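(* Let $d\ge1$, $w\in\mathbb R$, $k\in(0,2\pi)\setminus\{\pi\}$, and let $V=(V(n))_{n\in\mathbb Z^d}$ be a bounded real-valued sequence. Assume there are $m\in\mathbb N$ and $0\le r<q$ such that, as $|n|\to+\infty$, $$V(n)=O\Big(\ln_{m+1}^{-q}(|n|)\prod_{j=0}^m\ln_j^{-r}(|n|)\Big)\quad\text{and}\quad n_i(V-\tau_iV)(n)=O\Big(\ln_{m+1}^{-q}(|n|)\prod_{j=0}^m\ln_j^{-r}(|n|)\Big)\ \ \forall\,1\le i\le d .$$ Let $H=\Delta+V+W$. If $E\in\mu(H)$, then there is an open interval $I$ containing $E$ that contains at most finitely many eigenvalues of $H$ (including multiplicities). The corresponding eigenfunctions, if any, decay sub-exponentially. Also, in dimension $d=1$ the point spectrum of $H$ is empty in $I$ whenever $I\subset(E_-(k),E_+(k))$.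
   Context: $\mathbb N=\{0,1,2,\dots\}$. $\mathscr H=\ell^2(\mathbb Z^d)$; for $n=(n_1,\dots,n_d)\in\mathbb Z^d$, $|n|^2=n_1^2+\dots+n_d^2$, $\langle n\rangle=\sqrt{1+|n|^2}$. Iterated logarithms on $[1,+\infty)$: $\ln_0(x):=1$, $\ln_1(x):=\ln(1+x)$, $\ln_j(x):=\ln(1+\ln_{j-1}(x))$ for $j\ge2$; $\ln_j^p(x):=(\ln_j(x))^p$. Operators on $\mathscr H$: $(S_i\psi)(n)=\psi(n_1,\dots,n_i-1,\dots,n_d)$, with adjoint $S_i^*=S_i^{-1}$. $\Delta=\sum_{i=1}^d(2-S_i-S_i^* )$. $V$ is multiplication by $V(n)$; $(\tau_iV)(n)=V(n_1,\dots,n_i-1,\dots,n_d)$. $(W\psi)(n)=w\sin(k(n_1+\dots+n_d))|n|^{-1}\psi(n)$ for $n\ne0$, $(W\psi)(0)=0$. Energies: $E_\pm(k):=2\pm2\cos(k/2)$; $E(k):=2E_-(k)$ if $k\in(0,\pi)$ and $E(k):=2E_+(k)$ if $k\in(\pi,2\pi)$. If $d=1$, $\mu(H):=(0,4)\setminus\{E_\pm(k)\}$; if $d\ge2$, $\mu(H):=(0,E(k))\cup(4d-E(k),4d)$. A sequence $\psi\in\ell^2(\mathbb Z^d)$ decays sub-exponentially if there are $c>0$ and $\gamma\in(0,1)$ such that $\sum_{n}e^{2c\langle n\rangle^\gamma}|\psi(n)|^2<\infty$. *)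

theory Defs
  imports "HOL-Analysis.Analysis" "HOL-Library.Landau_Symbols" "HOL-Library.Function_Algebras"
begin

text \<open>The lattice of dimension \<open>d\<close> is \<open>int ^ 'd\<close> with \<open>CARD('d) = d\<close>.\<close>

definition lnorm :: "int ^ 'd \<Rightarrow> real" where
  "lnorm n = sqrt (\<Sum>i\<in>UNIV. (real_of_int (n $ i))\<^sup>2)"

definition jbracket :: "int ^ 'd \<Rightarrow> real" where
  "jbracket n = sqrt (1 + (lnorm n)\<^sup>2)"

definition at_inf_lattice :: "(int ^ 'd) filter" where
  "at_inf_lattice = filtercomap lnorm at_top"

text \<open>Iterated logarithms. The level-zero function is the constant 1, so level one
  is not obtained from it by the recursion; only arguments \<open>x \<ge> 1\<close> are meaningful.\<close>

fun iter_ln :: "nat \<Rightarrow> real \<Rightarrow> real" where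
  "iter_ln 0 x = 1"
| "iter_ln (Suc 0) x = ln (1 + x)"
| "iter_ln (Suc (Suc j)) x = ln (1 + iter_ln (Suc j) x)"

definition log_rate :: "nat \<Rightarrow> real \<Rightarrow> real \<Rightarrow> real \<Rightarrow> real" where
  "log_rate m q r x = iter_ln (m + 1) x powr (- q) * (\<Prod>j=0..m. iter_ln j x powr (- r))"

text \<open>Operators are given by their action on all functions on the lattice; as operators
  on the Hilbert space they are restricted to \<open>ell2\<close>. They are bounded there when
  the potential is, so no further domain condition arises.\<close>

definition ell2 :: "(int ^ 'd \<Rightarrow> complex) set" where
  "ell2 = {\<psi>. (\<lambda>n. (cmod (\<psi> n))\<^sup>2) summable_on UNIV}"

text \<open>\<open>shift\<close> is polymorphic in the values: it is \<open>S_i\<close> on wave functions and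
  \<open>\<tau>_i\<close> on potentials.\<close>

definition shift :: "'d \<Rightarrow> (int ^ 'd \<Rightarrow> 'a) \<Rightarrow> int ^ 'd \<Rightarrow> 'a" where
  "shift i f n = f (n - axis i 1)"

definition shift_adj :: "'d \<Rightarrow> (int ^ 'd \<Rightarrow> 'a) \<Rightarrow> int ^ 'd \<Rightarrow> 'a" where
  "shift_adj i f n = f (n + axis i 1)"

definition laplacian :: "(int ^ 'd \<Rightarrow> complex) \<Rightarrow> int ^ 'd \<Rightarrow> complex" where
  "laplacian \<psi> n = (\<Sum>i\<in>UNIV. 2 * \<psi> n - shift i \<psi> n - shift_adj i \<psi> n)"

definition mult_op :: "(int ^ 'd \<Rightarrow> real) \<Rightarrow> (int ^ 'd \<Rightarrow> complex) \<Rightarrow> int ^ 'd \<Rightarrow> complex" where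
  "mult_op V \<psi> n = of_real (V n) * \<psi> n"

definition wigner_von_neumann :: "real \<Rightarrow> real \<Rightarrow> int ^ 'd \<Rightarrow> real" where
  "wigner_von_neumann w k n =
     (if n = 0 then 0 else w * sin (k * real_of_int (\<Sum>i\<in>UNIV. n $ i)) / lnorm n)"

definition hamiltonian ::
    "(int ^ 'd \<Rightarrow> real) \<Rightarrow> real \<Rightarrow> real \<Rightarrow> (int ^ 'd \<Rightarrow> complex) \<Rightarrow> int ^ 'd \<Rightarrow> complex" where
  "hamiltonian V w k \<psi> n =
     laplacian \<psi> n + mult_op V \<psi> n + mult_op (wigner_von_neumann w k) \<psi> n"

definition E_minus :: "real \<Rightarrow> real" where
  "E_minus k = 2 - 2 * cos (k / 2)"

definition E_plus :: "real \<Rightarrow> real" where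
  "E_plus k = 2 + 2 * cos (k / 2)"

text \<open>Only used for \<open>k\<close> in \<open>(0, 2 * pi)\<close> different from \<open>pi\<close>.\<close>

definition E_edge :: "real \<Rightarrow> real" where
  "E_edge k = (if k < pi then 2 * E_minus k else 2 * E_plus k)"

definition mu_H :: "nat \<Rightarrow> real \<Rightarrow> real set" where
  "mu_H d k =
     (if d = 1 then {0<..<4} - {E_minus k, E_plus k}
      else {0<..<E_edge k} \<union> {4 * real d - E_edge k<..<4 * real d})"

definition cscale :: "complex \<Rightarrow> ('n \<Rightarrow> complex) \<Rightarrow> 'n \<Rightarrow> complex" where
  "cscale c \<psi> = (\<lambda>n. c * \<psi> n)"

interpretation cfun: vector_space cscale
  by unfold_locales (auto simp: cscale_def algebra_simps plus_fun_def)

definition finite_dimensional :: "('n \<Rightarrow> complex) set \<Rightarrow> bool" where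
  "finite_dimensional U \<longleftrightarrow> (\<exists>B. finite B \<and> U \<subseteq> cfun.span B)"

text \<open>Real spectral parameters suffice: the operators considered are self-adjoint.\<close>

definition eigenspace ::
    "((int ^ 'd \<Rightarrow> complex) \<Rightarrow> int ^ 'd \<Rightarrow> complex) \<Rightarrow> real \<Rightarrow> (int ^ 'd \<Rightarrow> complex) set" where
  "eigenspace T \<nu> = {\<psi> \<in> ell2. T \<psi> = cscale (of_real \<nu>) \<psi>}"

definition point_spectrum ::
    "((int ^ 'd \<Rightarrow> complex) \<Rightarrow> int ^ 'd \<Rightarrow> complex) \<Rightarrow> real set" where
  "point_spectrum T = {\<nu>. \<exists>\<psi>\<in>eigenspace T \<nu>. \<psi> \<noteq> 0}"

definition finitely_many_eigenvalues_in ::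
    "((int ^ 'd \<Rightarrow> complex) \<Rightarrow> int ^ 'd \<Rightarrow> complex) \<Rightarrow> real set \<Rightarrow> bool" where
  "finitely_many_eigenvalues_in T I \<longleftrightarrow>
     finite (point_spectrum T \<inter> I) \<and>
     (\<forall>\<nu>\<in>point_spectrum T \<inter> I. finite_dimensional (eigenspace T \<nu>))"

definition decays_subexponentially :: "(int ^ 'd \<Rightarrow> complex) \<Rightarrow> bool" where
  "decays_subexponentially \<psi> \<longleftrightarrow>
     (\<exists>c>0. \<exists>\<gamma>\<in>{0<..<1}.
        (\<lambda>n. exp (2 * c * jbracket n powr \<gamma>) * (cmod (\<psi> n))\<^sup>2) summable_on UNIV)"

end

theory Submission
  imports Defs
begin

text \<open>
  Since \<open>r < q\<close> and \<open>0 \<le> r\<close>, the rate tends to zero, so that \<open>V\<close> and all \<open>n_i (V - \<tau>_i V)\<close> tend to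
  zero at infinity. The proof works with these two limits and avoids spectral calculus.

  Dimension at least two. Let \<open>A\<close> be the antisymmetric generator of dilations (\<open>dil\<close>). For finitely
  supported \<open>v\<close> one has \<open>- 2 \<langle>\<Delta>v, Av\<rangle> \<ge> 4 \<langle>v, \<Delta>v\<rangle> - \<parallel>\<Delta>v\<parallel>\<^sup>2\<close> (\<open>positive_commutator\<close>), and the right-hand
  side is close to \<open>\<nu> (4 - \<nu>) \<parallel>v\<parallel>\<^sup>2\<close> when \<open>\<Delta>v\<close> is close to \<open>\<nu>v\<close>, with \<open>0 < \<nu> < 4\<close>. The commutator
  of \<open>A\<close> with \<open>V\<close> is small at infinity. The commutator with \<open>W\<close> is not, because \<open>W\<close> decays only
  like \<open>1 / |n|\<close>, but its leading part is a pairing of two approximate solutions of \<open>\<Delta>x = \<nu>x\<close> through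
  the factor \<open>sin (k (n_1 + ... + n_d))\<close>. Multiplication by \<open>exp (i k (n_1 + ... + n_d))\<close> turns \<open>\<Delta>\<close> into a
  twisted Laplacian, the sum of the two is at least \<open>4 d (1 - |cos (k/2)|)\<close>, and this exceeds \<open>2 \<nu>\<close>
  for \<open>\<nu>\<close> near an energy below \<open>E(k)\<close>. Hence no function has energy \<open>\<nu>\<close> for both operators and
  the pairing is small (\<open>nonresonance\<close>).

  The same computation is done for \<open>exp F (H - \<nu>) exp (- F)\<close>, where \<open>F\<close> is a bounded regularisation of
  \<open>\<langle>n\<rangle> powr (1/4) / 2\<close>. Up to terms that vanish at infinity the conjugation adds \<open>- g A\<close> with \<open>g \<ge> 0\<close>,
  and this contributes the nonnegative quantity \<open>\<langle>g Av, Av\<rangle>\<close>. The outcome (\<open>carleman\<close>) bounds \<open>v\<close> by its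
  restriction to a finite set and by \<open>\<langle>n\<rangle>\<close> times the conjugated equation, with constants that depend
  neither on the regularisation nor on \<open>\<nu>\<close> near \<open>E\<close>. Applied to \<open>v = exp F \<chi> u\<close> with an
  eigenfunction \<open>u\<close> and wide cutoffs \<open>\<chi>\<close>, it bounds the sum of \<open>exp (\<langle>n\<rangle> powr (1/4)) |u|\<^sup>2\<close> by a
  multiple of the sum of \<open>|u|\<^sup>2\<close> over a fixed finite set \<open>B\<close> (\<open>low_energy_estimate\<close>). This
  gives everything at once: decay; finite multiplicity, because an eigenfunction that vanishes on \<open>B\<close>
  is zero; and finitely many eigenvalues, because by Bessel's inequality orthonormal functions with at
  least a fixed mass on \<open>B\<close> are bounded in number (\<open>concentrated_eigenfunctions\<close>). Energies near \<open>4 d\<close> are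
  reduced to energies near zero by the sign \<open>(-1) ^ (n_1 + ... + n_d)\<close>, which replaces \<open>\<Delta>\<close> by \<open>4 d - \<Delta>\<close>.

  Dimension one. No admissible energy is an eigenvalue (\<open>no_eigenfunctions_dim_1\<close>). A positive
  quadratic form \<open>G\<close> in \<open>(u n, u (n + 1))\<close> changes along a solution by \<open>o(1/n) G\<close> and by a term of size
  \<open>1/n\<close> that oscillates with the phases \<open>2 \<theta> \<plusminus> k\<close>, where \<open>\<nu> = 2 - 2 cos \<theta>\<close>. Away from \<open>E_\<plusminus>(k)\<close> these
  phases are not multiples of \<open>2 \<pi>\<close>, and summation by parts absorbs the oscillating term into
  a corrected form \<open>T\<close>. Then \<open>n T n\<close> eventually increases, so a nonzero solution is not square summable.
\<close>

section \<open>Finitely supported functions on the lattice as an inner product space\<close>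

text \<open>All commutator computations take place on finitely supported functions, where sums can be rearranged
  freely and unbounded multiplication operators cause no domain questions. The inner product is the
  real part of the usual one: over the reals it makes complex-valued functions an instance of
  \<open>real_inner\<close>, and only real parts occur in the estimates.\<close>

typedef 'd fsf = "{f :: int ^ 'd \<Rightarrow> complex. finite {n. f n \<noteq> 0}}"
  morphisms val Fsf
  by (rule exI[of _ "\<lambda>_. 0"]) simp

setup_lifting type_definition_fsf

definition supp :: "'d fsf \<Rightarrow> (int ^ 'd) set" where
  "supp f = {n. val f n \<noteq> 0}"

lemma finite_supp [simp]: "finite (supp f)"
  using val[of f] by (simp add: supp_def)

lemma finite_nonzero [simp]: "finite {n. val f n \<noteq> 0}"
  using val[of f] by simp

lemma fsf_eqI: "(\<And>n. val f n = val g n) \<Longrightarrow> f = g"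
  by (metis ext val_inject)

instantiation fsf :: (finite) real_vector
begin

lift_definition zero_fsf :: "'a fsf" is "\<lambda>_. 0" by simp

lift_definition plus_fsf :: "'a fsf \<Rightarrow> 'a fsf \<Rightarrow> 'a fsf" is "\<lambda>f g n. f n + g n"
  by (erule (1) finite_subset[OF _ finite_UnI, rotated]) auto

lift_definition minus_fsf :: "'a fsf \<Rightarrow> 'a fsf \<Rightarrow> 'a fsf" is "\<lambda>f g n. f n - g n"
  by (erule (1) finite_subset[OF _ finite_UnI, rotated]) auto

lift_definition uminus_fsf :: "'a fsf \<Rightarrow> 'a fsf" is "\<lambda>f n. - f n" by simp

lift_definition scaleR_fsf :: "real \<Rightarrow> 'a fsf \<Rightarrow> 'a fsf" is "\<lambda>a f n. a *\<^sub>R f n"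
  by (rule finite_subset) auto

instance
  by standard (transfer; simp add: fun_eq_iff algebra_simps scaleR_add_right scaleR_add_left)+

end

instantiation fsf :: (finite) real_inner
begin

definition inner_fsf :: "'a fsf \<Rightarrow> 'a fsf \<Rightarrow> real" where
  "inner_fsf f g = (\<Sum>n\<in>supp f. val f n \<bullet> val g n)"

definition norm_fsf :: "'a fsf \<Rightarrow> real" where
  "norm_fsf f = sqrt (inner f f)"

definition sgn_fsf :: "'a fsf \<Rightarrow> 'a fsf" where
  "sgn_fsf f = inverse (norm f) *\<^sub>R f"

definition dist_fsf :: "'a fsf \<Rightarrow> 'a fsf \<Rightarrow> real" where
  "dist_fsf f g = norm (f - g)"

definition uniformity_fsf :: "('a fsf \<times> 'a fsf) filter" where
  "uniformity_fsf = (INF e\<in>{0<..}. principal {(x, y). dist x y < e})"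

definition open_fsf :: "'a fsf set \<Rightarrow> bool" where
  "open_fsf U = (\<forall>x\<in>U. eventually (\<lambda>(x', y). x' = x \<longrightarrow> y \<in> U) uniformity)"

lemma inner_fsf_superset:
  assumes "finite A" "supp f \<subseteq> A"
  shows "inner f g = (\<Sum>n\<in>A. val f n \<bullet> val g n)"
  unfolding inner_fsf_def
  by (rule sum.mono_neutral_left) (use assms in \<open>auto simp: supp_def\<close>)

instance
proof
  fix x y z :: "'a fsf" and r :: real
  let ?A = "supp x \<union> supp y \<union> supp z \<union> supp (x + y)"
  have fA: "finite ?A" by simp
  show "inner x y = inner y x"
    by (subst (1 2) inner_fsf_superset[OF fA]) (auto simp: inner_commute)
  show "inner (x + y) z = inner x z + inner y z"
    by (subst (1 2 3) inner_fsf_superset[OF fA])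
       (auto simp: plus_fsf.rep_eq inner_add_left sum.distrib)
  show "inner (r *\<^sub>R x) y = r * inner x y"
    by (subst (1 2) inner_fsf_superset[of "supp x"])
       (auto simp: scaleR_fsf.rep_eq sum_distrib_left supp_def)
  show "0 \<le> inner x x"
    by (simp add: inner_fsf_def sum_nonneg)
  show "(inner x x = 0) = (x = 0)"
  proof
    assume "inner x x = 0"
    then have "\<forall>n\<in>supp x. val x n \<bullet> val x n = 0"
      unfolding inner_fsf_def by (subst (asm) sum_nonneg_eq_0_iff) auto
    then have "val x n = 0" for n by (auto simp: supp_def)
    then show "x = 0" by (intro fsf_eqI) (simp add: zero_fsf.rep_eq)
  qed (simp add: inner_fsf_def supp_def zero_fsf.rep_eq)
  show "norm x = sqrt (inner x x)" by (rule norm_fsf_def)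
qed (rule sgn_fsf_def dist_fsf_def uniformity_fsf_def open_fsf_def)+

end

lemmas val_simps [simp] =
  zero_fsf.rep_eq plus_fsf.rep_eq minus_fsf.rep_eq uminus_fsf.rep_eq scaleR_fsf.rep_eq

lemma val_sum [simp]: "val (\<Sum>i\<in>I. f i) n = (\<Sum>i\<in>I. val (f i) n)"
  by (induction I rule: infinite_finite_induct) auto

lemma norm_fsf_superset:
  assumes "finite A" "supp f \<subseteq> A"
  shows "(norm f)\<^sup>2 = (\<Sum>n\<in>A. (cmod (val f n))\<^sup>2)"
  unfolding power2_norm_eq_inner by (rule inner_fsf_superset[OF assms])

lemma norm_fsf_mono:
  assumes "\<And>n. cmod (val f n) \<le> cmod (val g n)"
  shows "norm f \<le> norm g"
proof (rule power2_le_imp_le)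
  show "(norm f)\<^sup>2 \<le> (norm g)\<^sup>2"
    by (subst (1 2) norm_fsf_superset[of "supp f \<union> supp g"])
       (auto intro!: sum_mono power_mono assms)
qed simp

section \<open>Translations and multiplication operators\<close>

lift_definition tr :: "int ^ 'd \<Rightarrow> 'd fsf \<Rightarrow> 'd fsf" is "\<lambda>s f n. f (n - s)"
proof -
  fix s :: "int ^ 'd" and f :: "int ^ 'd \<Rightarrow> complex"
  assume "finite {n. f n \<noteq> 0}"
  moreover have "{n. f (n - s) \<noteq> 0} = (\<lambda>n. n + s) ` {n. f n \<noteq> 0}"
    by (auto simp: image_iff) (metis diff_add_cancel)
  ultimately show "finite {n. f (n - s) \<noteq> 0}" by simp
qed

lift_definition mul :: "(int ^ 'd \<Rightarrow> complex) \<Rightarrow> 'd fsf \<Rightarrow> 'd fsf" is "\<lambda>b f n. b n * f n"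
  by (rule finite_subset) auto

abbreviation rmul :: "(int ^ 'd \<Rightarrow> real) \<Rightarrow> 'd fsf \<Rightarrow> 'd fsf" where
  "rmul b \<equiv> mul (\<lambda>n. of_real (b n))"

declare tr.rep_eq [simp] mul.rep_eq [simp]

lemma tr_tr [simp]: "tr s (tr t f) = tr (s + t) f"
  by (rule fsf_eqI) (simp add: algebra_simps)

lemma tr_0 [simp]: "tr 0 f = f"
  by (rule fsf_eqI) simp

lemma linear_tr: "linear (tr s)"
  by (rule linearI) (auto intro: fsf_eqI)

lemma linear_mul: "linear (mul b)"
  by (rule linearI) (auto intro: fsf_eqI simp: algebra_simps)

lemmas tr_linear = linear_add[OF linear_tr] linear_diff[OF linear_tr] linear_neg[OF linear_tr]
  linear_scale[OF linear_tr] linear_sum[OF linear_tr] linear_0[OF linear_tr]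
lemmas mul_linear = linear_add[OF linear_mul] linear_diff[OF linear_mul] linear_neg[OF linear_mul]
  linear_scale[OF linear_mul] linear_sum[OF linear_mul] linear_0[OF linear_mul]

lemma supp_tr: "supp (tr s f) = (\<lambda>n. n + s) ` supp f"
  by (auto simp: supp_def image_iff) (metis diff_add_cancel)

lemma inner_tr: "tr s f \<bullet> g = f \<bullet> tr (- s) g"
proof -
  have "tr s f \<bullet> g = (\<Sum>n\<in>(\<lambda>n. n + s) ` supp f. val f (n - s) \<bullet> val g n)"
    by (simp add: inner_fsf_def supp_tr)
  also have "\<dots> = (\<Sum>n\<in>supp f. val f n \<bullet> val g (n + s))"
    by (subst sum.reindex) (auto simp: inj_on_def)
  finally show ?thesis by (simp add: inner_fsf_def)
qed

lemma inner_tr': "f \<bullet> tr s g = tr (- s) f \<bullet> g"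
  by (simp add: inner_tr)

lemma norm_tr [simp]: "norm (tr s f) = norm f"
  by (simp add: norm_eq_sqrt_inner inner_tr)

lemma inner_mul: "mul b f \<bullet> g = f \<bullet> mul (\<lambda>n. cnj (b n)) g"
proof -
  have "mul b f \<bullet> g = (\<Sum>n\<in>supp f. val (mul b f) n \<bullet> val g n)"
    by (rule inner_fsf_superset) (auto simp: supp_def)
  also have "\<dots> = f \<bullet> mul (\<lambda>n. cnj (b n)) g"
    unfolding inner_fsf_def by (intro sum.cong) (auto simp: inner_complex_def algebra_simps)
  finally show ?thesis .
qed

lemma inner_rmul: "rmul b f \<bullet> g = f \<bullet> rmul b g"
  by (simp add: inner_mul)

lemma norm_mul_le:
  assumes "\<And>n. cmod (b n) \<le> C"
  shows "norm (mul b f) \<le> C * norm f"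
proof -
  have C: "0 \<le> C" using assms[of undefined] norm_ge_zero order_trans by blast
  have "norm (mul b f) \<le> norm (C *\<^sub>R f)"
    using assms C by (intro norm_fsf_mono) (auto simp: norm_mult intro!: mult_right_mono)
  then show ?thesis using C by simp
qed

lemma norm_rmul_le:
  assumes "\<And>n. \<bar>b n\<bar> \<le> C"
  shows "norm (rmul b f) \<le> C * norm f"
  by (rule norm_mul_le) (simp add: assms)

lemma mul_mul [simp]: "mul a (mul b f) = mul (\<lambda>n. a n * b n) f"
  by (rule fsf_eqI) simp

lemma tr_mul: "tr s (mul b f) = mul (\<lambda>n. b (n - s)) (tr s f)"
  by (rule fsf_eqI) simp

section \<open>The free Laplacian and the generator of dilations\<close>

abbreviation unit :: "'d \<Rightarrow> int ^ 'd" where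
  "unit i \<equiv> axis i 1"

definition lap1 :: "'d::finite \<Rightarrow> 'd fsf \<Rightarrow> 'd fsf" where
  "lap1 i f = 2 *\<^sub>R f - tr (unit i) f - tr (- unit i) f"

definition lap :: "'d::finite fsf \<Rightarrow> 'd fsf" where
  "lap f = (\<Sum>i\<in>UNIV. lap1 i f)"

definition dil1 :: "'d::finite \<Rightarrow> 'd fsf \<Rightarrow> 'd fsf" where
  "dil1 i f = rmul (\<lambda>n. of_int (n $ i) - 1/2) (tr (unit i) f)
            - rmul (\<lambda>n. of_int (n $ i) + 1/2) (tr (- unit i) f)"

definition dil :: "'d::finite fsf \<Rightarrow> 'd fsf" where
  "dil f = (\<Sum>i\<in>UNIV. dil1 i f)"

lemma linear_lap1: "linear (lap1 i)"
  by (rule linearI) (simp_all add: lap1_def tr_linear algebra_simps)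

lemma linear_lap: "linear lap"
  unfolding lap_def by (intro linear_compose_sum ballI linear_lap1)

lemma inner_lap1: "lap1 i f \<bullet> g = f \<bullet> lap1 i g"
  by (simp add: lap1_def inner_diff_left inner_diff_right inner_tr)

lemma inner_lap: "lap f \<bullet> g = f \<bullet> lap g"
  by (simp add: lap_def inner_sum_left inner_sum_right inner_lap1)

lemma inner_dil1: "dil1 i f \<bullet> g = - (f \<bullet> dil1 i g)"
proof -
  have 1: "rmul (\<lambda>n. of_int (n $ i) - 1/2) (tr (unit i) f) \<bullet> g
      = f \<bullet> rmul (\<lambda>n. of_int (n $ i) + 1/2) (tr (- unit i) g)"
    unfolding inner_rmul inner_tr tr_mul by (simp add: axis_def algebra_simps)
  have 2: "rmul (\<lambda>n. of_int (n $ i) + 1/2) (tr (- unit i) f) \<bullet> g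
      = f \<bullet> rmul (\<lambda>n. of_int (n $ i) - 1/2) (tr (unit i) g)"
    unfolding inner_rmul inner_tr tr_mul by (simp add: axis_def algebra_simps)
  show ?thesis
    unfolding dil1_def inner_diff_left inner_diff_right 1 2 by simp
qed

lemma inner_dil: "dil f \<bullet> g = - (f \<bullet> dil g)"
  by (simp add: dil_def inner_sum_left inner_sum_right inner_dil1 sum_negf)

lemma inner_dil_self: "f \<bullet> dil f = 0"
  using inner_dil[of f f] by (simp add: inner_commute)

lemma lap1_dil1_commute: "i \<noteq> j \<Longrightarrow> lap1 j (dil1 i f) = dil1 i (lap1 j f)"
  by (rule fsf_eqI) (simp add: lap1_def dil1_def axis_def algebra_simps)

lemma lap1_dil1_commutator:
  "lap1 i (dil1 i f) - dil1 i (lap1 i f) = lap1 i (lap1 i f) - 4 *\<^sub>R lap1 i f"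
  by (rule fsf_eqI) (simp add: lap1_def dil1_def axis_def algebra_simps scaleR_conv_of_real)

text \<open>Pairing a symmetric with an antisymmetric operator gives half their commutator. It vanishes across
  different coordinates, and within one coordinate it is \<open>\<Delta>_i\<^sup>2 - 4 \<Delta>_i\<close>.\<close>

lemma inner_lap1_dil1:
  "2 * (lap1 j v \<bullet> dil1 i v) = (if i = j then (norm (lap1 i v))\<^sup>2 - 4 * (v \<bullet> lap1 i v) else 0)"
proof -
  have "2 * (lap1 j v \<bullet> dil1 i v) = v \<bullet> (lap1 j (dil1 i v) - dil1 i (lap1 j v))"
    using inner_lap1[of j v "dil1 i v"] inner_dil1[of i v "lap1 j v"]
    by (simp add: inner_diff_right inner_commute)
  also have "\<dots> = (if i = j then (norm (lap1 i v))\<^sup>2 - 4 * (v \<bullet> lap1 i v) else 0)"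
  proof (cases "i = j")
    case True
    have "v \<bullet> (lap1 i (dil1 i v) - dil1 i (lap1 i v)) = (norm (lap1 i v))\<^sup>2 - 4 * (v \<bullet> lap1 i v)"
      unfolding lap1_dil1_commutator by (simp add: inner_diff_right power2_norm_eq_inner inner_lap1)
    then show ?thesis using True by simp
  qed (simp add: lap1_dil1_commute)
  finally show ?thesis .
qed

text \<open>The operators \<open>\<Delta>_i\<close> are commuting squares \<open>\<nabla>_i\<^sup>* \<nabla>_i\<close>, so the pairing is \<open>\<parallel>\<nabla>_j \<nabla>_i v\<parallel>\<^sup>2\<close>.\<close>

lemma inner_lap1_lap1_nonneg: "0 \<le> lap1 i v \<bullet> lap1 j v"
proof -
  define d where "d i f = f - tr (unit i) f" for i and f :: "'a fsf"
  define d' where "d' i f = f - tr (- unit i) f" for i and f :: "'a fsf"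
  have l: "lap1 i f = d' i (d i f)" for i f
    by (rule fsf_eqI) (simp add: d_def d'_def lap1_def scaleR_conv_of_real)
  have adj: "d' i f \<bullet> g = f \<bullet> d i g" for i f g
    by (simp add: d_def d'_def inner_diff_left inner_diff_right inner_tr)
  have c: "d i (d' j f) = d' j (d i f)" "d i (d j f) = d j (d i f)" for i j f
    by (rule fsf_eqI; simp add: d_def d'_def algebra_simps)+
  have "lap1 i v \<bullet> lap1 j v = d j (d i v) \<bullet> d j (d i v)"
    by (metis l adj c inner_commute)
  then show ?thesis by simp
qed

text \<open>The commutator is the sum of \<open>\<Delta>_i (4 - \<Delta>_i)\<close>; dropping the nonnegative cross terms in \<open>\<Delta>\<^sup>2\<close> leaves
  \<open>\<Delta> (4 - \<Delta>)\<close>, a function of the total energy. This is positive for energies between 0 and 4.\<close>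

lemma positive_commutator:
  "4 * (v \<bullet> lap v) - (norm (lap v))\<^sup>2 \<le> - 2 * (lap v \<bullet> dil v)"
proof -
  have "2 * (lap v \<bullet> dil v) = (\<Sum>i\<in>UNIV. \<Sum>j\<in>UNIV. 2 * (lap1 j v \<bullet> dil1 i v))"
    by (simp add: lap_def dil_def inner_sum_left inner_sum_right sum_distrib_left)
  also have "\<dots> = (\<Sum>j\<in>UNIV. (norm (lap1 j v))\<^sup>2 - 4 * (v \<bullet> lap1 j v))"
    by (simp add: inner_lap1_dil1)
  finally have A: "2 * (lap v \<bullet> dil v) = (\<Sum>j\<in>UNIV. (norm (lap1 j v))\<^sup>2) - 4 * (v \<bullet> lap v)"
    by (simp add: sum_subtractf lap_def inner_sum_right sum_distrib_left)
  have "(\<Sum>j\<in>UNIV. (norm (lap1 j v))\<^sup>2) = (\<Sum>j\<in>UNIV. \<Sum>i\<in>{j}. lap1 i v \<bullet> lap1 j v)"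
    by (simp add: power2_norm_eq_inner)
  also have "\<dots> \<le> (\<Sum>j\<in>UNIV. \<Sum>i\<in>UNIV. lap1 i v \<bullet> lap1 j v)"
    by (intro sum_mono sum_mono2) (auto simp: inner_lap1_lap1_nonneg)
  also have "\<dots> = (norm (lap v))\<^sup>2"
    by (simp add: power2_norm_eq_inner lap_def inner_sum_left inner_sum_right)
  finally show ?thesis using A by simp
qed

section \<open>Low energies and the oscillating factor\<close>

text \<open>The Laplacian conjugated by the phase factor \<open>exp (i \<theta> (n_1 + ... + n_d))\<close>; see \<open>lap_tw_modulate\<close>.\<close>

definition lap_tw :: "real \<Rightarrow> 'd::finite fsf \<Rightarrow> 'd fsf" where
  "lap_tw \<theta> f = (\<Sum>i\<in>UNIV. 2 *\<^sub>R f - mul (\<lambda>_. cis \<theta>) (tr (unit i) f)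
                                 - mul (\<lambda>_. cis (- \<theta>)) (tr (- unit i) f))"

text \<open>The difference between \<open>4 d\<close> and the sum of the Laplacian and its twist. Adjacent sites are
  coupled with strength \<open>|1 + exp (i \<theta>)| = 2 |cos (\<theta>/2)|\<close> only, which is where the constant in \<open>E(k)\<close> comes from.\<close>

definition hop :: "real \<Rightarrow> 'd::finite fsf \<Rightarrow> 'd fsf" where
  "hop \<theta> f = (\<Sum>i\<in>UNIV. mul (\<lambda>_. 1 + cis \<theta>) (tr (unit i) f)
                            + mul (\<lambda>_. 1 + cis (- \<theta>)) (tr (- unit i) f))"

lemma hop_eq: "hop \<theta> f = (4 * real CARD('d)) *\<^sub>R (f :: 'd::finite fsf) - lap f - lap_tw \<theta> f"
  by (rule fsf_eqI)
     (simp add: hop_def lap_def lap1_def lap_tw_def sum.distrib sum_subtractf scaleR_conv_of_real algebra_simps)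

lemma cmod_1_plus_cis: "cmod (1 + cis \<theta>) = 2 * \<bar>cos (\<theta> / 2)\<bar>"
proof -
  have "1 + cis \<theta> = cis (\<theta>/2) * (cis (\<theta>/2) + cis (- (\<theta>/2)))"
    by (simp add: algebra_simps cis_mult)
  also have "cis (\<theta>/2) + cis (- (\<theta>/2)) = of_real (2 * cos (\<theta>/2))"
    by (simp add: complex_eq_iff)
  finally show ?thesis by (simp add: norm_mult)
qed

lemma norm_hop_le: "norm (hop \<theta> f) \<le> 4 * real CARD('d) * \<bar>cos (\<theta>/2)\<bar> * norm (f :: 'd::finite fsf)"
proof -
  have "norm (hop \<theta> f) \<le> (\<Sum>i\<in>(UNIV::'d set). 4 * \<bar>cos (\<theta>/2)\<bar> * norm f)"
    unfolding hop_def
  proof (rule sum_norm_le)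
    fix i :: 'd
    have "norm (mul (\<lambda>_. 1 + cis \<theta>) (tr (unit i) f)) \<le> 2 * \<bar>cos (\<theta>/2)\<bar> * norm (tr (unit i) f)"
      by (rule norm_mul_le) (simp add: cmod_1_plus_cis)
    moreover have "norm (mul (\<lambda>_. 1 + cis (- \<theta>)) (tr (- unit i) f))
        \<le> 2 * \<bar>cos (\<theta>/2)\<bar> * norm (tr (- unit i) f)"
      by (rule norm_mul_le) (subst cmod_1_plus_cis, simp)
    ultimately show "norm (mul (\<lambda>_. 1 + cis \<theta>) (tr (unit i) f)
        + mul (\<lambda>_. 1 + cis (- \<theta>)) (tr (- unit i) f)) \<le> 4 * \<bar>cos (\<theta>/2)\<bar> * norm f"
      by (intro norm_triangle_le) simp
  qed
  then show ?thesis by simp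
qed

lemma mul_const_tr: "mul (\<lambda>_. c) (tr s f) = tr s (mul (\<lambda>_. c) f)"
  by (simp add: tr_mul)

lemma linear_lap_tw: "linear (lap_tw \<theta>)"
  unfolding lap_tw_def
  by (intro linear_compose_sum ballI linear_compose_sub linear_compose[OF linear_tr linear_mul, unfolded o_def]
      linear_compose_scale_right linear_id[unfolded id_def])

lemma linear_hop: "linear (hop \<theta>)"
  unfolding hop_def
  by (intro linear_compose_sum ballI linear_compose_add linear_compose[OF linear_tr linear_mul, unfolded o_def])

lemma tr_lap1: "tr s (lap1 i f) = lap1 i (tr s f)"
  by (simp add: lap1_def tr_linear add.commute)

lemma tr_lap: "tr s (lap f) = lap (tr s f)"
  by (simp add: lap_def tr_linear tr_lap1)

lemma mul_const_lap: "mul (\<lambda>_. c) (lap f) = lap (mul (\<lambda>_. c) f)"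
  by (simp add: lap_def lap1_def mul_linear mul_const_tr)

lemma lap_lap_tw: "lap (lap_tw \<theta> f) = lap_tw \<theta> (lap f)"
  by (simp add: lap_tw_def linear_sum[OF linear_lap] linear_diff[OF linear_lap]
      linear_scale[OF linear_lap] tr_lap mul_const_lap)

text \<open>With \<open>M = hop\<close> and \<open>\<alpha> = 4 d - 2 \<nu>\<close>, the operator \<open>\<alpha> - M\<close> equals \<open>(\<Delta> - \<nu>) + (\<Delta>_\<theta> - \<nu>)\<close>, so its pairing with
  \<open>x\<close> and \<open>z\<close> is controlled by the two energy defects. As \<open>\<parallel>M\<parallel> \<le> \<beta> < \<alpha>\<close>, it is invertible; in place
  of the inverse the identity \<open>\<alpha> \<langle>x, z\<rangle> = \<langle>x, Mz\<rangle> + error\<close> is iterated, which is the Neumann series and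
  stays within finitely supported functions.\<close>

lemma nonresonance_tw:
  fixes x z :: "'d::finite fsf" and \<nu> \<theta> :: real
  defines "\<alpha> \<equiv> 4 * real CARD('d) - 2 * \<nu>" and "\<beta> \<equiv> 4 * real CARD('d) * \<bar>cos (\<theta>/2)\<bar>"
  assumes "\<beta> < \<alpha>"
  shows "(\<alpha> - \<beta>) * \<bar>x \<bullet> z\<bar>
       \<le> norm (lap x - \<nu> *\<^sub>R x) * norm z + norm x * norm (lap_tw \<theta> z - \<nu> *\<^sub>R z)"
proof -
  define \<eta> where "\<eta> z = norm (lap x - \<nu> *\<^sub>R x) * norm z + norm x * norm (lap_tw \<theta> z - \<nu> *\<^sub>R z)"
    for z :: "'d fsf"
  have b: "0 \<le> \<beta>" by (simp add: \<beta>_def)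
  have a: "0 < \<alpha>" using assms(3) b by simp
  have hop: "norm (hop \<theta> z) \<le> \<beta> * norm z" for z :: "'d fsf"
    using norm_hop_le[of \<theta> z] by (simp add: \<beta>_def)
  have step: "\<alpha> * \<bar>x \<bullet> z\<bar> \<le> \<bar>x \<bullet> hop \<theta> z\<bar> + \<eta> z" for z
  proof -
    have "\<alpha> * (x \<bullet> z) = x \<bullet> hop \<theta> z + (lap x - \<nu> *\<^sub>R x) \<bullet> z + x \<bullet> (lap_tw \<theta> z - \<nu> *\<^sub>R z)"
      by (simp add: hop_eq inner_diff_right inner_diff_left inner_lap \<alpha>_def algebra_simps)
    then have "\<bar>\<alpha> * (x \<bullet> z)\<bar> \<le> \<bar>x \<bullet> hop \<theta> z\<bar> + \<bar>(lap x - \<nu> *\<^sub>R x) \<bullet> z\<bar>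
        + \<bar>x \<bullet> (lap_tw \<theta> z - \<nu> *\<^sub>R z)\<bar>"
      by linarith
    also have "\<dots> \<le> \<bar>x \<bullet> hop \<theta> z\<bar> + \<eta> z"
      unfolding \<eta>_def using Cauchy_Schwarz_ineq2[of "lap x - \<nu> *\<^sub>R x" z]
        Cauchy_Schwarz_ineq2[of x "lap_tw \<theta> z - \<nu> *\<^sub>R z"] by linarith
    finally show ?thesis using a by (simp add: abs_mult)
  qed
  have \<eta>hop: "\<eta> (hop \<theta> z) \<le> \<beta> * \<eta> z" for z
  proof -
    have "lap_tw \<theta> (hop \<theta> z) - \<nu> *\<^sub>R hop \<theta> z = hop \<theta> (lap_tw \<theta> z - \<nu> *\<^sub>R z)"
      by (simp add: linear_diff[OF linear_hop] linear_scale[OF linear_hop])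
         (simp add: hop_eq linear_diff[OF linear_lap_tw] linear_scale[OF linear_lap_tw] lap_lap_tw)
    then have "\<eta> (hop \<theta> z) \<le> norm (lap x - \<nu> *\<^sub>R x) * (\<beta> * norm z)
        + norm x * (\<beta> * norm (lap_tw \<theta> z - \<nu> *\<^sub>R z))"
      unfolding \<eta>_def by (simp only:) (intro add_mono mult_left_mono hop norm_ge_zero)
    then show ?thesis by (simp add: \<eta>_def algebra_simps)
  qed
  have iter: "\<bar>x \<bullet> z\<bar> \<le> \<eta> z / (\<alpha> - \<beta>) + (\<beta> / \<alpha>) ^ N * (norm x * norm z)" for N z
  proof (induction N arbitrary: z)
    case 0
    have "0 \<le> \<eta> z / (\<alpha> - \<beta>)" using assms(3) by (simp add: \<eta>_def)
    then show ?case using Cauchy_Schwarz_ineq2[of x z] by simp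
  next
    case (Suc N)
    have "\<alpha> * \<bar>x \<bullet> z\<bar> \<le> \<eta> (hop \<theta> z) / (\<alpha> - \<beta>) + (\<beta> / \<alpha>) ^ N * (norm x * norm (hop \<theta> z)) + \<eta> z"
      using step[of z] Suc.IH[of "hop \<theta> z"] by linarith
    also have "\<dots> \<le> \<beta> * \<eta> z / (\<alpha> - \<beta>) + (\<beta> / \<alpha>) ^ N * (norm x * (\<beta> * norm z)) + \<eta> z"
      by (intro add_mono divide_right_mono mult_left_mono \<eta>hop hop order_refl norm_ge_zero)
         (use assms(3) a b in auto)
    also have "\<dots> = \<alpha> * (\<eta> z / (\<alpha> - \<beta>) + (\<beta> / \<alpha>) ^ Suc N * (norm x * norm z))"
      using assms(3) a by (simp add: field_simps)
    finally show ?case using a by simp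
  qed
  have "(\<lambda>N. \<eta> z / (\<alpha> - \<beta>) + (\<beta> / \<alpha>) ^ N * (norm x * norm z))
      \<longlonglongrightarrow> \<eta> z / (\<alpha> - \<beta>) + 0 * (norm x * norm z)"
    by (intro tendsto_intros LIMSEQ_realpow_zero) (use assms(3) a b in auto)
  then have "\<bar>x \<bullet> z\<bar> \<le> \<eta> z / (\<alpha> - \<beta>)"
    using iter by (intro LIMSEQ_le_const) (auto intro: exI[of _ 0])
  then show ?thesis using assms(3) by (simp add: \<eta>_def field_simps)
qed

definition phase :: "int ^ 'd \<Rightarrow> real" where
  "phase n = real_of_int (\<Sum>i\<in>UNIV. n $ i)"

lemma phase_unit [simp]: "phase (n - unit i) = phase n - 1" "phase (n + unit i) = phase n + 1"
  by (simp_all add: phase_def sum_subtractf sum.distrib axis_def sum.delta)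

lemma lap_tw_modulate:
  fixes y :: "'d::finite fsf"
  shows "lap_tw \<theta> (mul (\<lambda>n. c * cis (\<theta> * phase n)) y) = mul (\<lambda>n. c * cis (\<theta> * phase n)) (lap y)"
proof (rule fsf_eqI)
  fix n :: "int ^ 'd"
  have 1: "cis \<theta> * (cis (\<theta> * phase n - \<theta>) * X) = cis (\<theta> * phase n) * X" for X
    by (simp add: cis_mult flip: mult.assoc)
  have 2: "cis (- \<theta>) * (cis (\<theta> + \<theta> * phase n) * X) = cis (\<theta> * phase n) * X" for X
    by (simp add: cis_mult flip: mult.assoc)
  show "val (lap_tw \<theta> (mul (\<lambda>n. c * cis (\<theta> * phase n)) y)) n
      = val (mul (\<lambda>n. c * cis (\<theta> * phase n)) (lap y)) n"
    by (simp add: lap_tw_def lap_def lap1_def sum_distrib_left scaleR_conv_of_real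
        algebra_simps 1 2)
qed

text \<open>Writing the sine as a difference of exponentials reduces this to twists by \<open>k\<close> and by \<open>-k\<close>.\<close>

lemma nonresonance:
  fixes x y :: "'d::finite fsf" and \<nu> k :: real
  defines "\<alpha> \<equiv> 4 * real CARD('d) - 2 * \<nu>" and "\<beta> \<equiv> 4 * real CARD('d) * \<bar>cos (k/2)\<bar>"
  assumes "\<beta> < \<alpha>"
  shows "(\<alpha> - \<beta>) * \<bar>x \<bullet> rmul (\<lambda>n. sin (k * phase n)) y\<bar>
       \<le> norm (lap x - \<nu> *\<^sub>R x) * norm y + norm x * norm (lap y - \<nu> *\<^sub>R y)"
proof -
  define z where "z c \<theta> = mul (\<lambda>n. c * cis (\<theta> * phase n)) y" for c \<theta>
  have z: "2 * ((\<alpha> - \<beta>) * \<bar>x \<bullet> z c \<theta>\<bar>)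
      \<le> norm (lap x - \<nu> *\<^sub>R x) * norm y + norm x * norm (lap y - \<nu> *\<^sub>R y)"
    if c: "cmod c = 1/2" and \<theta>: "\<bar>cos (\<theta>/2)\<bar> = \<bar>cos (k/2)\<bar>" for c \<theta>
  proof -
    have n: "norm (mul (\<lambda>n. c * cis (\<theta> * phase n)) f) \<le> 1/2 * norm f" for f :: "'d fsf"
      by (rule norm_mul_le) (simp add: norm_mult c)
    have "lap_tw \<theta> (z c \<theta>) - \<nu> *\<^sub>R z c \<theta> = mul (\<lambda>n. c * cis (\<theta> * phase n)) (lap y - \<nu> *\<^sub>R y)"
      by (simp add: z_def lap_tw_modulate mul_linear)
    then have n2: "norm (lap_tw \<theta> (z c \<theta>) - \<nu> *\<^sub>R z c \<theta>) \<le> 1/2 * norm (lap y - \<nu> *\<^sub>R y)"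
      using n by simp
    have "(\<alpha> - \<beta>) * \<bar>x \<bullet> z c \<theta>\<bar> \<le> norm (lap x - \<nu> *\<^sub>R x) * norm (z c \<theta>)
        + norm x * norm (lap_tw \<theta> (z c \<theta>) - \<nu> *\<^sub>R z c \<theta>)"
      using nonresonance_tw[of \<theta> \<nu> x "z c \<theta>"] assms(3) \<theta> by (simp add: \<alpha>_def \<beta>_def)
    also have "\<dots> \<le> norm (lap x - \<nu> *\<^sub>R x) * (1/2 * norm y)
        + norm x * (1/2 * norm (lap y - \<nu> *\<^sub>R y))"
      using n[of y] n2 by (intro add_mono mult_left_mono) (auto simp: z_def)
    finally show ?thesis by simp
  qed
  \<comment> \<open>\<open>sin x = (exp (i x) - exp (- i x)) / (2 i)\<close>\<close>
  have "rmul (\<lambda>n. sin (k * phase n)) y = z (- \<i>/2) k + z (\<i>/2) (- k)"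
    by (rule fsf_eqI) (auto simp: z_def complex_eq_iff field_simps)
  then have "\<bar>x \<bullet> rmul (\<lambda>n. sin (k * phase n)) y\<bar> \<le> \<bar>x \<bullet> z (- \<i>/2) k\<bar> + \<bar>x \<bullet> z (\<i>/2) (- k)\<bar>"
    by (simp add: inner_add_right)
  then have "(\<alpha> - \<beta>) * \<bar>x \<bullet> rmul (\<lambda>n. sin (k * phase n)) y\<bar>
     \<le> (\<alpha> - \<beta>) * (\<bar>x \<bullet> z (- \<i>/2) k\<bar> + \<bar>x \<bullet> z (\<i>/2) (- k)\<bar>)"
    using assms(3) by (intro mult_left_mono) auto
  then show ?thesis using z[of "- \<i>/2" k] z[of "\<i>/2" "- k"] by (simp add: norm_divide distrib_left)
qed

section \<open>Norms on the lattice\<close>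

definition omega :: "'d \<Rightarrow> int ^ 'd \<Rightarrow> real" where
  "omega i n = of_int (n $ i) / lnorm n"

lemma lnorm_nonneg [simp]: "0 \<le> lnorm n"
  by (simp add: lnorm_def sum_nonneg)

lemma jbracket_ge_1 [simp]: "1 \<le> jbracket n"
  by (simp add: jbracket_def)

lemma jbracket_pos [simp]: "0 < jbracket n"
  using jbracket_ge_1[of n] by linarith

lemma lnorm_sq: "(lnorm n)\<^sup>2 = (\<Sum>i\<in>UNIV. (real_of_int (n $ i))\<^sup>2)"
  by (simp add: lnorm_def sum_nonneg)

lemma jbracket_sq: "(jbracket n)\<^sup>2 = 1 + (lnorm n)\<^sup>2"
  by (simp add: jbracket_def)

lemma coord_le_lnorm: "\<bar>real_of_int (n $ i)\<bar> \<le> lnorm n"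
  unfolding lnorm_def
proof (rule real_le_rsqrt)
  show "\<bar>real_of_int (n $ i)\<bar>\<^sup>2 \<le> (\<Sum>i\<in>UNIV. (real_of_int (n $ i))\<^sup>2)"
    unfolding power2_abs by (rule member_le_sum) auto
qed

lemma lnorm_le_jbracket: "lnorm n \<le> jbracket n"
  by (rule power2_le_imp_le) (auto simp: jbracket_sq intro: less_imp_le)

lemma coord_le_jbracket: "\<bar>real_of_int (n $ i)\<bar> \<le> jbracket n"
  using coord_le_lnorm lnorm_le_jbracket order_trans by blast

lemma lnorm_eq_0_iff: "lnorm n = 0 \<longleftrightarrow> n = 0"
proof
  assume "lnorm n = 0"
  then have "\<bar>real_of_int (n $ i)\<bar> \<le> 0" for i using coord_le_lnorm[of n i] by simp
  then show "n = 0" by (simp add: vec_eq_iff)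
qed (simp add: lnorm_def)

lemma abs_omega_le: "\<bar>omega i n\<bar> \<le> 1"
proof (cases "lnorm n = 0")
  case False
  then have "0 < lnorm n" using lnorm_nonneg[of n] by linarith
  then show ?thesis using coord_le_lnorm[of n i] by (simp add: omega_def)
qed (simp add: omega_def)

lemma wvn_eq: "wigner_von_neumann w k n = w * sin (k * phase n) / lnorm n"
  by (simp add: wigner_von_neumann_def phase_def lnorm_def)

lemma wvn_coord: "wigner_von_neumann w k n * of_int (n $ i) = w * (omega i n * sin (k * phase n))"
  by (simp add: wvn_eq omega_def)

lemma mul_1 [simp]: "mul (\<lambda>_. 1) f = f"
  by (rule fsf_eqI) simp

lemma abs_jbracket [simp]: "\<bar>jbracket n\<bar> = jbracket n"
  by (rule abs_of_pos) (rule jbracket_pos)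

lemma jbracket_nz [simp]: "jbracket n \<noteq> 0"
  using jbracket_pos[of n] by (metis less_irrefl)

section \<open>A weighted commutator estimate\<close>

text \<open>The form in which terms that are small at infinity enter: a coefficient below \<open>\<epsilon>\<close> outside a finite
  set costs \<open>\<epsilon>\<close> times the norm, plus a multiple of the mass near that set.\<close>

lemma norm_small_mul_tr:
  assumes off: "\<And>n. n \<notin> B0 \<Longrightarrow> \<bar>b n\<bar> \<le> \<epsilon>" and all: "\<And>n. \<bar>b n\<bar> \<le> C0"
    and nb: "\<And>n. n \<in> B0 \<Longrightarrow> n - s \<in> B" and "0 \<le> \<epsilon>"
  shows "norm (rmul b (tr s v)) \<le> \<epsilon> * norm v + C0 * norm (rmul (indicat_real B) v)"
proof -
  have C0: "0 \<le> C0" using all[of undefined] by linarith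
  have "rmul b (tr s v) = rmul (\<lambda>n. if n \<in> B0 then 0 else b n) (tr s v)
      + rmul (\<lambda>n. if n \<in> B0 then b n else 0) (tr s v)"
    by (rule fsf_eqI) simp
  moreover have "norm (rmul (\<lambda>n. if n \<in> B0 then 0 else b n) (tr s v)) \<le> \<epsilon> * norm (tr s v)"
    by (rule norm_rmul_le) (use off assms(4) in auto)
  moreover have "norm (rmul (\<lambda>n. if n \<in> B0 then b n else 0) (tr s v))
      \<le> norm (C0 *\<^sub>R tr s (rmul (indicat_real B) v))"
    by (rule norm_fsf_mono) (use all C0 nb in \<open>auto simp: norm_mult intro!: mult_right_mono\<close>)
  moreover have "norm (C0 *\<^sub>R tr s (rmul (indicat_real B) v)) = C0 * norm (rmul (indicat_real B) v)"
    using C0 by simp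
  ultimately show ?thesis
    by (simp only:) (intro norm_triangle_le add_mono; simp)
qed

definition carleman_const :: "real \<Rightarrow> real \<Rightarrow> real \<Rightarrow> real \<Rightarrow> real" where
  "carleman_const d w \<kappa> \<delta> =
     (12 * d + 16 * d\<^sup>2 + 2 * d * \<bar>w\<bar> * (20 * d + 8) / \<kappa> + 4 * (4 * d + 2) + (4 * d + 2)\<^sup>2) / \<delta> + 1"

text \<open>Each coefficient that disappears at infinity is at most \<open>\<epsilon>\<close> outside a set \<open>B0\<close> and at most \<open>C0\<close>
  everywhere. In the condition on the differences of \<open>V\<close>, \<open>n_i + 1/2\<close> is the coordinate of the midpoint of an edge.\<close>

locale small_potentials =
  fixes V :: "int ^ 'd::finite \<Rightarrow> real" and w k \<epsilon> C0 :: real and B0 :: "(int ^ 'd) set"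
  assumes V_off: "\<And>n. n \<notin> B0 \<Longrightarrow> \<bar>V n\<bar> \<le> \<epsilon>" and V_all: "\<And>n. \<bar>V n\<bar> \<le> C0"
    and W_off: "\<And>n. n \<notin> B0 \<Longrightarrow> \<bar>wigner_von_neumann w k n\<bar> \<le> \<epsilon>"
    and W_all: "\<And>n :: int ^ 'd. \<bar>wigner_von_neumann w k n\<bar> \<le> C0"
    and dV_off: "\<And>n i. n \<notin> B0 \<Longrightarrow> \<bar>(of_int (n $ i) + 1/2) * (V (n + unit i) - V n)\<bar> \<le> \<epsilon>"
    and dV_all: "\<And>n i. \<bar>(of_int (n $ i) + 1/2) * (V (n + unit i) - V n)\<bar> \<le> C0"
    and om_off: "\<And>n i j. n \<notin> B0 \<Longrightarrow> \<bar>omega i n - omega i (n - unit j)\<bar> \<le> \<epsilon>"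
      "\<And>n i j. n \<notin> B0 \<Longrightarrow> \<bar>omega i n - omega i (n + unit j)\<bar> \<le> \<epsilon>"

text \<open>The coefficients of \<open>exp F (H - \<nu>) exp (- F)\<close> for a weight \<open>F\<close>: the hopping coefficients are expanded to
  first order, \<open>g\<close> is the slope of the weight in the radial direction, and \<open>r\<close>, \<open>r'\<close> are the remainders for the
  two directions of hopping. The set \<open>B\<close> contains \<open>B0\<close> and its neighbours, since translations move
  mass by one site. The constant in \<open>carleman\<close> must not involve \<open>\<epsilon>\<close>, \<open>C0\<close> or the weight: \<open>\<epsilon>\<close> is chosen only
  after that constant is known.\<close>

locale weighted_setting = small_potentials +
  fixes \<nu> \<kappa> \<delta> d :: real and g :: "int ^ 'd \<Rightarrow> real" and r r' :: "'d \<Rightarrow> int ^ 'd \<Rightarrow> real"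
    and B :: "(int ^ 'd) set"
  assumes d_def: "d = real CARD('d)"
    and nu: "0 \<le> \<nu>" "\<nu> \<le> 4" "\<delta> \<le> 4 * \<nu> - \<nu>\<^sup>2" "0 < \<delta>"
    and gap: "0 < \<kappa>" "\<kappa> \<le> 4 * d - 2 * \<nu> - 4 * d * \<bar>cos (k/2)\<bar>"
    and eps: "0 \<le> \<epsilon>" and C0_ge: "2 \<le> C0"
    and nb: "\<And>n. n \<in> B0 \<Longrightarrow> n \<in> B" "\<And>n i. n \<in> B0 \<Longrightarrow> n - unit i \<in> B"
      "\<And>n i. n \<in> B0 \<Longrightarrow> n + unit i \<in> B"
    and g_nonneg: "\<And>n. 0 \<le> g n"
    and g_off: "\<And>n. n \<notin> B0 \<Longrightarrow> 2 * (jbracket n * g n) \<le> \<epsilon>" and g_all: "\<And>n. 2 * (jbracket n * g n) \<le> C0"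
    and r_off: "\<And>n i. n \<notin> B0 \<Longrightarrow> jbracket n * \<bar>r i n\<bar> \<le> \<epsilon>"
      "\<And>n i. n \<notin> B0 \<Longrightarrow> jbracket n * \<bar>r' i n\<bar> \<le> \<epsilon>"
    and r_all: "\<And>n i. jbracket n * \<bar>r i n\<bar> \<le> C0" "\<And>n i. jbracket n * \<bar>r' i n\<bar> \<le> C0"
begin

definition R where
  "R v = (\<Sum>i\<in>UNIV. rmul (r i) (tr (unit i) v) + rmul (r' i) (tr (- unit i) v))"

text \<open>The conjugated operator \<open>exp F (H - \<nu>) exp (- F)\<close>; see \<open>conjugated_equation\<close>.\<close>

definition P where
  "P v = lap v - \<nu> *\<^sub>R v + rmul V v + rmul (wigner_von_neumann w k) v - rmul g (dil v) - R v"

text \<open>A common bound for all contributions that are small at infinity.\<close>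

definition Y where
  "Y v = \<epsilon> * norm v + C0 * norm (rmul (indicat_real B) v)"

abbreviation p where
  "p v \<equiv> norm (rmul jbracket (P v))"

lemma Y_nonneg: "0 \<le> Y v"
  using eps C0_ge by (simp add: Y_def)

lemma small:
  assumes off: "\<And>n. n \<notin> B0 \<Longrightarrow> \<bar>b n\<bar> \<le> \<epsilon>" and all: "\<And>n. \<bar>b n\<bar> \<le> C0"
  shows "norm (rmul b v) \<le> Y v" "norm (rmul b (tr (unit i) v)) \<le> Y v"
    "norm (rmul b (tr (- unit i) v)) \<le> Y v"
proof -
  have *: "norm (rmul b (tr s v)) \<le> Y v" if "\<And>n. n \<in> B0 \<Longrightarrow> n - s \<in> B" for s
    unfolding Y_def using off all that eps by (rule norm_small_mul_tr)
  show "norm (rmul b (tr (unit i) v)) \<le> Y v"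
    by (rule *) (rule nb)
  show "norm (rmul b (tr (- unit i) v)) \<le> Y v"
    by (rule *) (simp only: diff_minus_eq_add nb)
  have "norm (rmul b (tr 0 v)) \<le> Y v"
    by (rule *) (simp only: diff_0_right nb)
  then show "norm (rmul b v) \<le> Y v"
    by simp
qed

lemma sum2_norm_le:
  assumes "\<And>i::'d. norm (f i) \<le> c" "\<And>i::'d. norm (f' i) \<le> c"
  shows "norm (\<Sum>i\<in>UNIV. f i + f' i) \<le> 2 * d * c"
proof -
  have "norm (f i + f' i) \<le> 2 * c" for i
    using norm_triangle_ineq[of "f i" "f' i"] assms(1)[of i] assms(2)[of i] by linarith
  then have "norm (\<Sum>i\<in>UNIV. f i + f' i) \<le> (\<Sum>i\<in>(UNIV::'d set). 2 * c)"
    by (rule sum_norm_le)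
  then show ?thesis by (simp add: d_def)
qed

lemma coord_half: "\<bar>real_of_int (n $ i) - 1/2\<bar> \<le> 2 * jbracket n"
  "\<bar>real_of_int (n $ i) + 1/2\<bar> \<le> 2 * jbracket n"
  using coord_le_jbracket[of n i] jbracket_ge_1[of n] by linarith+

lemma norm_g_dil: "norm (rmul g (dil v)) \<le> 2 * d * Y v"
proof -
  have "rmul g (dil v) = (\<Sum>i\<in>UNIV. rmul (\<lambda>n. g n * (of_int (n $ i) - 1/2)) (tr (unit i) v)
      + rmul (\<lambda>n. - (g n * (of_int (n $ i) + 1/2))) (tr (- unit i) v))"
    by (rule fsf_eqI) (simp add: dil_def dil1_def sum_distrib_left algebra_simps)
  moreover have b: "\<bar>g n * (of_int (n $ i) - 1/2)\<bar> \<le> 2 * (jbracket n * g n)"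
    "\<bar>- (g n * (of_int (n $ i) + 1/2))\<bar> \<le> 2 * (jbracket n * g n)" for n i
    using mult_left_mono[OF coord_half(1) g_nonneg[of n], of n i]
      mult_left_mono[OF coord_half(2) g_nonneg[of n], of n i] g_nonneg[of n]
    by (simp_all add: abs_mult mult_ac)
  ultimately show ?thesis
    by (simp only:) (intro sum2_norm_le small order_trans[OF b(1)] order_trans[OF b(2)] g_off g_all)
qed

text \<open>The remainders stay small after multiplication by \<open>\<langle>n\<rangle>\<close>. This is needed because the dilation
  generator grows like \<open>\<langle>n\<rangle>\<close>.\<close>

lemma norm_rho_R: "norm (rmul jbracket (R v)) \<le> 2 * d * Y v"
proof -
  have "rmul jbracket (R v) = (\<Sum>i\<in>UNIV. rmul (\<lambda>n. jbracket n * r i n) (tr (unit i) v)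
      + rmul (\<lambda>n. jbracket n * r' i n) (tr (- unit i) v))"
    by (rule fsf_eqI) (simp add: R_def sum_distrib_left algebra_simps)
  moreover have "\<bar>jbracket n * r i n\<bar> = jbracket n * \<bar>r i n\<bar>" 
    "\<bar>jbracket n * r' i n\<bar> = jbracket n * \<bar>r' i n\<bar>" for n i
    by (simp_all add: abs_mult less_imp_le)
  ultimately show ?thesis
    by (simp only:) (intro sum2_norm_le small; simp add: r_off r_all)
qed

lemma norm_le_norm_rho: "norm f \<le> norm (rmul jbracket f)"
  by (rule norm_fsf_mono) (simp add: norm_mult mult_le_cancel_right1)

lemma norm_dil_div_rho:
  fixes v :: "'d fsf"
  shows "norm (rmul (\<lambda>n. 1 / jbracket n) (dil v)) \<le> 4 * d * norm v"
proof -
  let ?a = "\<lambda>i. rmul (\<lambda>n. (of_int (n $ i) - 1/2) / jbracket n) (tr (unit i) v)"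
  let ?b = "\<lambda>i. rmul (\<lambda>n. - ((of_int (n $ i) + 1/2) / jbracket n)) (tr (- unit i) v)"
  have "rmul (\<lambda>n. 1 / jbracket n) (dil v)
      = (\<Sum>i\<in>UNIV. (?a i)
      + (?b i))"
    by (rule fsf_eqI) (simp add: dil_def dil1_def sum_divide_distrib diff_divide_distrib add_divide_distrib algebra_simps)
  also have "norm \<dots> \<le> 2 * d * (2 * norm v)"
  proof (rule sum2_norm_le)
    fix i
    have "norm ((?a i)) \<le> 2 * norm (tr (unit i) v)"
      by (rule norm_rmul_le) (use coord_half in \<open>simp add: divide_le_eq\<close>)
    then show "norm ((?a i)) \<le> 2 * norm v" by simp
    have "norm ((?b i)) \<le> 2 * norm (tr (- unit i) v)"
      by (rule norm_rmul_le) (use coord_half in \<open>simp add: divide_le_eq\<close>)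
    then show "norm ((?b i)) \<le> 2 * norm v" by simp
  qed
  finally show ?thesis by simp
qed

lemma inner_dil_le:
  fixes v :: "'d fsf"
  shows "\<bar>f \<bullet> dil v\<bar> \<le> norm (rmul jbracket f) * (4 * d * norm v)"
proof -
  have "f \<bullet> dil v = rmul jbracket f \<bullet> rmul (\<lambda>n. 1 / jbracket n) (dil v)"
    by (simp add: inner_rmul)
  also have "\<bar>\<dots>\<bar> \<le> norm (rmul jbracket f) * norm (rmul (\<lambda>n. 1 / jbracket n) (dil v))"
    by (rule Cauchy_Schwarz_ineq2)
  also have "\<dots> \<le> norm (rmul jbracket f) * (4 * d * norm v)"
    by (intro mult_left_mono norm_dil_div_rho) simp
  finally show ?thesis .
qed

lemma lap_eq: "lap v = \<nu> *\<^sub>R v + P v - rmul V v - rmul (wigner_von_neumann w k) v + rmul g (dil v) + R v"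
  by (simp add: P_def)

text \<open>The conjugated equation says that \<open>v\<close> almost has energy \<open>\<nu>\<close> for the free Laplacian: even the term
  \<open>g A v\<close> is small, since \<open>\<langle>n\<rangle> g\<close> is small at infinity.\<close>

lemma norm_energy_defect: "norm (lap v - \<nu> *\<^sub>R v) \<le> (4 * d + 2) * (p v + Y v)"
proof -
  have d: "1 \<le> d" by (simp add: Suc_leI d_def)
  have "norm (lap v - \<nu> *\<^sub>R v)
      \<le> norm (P v) + norm (rmul V v) + norm (rmul (wigner_von_neumann w k) v)
        + norm (rmul g (dil v)) + norm (R v)"
  proof -
    have "lap v - \<nu> *\<^sub>R v = P v + - rmul V v + - rmul (wigner_von_neumann w k) v + rmul g (dil v) + R v"
      by (simp add: lap_eq)
    then show ?thesis
      by (simp only:) (intro norm_triangle_le add_mono; simp)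
  qed
  also have "\<dots> \<le> p v + Y v + Y v + 2 * d * Y v + 2 * d * Y v"
    by (intro add_mono small norm_le_norm_rho norm_g_dil order_trans[OF norm_le_norm_rho norm_rho_R]
        V_off V_all W_off W_all)
  also have "\<dots> = p v + (4 * d + 2) * Y v" by (simp add: algebra_simps)
  also have "\<dots> \<le> (4 * d + 2) * p v + (4 * d + 2) * Y v"
    using mult_right_mono[of 1 "4 * d + 2" "p v"] d by simp
  finally show ?thesis by (simp add: algebra_simps)
qed

text \<open>Antisymmetry of the dilation generator turns this pairing into one with the discrete derivative of
  \<open>V\<close>, weighted by the coordinate.\<close>

lemma inner_V_dil: "\<bar>rmul V v \<bullet> dil v\<bar> \<le> d * (Y v * norm v)"
proof -
  have "\<bar>rmul V v \<bullet> dil1 i v\<bar> \<le> Y v * norm v" for i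
  proof -
    let ?a = "rmul (\<lambda>n. (of_int (n $ i) + 1/2) * V (n + unit i)) (tr (- unit i) v)"
    let ?b = "rmul (\<lambda>n. (of_int (n $ i) + 1/2) * V n) (tr (- unit i) v)"
    let ?c = "rmul (\<lambda>n. (of_int (n $ i) + 1/2) * (V (n + unit i) - V n)) (tr (- unit i) v)"
    have "rmul V v \<bullet> rmul (\<lambda>n. of_int (n $ i) - 1/2) (tr (unit i) v)
        = rmul (\<lambda>n. (of_int (n $ i) - 1/2) * V n) v \<bullet> tr (unit i) v"
      by (simp add: inner_rmul flip: of_real_mult) (simp add: mult_ac)
    also have "\<dots> = ?a \<bullet> v"
    proof -
      have "of_int ((n + unit i) $ i) - 1/2 = real_of_int (n $ i) + 1/2" for n :: "int ^ 'd"
        by (simp add: axis_nth)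
      then show ?thesis by (simp only: inner_tr' tr_mul diff_minus_eq_add)
    qed
    finally have 1: "rmul V v \<bullet> rmul (\<lambda>n. of_int (n $ i) - 1/2) (tr (unit i) v)
        = ?a \<bullet> v" .
    have 2: "rmul V v \<bullet> rmul (\<lambda>n. of_int (n $ i) + 1/2) (tr (- unit i) v)
        = ?b \<bullet> v"
      by (simp add: inner_rmul inner_commute[of _ v] mult_ac)
    have "rmul V v \<bullet> dil1 i v
        = (?a
          - ?b) \<bullet> v"
      unfolding dil1_def inner_diff_right inner_diff_left 1 2 ..
    also have "\<dots> = ?c \<bullet> v"
      by (rule arg_cong[where f = "\<lambda>f. f \<bullet> v"], rule fsf_eqI) (simp add: algebra_simps)
    finally have "rmul V v \<bullet> dil1 i v
        = ?c \<bullet> v" .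
    also have "\<bar>\<dots>\<bar> \<le> Y v * norm v"
      by (intro order_trans[OF Cauchy_Schwarz_ineq2] mult_right_mono small dV_off dV_all norm_ge_zero)
    finally show ?thesis .
  qed
  then have "\<bar>rmul V v \<bullet> dil v\<bar> \<le> (\<Sum>i\<in>(UNIV::'d set). Y v * norm v)"
    unfolding dil_def inner_sum_right by (intro order_trans[OF sum_abs] sum_mono)
  then show ?thesis by (simp add: d_def)
qed

text \<open>The product \<open>W n * n_i\<close> equals \<open>w\<close> times the bounded, slowly varying function \<open>omega i\<close> times the oscillating factor. Both
  \<open>omega i v\<close> and \<open>S_i v - S_i\<^sup>* v\<close> still have energy close to \<open>\<nu>\<close>, so nonresonance applies to them.\<close>

lemma inner_W_dil:
  "\<bar>rmul (wigner_von_neumann w k) v \<bullet> dil v\<bar>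
    \<le> d * ((\<bar>w\<bar> * (20 * d + 8) / \<kappa> + 1) * ((p v + Y v) * norm v))"
proof -
  let ?W = "wigner_von_neumann w k :: int ^ 'd \<Rightarrow> real"
  let ?sin = "\<lambda>n. sin (k * phase n)"
  let ?X = "p v + Y v"
  define h where "h = lap v - \<nu> *\<^sub>R v"
  have h: "norm h \<le> (4 * d + 2) * ?X"
    unfolding h_def by (rule norm_energy_defect)
  have X: "Y v \<le> ?X" by simp
  have each: "\<bar>rmul ?W v \<bullet> dil1 i v\<bar> \<le> (\<bar>w\<bar> * (20 * d + 8) / \<kappa> + 1) * (?X * norm v)" for i
  proof -
    define x where "x = rmul (omega i) v"
    define y where "y = tr (unit i) v - tr (- unit i) v"
    define c where "c = x \<bullet> rmul ?sin y"
    have nx: "norm x \<le> norm v"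
      using norm_rmul_le[of "omega i" 1 v, OF abs_omega_le] by (simp add: x_def)
    have ny: "norm y \<le> 2 * norm v"
      using norm_triangle_ineq4[of "tr (unit i) v" "tr (- unit i) v"] by (simp add: y_def)
    have "lap y - \<nu> *\<^sub>R y = tr (unit i) h - tr (- unit i) h"
      by (simp add: y_def h_def linear_diff[OF linear_lap] tr_linear tr_lap algebra_simps)
    then have ly: "norm (lap y - \<nu> *\<^sub>R y) \<le> 2 * norm h"
      using norm_triangle_ineq4[of "tr (unit i) h" "tr (- unit i) h"] by simp
    have "lap x - \<nu> *\<^sub>R x = rmul (omega i) h
        + (\<Sum>j\<in>UNIV. rmul (\<lambda>n. omega i n - omega i (n - unit j)) (tr (unit j) v)
                    + rmul (\<lambda>n. omega i n - omega i (n + unit j)) (tr (- unit j) v))"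
      by (rule fsf_eqI) (simp add: x_def h_def lap_def lap1_def sum_distrib_left scaleR_conv_of_real
          sum.distrib sum_subtractf algebra_simps)
    moreover have "norm (rmul (omega i) h) \<le> norm h"
      using norm_rmul_le[of "omega i" 1 h, OF abs_omega_le] by simp
    moreover have "\<bar>omega i a - omega i b\<bar> \<le> C0" for a b :: "int ^ 'd"
      using abs_omega_le[of i a] abs_omega_le[of i b] C0_ge by linarith
    then have "norm (\<Sum>j\<in>UNIV. rmul (\<lambda>n. omega i n - omega i (n - unit j)) (tr (unit j) v)
                    + rmul (\<lambda>n. omega i n - omega i (n + unit j)) (tr (- unit j) v)) \<le> 2 * d * Y v"
      by (intro sum2_norm_le small om_off)
    ultimately have lx: "norm (lap x - \<nu> *\<^sub>R x) \<le> norm h + 2 * d * Y v"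
      by (simp only:) (intro norm_triangle_le add_mono)
    have "\<kappa> * \<bar>c\<bar> \<le> (4 * d - 2 * \<nu> - 4 * d * \<bar>cos (k/2)\<bar>) * \<bar>c\<bar>"
      using gap by (intro mult_right_mono) auto
    also have "\<dots> \<le> norm (lap x - \<nu> *\<^sub>R x) * norm y + norm x * norm (lap y - \<nu> *\<^sub>R y)"
      unfolding c_def using nonresonance[of k \<nu> x y] gap by (simp add: d_def)
    also have "\<dots> \<le> (norm h + 2 * d * Y v) * (2 * norm v) + norm v * (2 * norm h)"
      by (intro add_mono mult_mono lx ny nx ly) (use Y_nonneg[of v] in \<open>auto simp: d_def\<close>)
    also have "\<dots> = (4 * norm h + 4 * d * Y v) * norm v" by (simp add: algebra_simps)
    also have "\<dots> \<le> (4 * ((4 * d + 2) * ?X) + 4 * d * ?X) * norm v"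
      using h by (intro mult_right_mono add_mono mult_left_mono X) (auto simp: d_def)
    also have "\<dots> = (20 * d + 8) * (?X * norm v)" by (simp add: algebra_simps)
    finally have c: "\<bar>c\<bar> \<le> (20 * d + 8) * (?X * norm v) / \<kappa>"
      using gap by (simp add: field_simps)
    have "rmul ?W v \<bullet> rmul (\<lambda>n. of_int (n $ i)) f = w * (x \<bullet> rmul ?sin f)" for f :: "'d fsf"
    proof -
      have "rmul ?W v \<bullet> rmul (\<lambda>n. of_int (n $ i)) f = rmul (\<lambda>n. ?W n * of_int (n $ i)) v \<bullet> f"
        by (simp add: inner_mul)
      also have "rmul (\<lambda>n. ?W n * of_int (n $ i)) v = w *\<^sub>R rmul ?sin x"
        by (rule fsf_eqI) (simp add: wvn_coord x_def scaleR_conv_of_real mult_ac)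
      also have "\<dots> \<bullet> f = w * (x \<bullet> rmul ?sin f)"
        by (simp only: inner_scaleR_left inner_rmul)
      finally show ?thesis .
    qed
    note split = this
    have "dil1 i v = rmul (\<lambda>n. of_int (n $ i)) y
        - (1/2) *\<^sub>R (tr (unit i) v + tr (- unit i) v)"
      by (rule fsf_eqI) (simp add: dil1_def y_def scaleR_conv_of_real algebra_simps)
    then have "rmul ?W v \<bullet> dil1 i v
        = w * c - 1/2 * (rmul ?W v \<bullet> (tr (unit i) v + tr (- unit i) v))"
      by (simp only: inner_diff_right inner_scaleR_right split c_def)
    moreover have "\<bar>rmul ?W v \<bullet> (tr (unit i) v + tr (- unit i) v)\<bar> \<le> Y v * (2 * norm v)"
    proof (rule order_trans[OF Cauchy_Schwarz_ineq2 mult_mono])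
      show "norm (rmul ?W v) \<le> Y v" by (intro small W_off W_all)
      show "norm (tr (unit i) v + tr (- unit i) v) \<le> 2 * norm v"
        using norm_triangle_ineq[of "tr (unit i) v" "tr (- unit i) v"] by simp
    qed (auto simp: Y_nonneg)
    ultimately have "\<bar>rmul ?W v \<bullet> dil1 i v\<bar> \<le> \<bar>w\<bar> * \<bar>c\<bar> + Y v * norm v"
      by (simp add: abs_mult[symmetric])
    also have "\<dots> \<le> \<bar>w\<bar> * ((20 * d + 8) * (?X * norm v) / \<kappa>) + ?X * norm v"
      by (intro add_mono mult_left_mono mult_right_mono c X) auto
    also have "\<dots> = (\<bar>w\<bar> * (20 * d + 8) / \<kappa> + 1) * (?X * norm v)"
      by (simp only: distrib_right times_divide_eq_left times_divide_eq_right mult_1 mult.assoc)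
    finally show ?thesis .
  qed
  have "\<bar>rmul ?W v \<bullet> dil v\<bar> \<le> (\<Sum>i\<in>(UNIV::'d set). (\<bar>w\<bar> * (20 * d + 8) / \<kappa> + 1) * (?X * norm v))"
    unfolding dil_def inner_sum_right by (intro order_trans[OF sum_abs] sum_mono each)
  then show ?thesis by (simp add: d_def)
qed

text \<open>The conjugated equation is paired with \<open>A v\<close>. The term \<open>g A\<close> contributes \<open>\<langle>g Av, Av\<rangle> \<ge> 0\<close>, with the sign
  that helps; everything else is at most a constant times \<open>\<parallel>v\<parallel> (p v + Y v)\<close>. Comparison with
  the positive commutator gives a quadratic inequality for \<open>\<parallel>v\<parallel>\<close>.\<close>

lemma carleman: "norm v \<le> carleman_const d w \<kappa> \<delta> * (p v + Y v)"
proof -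
  define K1 where "K1 = 12 * d + 16 * d\<^sup>2 + 2 * d * \<bar>w\<bar> * (20 * d + 8) / \<kappa> + 4 * (4 * d + 2)"
  define K where K: "K = carleman_const d w \<kappa> \<delta>"
  have K_def: "K = (K1 + (4 * d + 2)\<^sup>2) / \<delta> + 1"
    by (simp add: K K1_def carleman_const_def)
  let ?W = "wigner_von_neumann w k :: int ^ 'd \<Rightarrow> real"
  let ?X = "p v + Y v" and ?N = "norm v"
  define h where "h = lap v - \<nu> *\<^sub>R v"
  have h: "norm h \<le> (4 * d + 2) * ?X"
    unfolding h_def by (rule norm_energy_defect)
  have d0: "0 \<le> d" by (simp add: d_def)
  have X: "0 \<le> ?X" using Y_nonneg by simp
  have "lap v \<bullet> dil v = P v \<bullet> dil v - rmul V v \<bullet> dil v - rmul ?W v \<bullet> dil v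
      + rmul g (dil v) \<bullet> dil v + R v \<bullet> dil v"
    by (simp add: lap_eq inner_diff_left inner_add_left inner_dil_self)
  moreover have "0 \<le> rmul g (dil v) \<bullet> dil v"
  proof -
    have "rmul g (dil v) \<bullet> dil v = rmul (\<lambda>n. sqrt (g n)) (dil v) \<bullet> rmul (\<lambda>n. sqrt (g n)) (dil v)"
      by (simp add: inner_rmul g_nonneg flip: of_real_mult)
    then show ?thesis by simp
  qed
  moreover have "\<bar>P v \<bullet> dil v\<bar> \<le> 4 * d * (?X * ?N)"
  proof -
    have "\<bar>P v \<bullet> dil v\<bar> \<le> p v * (4 * d * ?N)" by (rule inner_dil_le)
    also have "\<dots> \<le> ?X * (4 * d * ?N)"
      using Y_nonneg d0 by (intro mult_right_mono) auto
    finally show ?thesis by (simp add: mult_ac)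
  qed
  moreover have "\<bar>R v \<bullet> dil v\<bar> \<le> 8 * d\<^sup>2 * (?X * ?N)"
  proof -
    have "\<bar>R v \<bullet> dil v\<bar> \<le> norm (rmul jbracket (R v)) * (4 * d * ?N)" by (rule inner_dil_le)
    also have "\<dots> \<le> (2 * d * ?X) * (4 * d * ?N)"
      using d0 by (intro mult_right_mono order_trans[OF norm_rho_R] mult_left_mono) auto
    finally show ?thesis by (simp add: power2_eq_square mult_ac)
  qed
  moreover have "\<bar>rmul V v \<bullet> dil v\<bar> \<le> d * (?X * ?N)"
    by (rule order_trans[OF inner_V_dil]) (use d0 in \<open>auto intro!: mult_left_mono mult_right_mono\<close>)
  moreover have "\<bar>rmul ?W v \<bullet> dil v\<bar> \<le> d * ((\<bar>w\<bar> * (20 * d + 8) / \<kappa> + 1) * (?X * ?N))"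
    by (rule inner_W_dil)
  ultimately have "- 2 * (lap v \<bullet> dil v) \<le> 2 * (4 * d * (?X * ?N)) + 2 * (8 * d\<^sup>2 * (?X * ?N))
      + 2 * (d * (?X * ?N)) + 2 * (d * ((\<bar>w\<bar> * (20 * d + 8) / \<kappa> + 1) * (?X * ?N)))"
    by linarith
  also have "\<dots> = (K1 - 4 * (4 * d + 2)) * (?X * ?N)"
    by (simp add: K1_def algebra_simps add_divide_distrib)
  finally have upper: "4 * (v \<bullet> lap v) - (norm (lap v))\<^sup>2 \<le> (K1 - 4 * (4 * d + 2)) * (?X * ?N)"
    using positive_commutator[of v] by linarith
  have "lap v = \<nu> *\<^sub>R v + h" by (simp add: h_def)
  then have "v \<bullet> lap v = \<nu> * ?N\<^sup>2 + v \<bullet> h"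
    and "(norm (lap v))\<^sup>2 = \<nu>\<^sup>2 * ?N\<^sup>2 + 2 * \<nu> * (v \<bullet> h) + (norm h)\<^sup>2"
    unfolding power2_norm_eq_inner
    by (simp_all only: inner_add_left inner_add_right inner_scaleR_left inner_scaleR_right inner_commute[of h v])
       (simp add: power2_eq_square distrib_left)
  then have "4 * (v \<bullet> lap v) - (norm (lap v))\<^sup>2
      = (4 * \<nu> - \<nu>\<^sup>2) * ?N\<^sup>2 + (4 - 2 * \<nu>) * (v \<bullet> h) - (norm h)\<^sup>2"
    by (simp only: left_diff_distrib distrib_left)
  moreover have "\<bar>(4 - 2 * \<nu>) * (v \<bullet> h)\<bar> \<le> 4 * (4 * d + 2) * (?X * ?N)"
  proof -
    have "\<bar>(4 - 2 * \<nu>) * (v \<bullet> h)\<bar> \<le> 4 * (?N * ((4 * d + 2) * ?X))"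
      unfolding abs_mult
      by (intro mult_mono order_trans[OF Cauchy_Schwarz_ineq2] mult_left_mono h) (use nu in auto)
    then show ?thesis by (simp only: mult_ac)
  qed
  moreover have "(norm h)\<^sup>2 \<le> (4 * d + 2)\<^sup>2 * ?X\<^sup>2"
    unfolding power_mult_distrib[symmetric] by (intro power_mono h) simp
  moreover have "\<delta> * ?N\<^sup>2 \<le> (4 * \<nu> - \<nu>\<^sup>2) * ?N\<^sup>2"
    using nu by (intro mult_right_mono) auto
  ultimately have main: "\<delta> * ?N\<^sup>2 \<le> K1 * (?X * ?N) + (4 * d + 2)\<^sup>2 * ?X\<^sup>2"
    using upper unfolding left_diff_distrib[of K1] by linarith
  have K1: "0 \<le> K1" using d0 gap by (simp add: K1_def)
  have "?N \<le> K * ?X"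
  proof (rule ccontr)
    assume "\<not> ?N \<le> K * ?X"
    then have N: "K * ?X < ?N" by simp
    have K1': "1 \<le> K" using K1 nu by (simp add: K_def)
    have XN: "?X \<le> ?N"
      using mult_right_mono[OF K1' X] less_imp_le[OF N] unfolding mult_1 by (rule order_trans)
    have "0 \<le> K * ?X" using K1' X by (intro mult_nonneg_nonneg) auto
    then have N0: "0 < ?N" using N by linarith
    have "\<delta> * ?N\<^sup>2 \<le> (K1 + (4 * d + 2)\<^sup>2) * (?X * ?N)"
    proof -
      have "?X\<^sup>2 \<le> ?X * ?N" using XN X by (simp add: power2_eq_square mult_left_mono)
      then have "(4 * d + 2)\<^sup>2 * ?X\<^sup>2 \<le> (4 * d + 2)\<^sup>2 * (?X * ?N)" by (intro mult_left_mono) auto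
      then show ?thesis using main by (simp add: algebra_simps)
    qed
    also have "\<dots> = \<delta> * ((K - 1) * ?X) * ?N" using nu by (simp add: K_def)
    also have "\<dots> \<le> \<delta> * (K * ?X) * ?N"
      using nu X N0 by (intro mult_right_mono mult_left_mono) auto
    also have "\<dots> < \<delta> * ?N * ?N"
      using nu N N0 by (intro mult_strict_right_mono mult_strict_left_mono) auto
    finally show False by (simp add: power2_eq_square)
  qed
  then show ?thesis by (simp only: K)
qed

end

section \<open>Neighbourhoods of infinity in the lattice\<close>

lemma lnorm_eq_norm: "lnorm n = norm (\<chi> i. real_of_int (n $ i))"
  by (simp add: lnorm_def norm_vec_def L2_set_def)

lemma lnorm_triangle: "lnorm (m + n) \<le> lnorm m + lnorm n"
proof -
  have "(\<chi> i. real_of_int ((m + n) $ i)) = (\<chi> i. real_of_int (m $ i)) + (\<chi> i. real_of_int (n $ i))"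
    by (simp add: vec_eq_iff)
  then show ?thesis unfolding lnorm_eq_norm by (simp only: norm_triangle_ineq)
qed

lemma lnorm_unit [simp]: "lnorm (unit i) = 1" "lnorm (- unit i) = 1"
proof -
  have "(\<chi> j. real_of_int (unit i $ j)) = axis i (1::real)"
    by (simp add: vec_eq_iff axis_def)
  then show "lnorm (unit i) = 1" unfolding lnorm_eq_norm by simp
  then show "lnorm (- unit i) = 1" by (simp add: lnorm_def)
qed

lemma lnorm_step: "\<bar>lnorm (n + unit i) - lnorm n\<bar> \<le> 1" "\<bar>lnorm (n - unit i) - lnorm n\<bar> \<le> 1"
  using lnorm_triangle[of n "unit i"] lnorm_triangle[of "n + unit i" "- unit i"]
    lnorm_triangle[of n "- unit i"] lnorm_triangle[of "n - unit i" "unit i"]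
  by (simp_all add: abs_le_iff)

lemma finite_lnorm_le: "finite {n :: int ^ 'd::finite. lnorm n \<le> R}"
proof -
  let ?C = "{- \<lceil>R\<rceil>..\<lceil>R\<rceil>}"
  have "finite (vec_lambda ` (PiE (UNIV :: 'd set) (\<lambda>_. ?C)))"
    by (intro finite_imageI finite_PiE) auto
  moreover have "{n :: int ^ 'd. lnorm n \<le> R} \<subseteq> vec_lambda ` (PiE UNIV (\<lambda>_. ?C))"
  proof
    fix n :: "int ^ 'd" assume "n \<in> {n. lnorm n \<le> R}"
    then have "\<bar>real_of_int (n $ i)\<bar> \<le> R" for i using coord_le_lnorm[of n i] by auto
    then have "n $ i \<in> ?C" for i by (simp add: abs_le_iff) (metis ceiling_mono ceiling_of_int minus_le_iff of_int_minus)
    then have "vec_nth n \<in> PiE UNIV (\<lambda>_. ?C)" by auto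
    then show "n \<in> vec_lambda ` (PiE UNIV (\<lambda>_. ?C))" by (metis image_eqI vec_nth_inverse)
  qed
  ultimately show ?thesis by (rule finite_subset[rotated])
qed

lemma eventually_at_inf_lattice:
  "eventually P at_inf_lattice \<longleftrightarrow> (\<exists>R. \<forall>n. R \<le> lnorm n \<longrightarrow> P n)"
  unfolding at_inf_lattice_def by (rule eventually_filtercomap_at_top_linorder)

lemma finite_exceptions:
  fixes P :: "int ^ 'd::finite \<Rightarrow> bool"
  assumes "eventually P at_inf_lattice"
  shows "finite {n. \<not> P n}"
proof -
  obtain R where "\<forall>n. R \<le> lnorm n \<longrightarrow> P n"
    using assms unfolding eventually_at_inf_lattice by blast
  then have "{n. \<not> P n} \<subseteq> {n. lnorm n \<le> R}" by (auto simp: not_le) (metis less_imp_le linorder_not_le)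
  then show ?thesis using finite_lnorm_le finite_subset by blast
qed

lemma lnorm_at_top: "filterlim lnorm at_top at_inf_lattice"
  unfolding at_inf_lattice_def by (rule filterlim_filtercomap)

lemma jbracket_at_top: "filterlim jbracket at_top at_inf_lattice"
  by (rule filterlim_at_top_mono[OF lnorm_at_top]) (simp add: lnorm_le_jbracket)

lemma shift_at_inf_lattice: "filterlim (\<lambda>n. n + unit i) at_inf_lattice at_inf_lattice"
  unfolding filterlim_iff eventually_at_inf_lattice
proof safe
  fix P :: "int ^ 'a \<Rightarrow> bool" and R assume R: "\<forall>n. R \<le> lnorm n \<longrightarrow> P n"
  show "\<exists>R. \<forall>n. R \<le> lnorm n \<longrightarrow> P (n + unit i)"
  proof (intro exI[of _ "R + 1"] allI impI)
    fix n :: "int ^ 'a" assume "R + 1 \<le> lnorm n"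
    then show "P (n + unit i)" using R lnorm_step(1)[of n i] by auto
  qed
qed

text \<open>Finitely many exceptional sites cannot spoil boundedness, since a ball contains finitely many lattice points.\<close>

lemma tendsto_0_imp_bounded:
  fixes f :: "int ^ 'd::finite \<Rightarrow> real"
  assumes "(f \<longlongrightarrow> 0) at_inf_lattice"
  shows "\<exists>C. \<forall>n. \<bar>f n\<bar> \<le> C"
proof -
  have "eventually (\<lambda>n. \<bar>f n\<bar> \<le> 1) at_inf_lattice"
    using tendstoD[OF assms zero_less_one] by (rule eventually_mono) (auto simp: dist_real_def)
  then have fin: "finite {n. \<not> \<bar>f n\<bar> \<le> 1}" by (rule finite_exceptions)
  have "\<bar>f n\<bar> \<le> max 1 (Max ((\<lambda>n. \<bar>f n\<bar>) ` {n. \<not> \<bar>f n\<bar> \<le> 1}))" for n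
    using fin by (cases "\<bar>f n\<bar> \<le> 1") (auto intro: le_max_iff_disj[THEN iffD2] Max_ge)
  then show ?thesis by blast
qed

lemma wvn_tendsto_0: "((wigner_von_neumann w k :: int ^ 'd::finite \<Rightarrow> real) \<longlongrightarrow> 0) at_inf_lattice"
proof (rule Lim_null_comparison)
  have "((\<lambda>n :: int ^ 'd. \<bar>w\<bar> * inverse (lnorm n)) \<longlongrightarrow> \<bar>w\<bar> * 0) at_inf_lattice"
    by (intro tendsto_intros tendsto_inverse_0_at_top lnorm_at_top)
  then show "((\<lambda>n :: int ^ 'd. \<bar>w\<bar> / lnorm n) \<longlongrightarrow> 0) at_inf_lattice" by (simp add: divide_inverse)
  have "\<bar>w * sin (k * phase n)\<bar> \<le> \<bar>w\<bar>" for n :: "int ^ 'd"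
    by (simp add: abs_mult mult_left_le)
  then have le: "norm (wigner_von_neumann w k n) \<le> \<bar>w\<bar> / lnorm n" for n :: "int ^ 'd"
    unfolding wvn_eq real_norm_def abs_divide abs_of_nonneg[OF lnorm_nonneg]
    by (intro divide_right_mono) auto
  show "\<forall>\<^sub>F n :: int ^ 'd in at_inf_lattice. norm (wigner_von_neumann w k n) \<le> \<bar>w\<bar> / lnorm n"
    by (intro always_eventually allI le)
qed

lemma omega_difference:
  assumes "\<bar>lnorm m - lnorm n\<bar> \<le> 1" "\<bar>real_of_int (n $ i - m $ i)\<bar> \<le> 1" "0 < lnorm n"
  shows "\<bar>omega i n - omega i m\<bar> \<le> 2 / lnorm n"
proof -
  have "omega i n - omega i m = of_int (n $ i - m $ i) / lnorm n + omega i m * (lnorm m - lnorm n) / lnorm n"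
  proof (cases "lnorm m = 0")
    case True
    then show ?thesis by (simp add: omega_def lnorm_eq_0_iff)
  next
    case False
    then have "omega i m * lnorm m = of_int (m $ i)" by (simp add: omega_def)
    then have "omega i m * (lnorm m - lnorm n) / lnorm n = of_int (m $ i) / lnorm n - omega i m"
      using assms(3) by (simp add: right_diff_distrib diff_divide_distrib)
    then show ?thesis by (simp add: omega_def[of i n] diff_divide_distrib)
  qed
  also have "\<bar>\<dots>\<bar> \<le> 1 / lnorm n + 1 * 1 / lnorm n"
    unfolding add_divide_distrib[symmetric] abs_divide abs_of_nonneg[OF lnorm_nonneg]
    using abs_omega_le[of i m] assms mult_mono[of "\<bar>omega i m\<bar>" 1 "\<bar>lnorm m - lnorm n\<bar>" 1]
    by (intro divide_right_mono order_trans[OF abs_triangle_ineq] add_mono) (auto simp: abs_mult)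
  finally show ?thesis by simp
qed

lemma omega_difference_eventually:
  assumes "0 < \<epsilon>"
  shows "\<forall>\<^sub>F n in at_inf_lattice. \<bar>omega i n - omega i (n - unit j)\<bar> \<le> \<epsilon>
     \<and> \<bar>omega i n - omega i (n + unit j)\<bar> \<le> \<epsilon>"
proof -
  have "\<forall>\<^sub>F n in at_inf_lattice. 2 / \<epsilon> + 1 \<le> lnorm n"
    using lnorm_at_top unfolding filterlim_at_top by blast
  then show ?thesis
  proof (rule eventually_mono)
    fix n :: "int ^ 'a" assume n: "2 / \<epsilon> + 1 \<le> lnorm n"
    then have pos: "0 < lnorm n" using assms by (smt (verit) divide_pos_pos)
    have "2 / \<epsilon> \<le> lnorm n" using n by simp
    then have "2 / lnorm n \<le> \<epsilon>" using assms pos by (simp add: field_simps)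
    have "\<bar>real_of_int (n $ i - (n - unit j) $ i)\<bar> \<le> 1" "\<bar>real_of_int (n $ i - (n + unit j) $ i)\<bar> \<le> 1"
      by (simp_all add: axis_def)
    then have "\<bar>omega i n - omega i (n - unit j)\<bar> \<le> 2 / lnorm n" "\<bar>omega i n - omega i (n + unit j)\<bar> \<le> 2 / lnorm n"
      using omega_difference lnorm_step pos by blast+
    then
    show "\<bar>omega i n - omega i (n - unit j)\<bar> \<le> \<epsilon> \<and> \<bar>omega i n - omega i (n + unit j)\<bar> \<le> \<epsilon>"
      using \<open>2 / lnorm n \<le> \<epsilon>\<close> by linarith
  qed
qed

section \<open>Weights of sub-exponential growth\<close>

text \<open>The weight exponent as a function of \<open>t = \<langle>n\<rangle>\<^sup>2\<close>: for \<open>a = 0\<close> it is \<open>t powr (1/8) / 2\<close>, and for \<open>a > 0\<close> it is a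
  bounded increasing approximation of it. With the exponent \<open>1/8\<close> the square of an increment over one
  lattice step is of order \<open>t powr (-3/4)\<close>, hence small even after multiplication by \<open>\<langle>n\<rangle> = sqrt t\<close>.
  The factor \<open>1/2\<close> keeps increments below one.\<close>

definition profile :: "real \<Rightarrow> real \<Rightarrow> real" where
  "profile a t = 1/2 * (t powr (1/8) * (1 + a * t) powr (-1/8))"

definition profile_slope :: "real \<Rightarrow> real \<Rightarrow> real" where
  "profile_slope a t = 1/16 * (t powr (-7/8) * (1 + a * t) powr (-9/8))"

lemma powr_affine_deriv:
  fixes a e e' t :: real
  assumes "0 \<le> a" "0 < t"
  shows "((\<lambda>t. t powr e * (1 + a * t) powr e') has_real_derivative
    e * (t powr (e - 1) * (1 + a * t) powr e') + e' * (t powr e * (a * (1 + a * t) powr (e' - 1)))) (at t)"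
proof -
  have p: "0 < 1 + a * t" using assms by (simp add: add_pos_nonneg)
  have 1: "((\<lambda>t. 1 + a * t) has_real_derivative a) (at t)"
    by (auto intro!: derivative_eq_intros)
  have 2: "((\<lambda>t. (1 + a * t) powr e') has_real_derivative e' * (1 + a * t) powr (e' - of_nat 1) * a) (at t)"
    by (rule DERIV_fun_powr[OF 1 p])
  show ?thesis
    by (rule DERIV_cong[OF DERIV_mult[OF has_real_derivative_powr[OF assms(2)] 2]]) (simp add: mult_ac)
qed

lemma has_deriv_profile:
  assumes "0 \<le> a" "0 < t"
  shows "(profile a has_real_derivative profile_slope a t) (at t)"
proof -
  have p: "0 < 1 + a * t" using assms by (simp add: add_pos_nonneg)
  have e: "1/8 - 1 = (-7/8 :: real)" "-1/8 - 1 = (-9/8 :: real)" by simp_all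
  have 1: "(1 + a * t) powr (-1/8) = (1 + a * t) * (1 + a * t) powr (-9/8)"
    using powr_add[of "1 + a * t" 1 "-9/8"] p by simp
  have 2: "t powr (1/8) = t * t powr (-7/8)"
    using powr_add[of t 1 "-7/8"] assms by simp
  show ?thesis
    unfolding profile_def
    by (rule DERIV_cong[OF DERIV_cmult[OF powr_affine_deriv[OF assms]]])
       (unfold e 1 2 profile_slope_def, algebra)
qed

lemma profile_slope_nonneg: "0 \<le> profile_slope a t"
  by (simp add: profile_slope_def)

lemma powr_neg_le_1: "1 \<le> x \<Longrightarrow> e \<le> 0 \<Longrightarrow> x powr e \<le> (1::real)"
  using powr_mono[of e 0 x] by simp

lemma profile_slope_le:
  assumes "0 \<le> a" "0 < t"
  shows "profile_slope a t \<le> 1/16 * t powr (-7/8)"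
proof -
  have "(1 + a * t) powr (-9/8) \<le> 1" using assms by (intro powr_neg_le_1) auto
  then show ?thesis unfolding profile_slope_def using mult_left_le[of _ "t powr (-7/8)"] by simp
qed

text \<open>The bound does not depend on \<open>a\<close>, because \<open>a t / (1 + a t)\<close> is at most one.\<close>

lemma has_deriv_slope:
  assumes "0 \<le> a" "0 < t"
  shows "\<exists>D. (profile_slope a has_real_derivative D) (at t) \<and> \<bar>D\<bar> \<le> 1/8 * t powr (-15/8)"
proof -
  have p: "0 < 1 + a * t" using assms by (simp add: add_pos_nonneg)
  let ?D = "1/16 * (-7/8 * (t powr (-15/8) * (1 + a * t) powr (-9/8))
      + -9/8 * (t powr (-7/8) * (a * (1 + a * t) powr (-17/8))))"
  have e: "-7/8 - 1 = (-15/8 :: real)" "-9/8 - 1 = (-17/8 :: real)" by simp_all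
  have "(profile_slope a has_real_derivative ?D) (at t)"
    unfolding profile_slope_def
    by (rule DERIV_cong[OF DERIV_cmult[OF powr_affine_deriv[OF assms]]]) (unfold e, rule refl)
  moreover have "\<bar>?D\<bar> \<le> 1/8 * t powr (-15/8)"
  proof -
    have 1: "t powr (-15/8) * (1 + a * t) powr (-9/8) \<le> t powr (-15/8)"
      using assms powr_neg_le_1[of "1 + a * t" "-9/8"] by (intro mult_left_le) auto
    have "a * t * (1 + a * t) powr (-17/8) \<le> (1 + a * t) * (1 + a * t) powr (-17/8)"
      by (intro mult_right_mono) auto
    also have "\<dots> = (1 + a * t) powr (-9/8)"
      using powr_add[of "1 + a * t" 1 "-17/8"] p by simp
    also have "\<dots> \<le> 1" using assms by (intro powr_neg_le_1) auto
    finally have "t powr (-15/8) * (a * t * (1 + a * t) powr (-17/8)) \<le> t powr (-15/8)"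
      by (intro mult_left_le) auto
    moreover have "t powr (-7/8) = t * t powr (-15/8)"
      using powr_add[of t 1 "-15/8"] assms by simp
    ultimately have 2: "t powr (-7/8) * (a * (1 + a * t) powr (-17/8)) \<le> t powr (-15/8)"
      by (simp add: mult_ac)
    have nn: "0 \<le> t powr (-15/8) * (1 + a * t) powr (-9/8)"
      "0 \<le> t powr (-7/8) * (a * (1 + a * t) powr (-17/8))" using assms by auto
    have "\<bar>1/16 * (-7/8 * A + -9/8 * B)\<bar> \<le> 1/8 * C"
      if "0 \<le> A" "0 \<le> B" "A \<le> C" "B \<le> C" for A B C :: real
    proof -
      have "1/16 * (-7/8 * A + -9/8 * B) = - (1/16 * (7/8 * A + 9/8 * B))" by (simp add: field_simps)
      then have "\<bar>1/16 * (-7/8 * A + -9/8 * B)\<bar> = 1/16 * (7/8 * A + 9/8 * B)"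
        using that by (simp only: abs_minus_cancel) simp
      also have "\<dots> \<le> 1/16 * (7/8 * C + 9/8 * C)"
        using that by (intro mult_left_mono add_mono) auto
      also have "\<dots> = 1/8 * C" by simp
      finally show ?thesis .
    qed
    from this[OF nn 1 2] show ?thesis .
  qed
  ultimately show ?thesis by blast
qed

lemma abs_exp_minus_1_minus_id:
  fixes y :: real
  assumes "\<bar>y\<bar> \<le> 1"
  shows "\<bar>exp y - 1 - y\<bar> \<le> y\<^sup>2"
proof (cases "0 \<le> y")
  case True
  then have "exp y \<le> 1 + y + y\<^sup>2" using assms by (intro exp_bound) auto
  then show ?thesis using exp_ge_add_one_self[of y] zero_le_power2[of y] by linarith
next
  case False
  define x where "x = - y"
  have x: "0 \<le> x" "x \<le> 1" using False assms by (auto simp: x_def)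
  have "1 \<le> (1 - x + x\<^sup>2) * (1 + x + x\<^sup>2 / 2)"
  proof -
    have "(1 - x + x\<^sup>2) * (1 + x + x\<^sup>2 / 2) = 1 + (x\<^sup>2 + x ^ 3 + x ^ 4) / 2"
      by (simp add: power2_eq_square power3_eq_cube power4_eq_xxxx field_simps)
    then show ?thesis using x by simp
  qed
  also have "\<dots> \<le> (1 - x + x\<^sup>2) * exp x"
    using x exp_lower_Taylor_quadratic[of x] by (intro mult_left_mono) auto
  finally have "exp y \<le> 1 - x + x\<^sup>2"
    by (simp add: x_def exp_minus field_simps)
  then show ?thesis using exp_ge_add_one_self[of y] zero_le_power2[of y]
    unfolding abs_le_iff x_def power2_minus by linarith
qed

lemma mvt_between:
  fixes f :: "real \<Rightarrow> real"
  assumes "\<And>\<xi>. min x t \<le> \<xi> \<Longrightarrow> \<xi> \<le> max x t \<Longrightarrow> (f has_real_derivative f' \<xi>) (at \<xi>)"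
  obtains \<xi> where "min x t \<le> \<xi>" "\<xi> \<le> max x t" "f t - f x = f' \<xi> * (t - x)"
proof -
  consider "x < t" | "x = t" | "t < x" by linarith
  then show ?thesis
  proof cases
    case 1
    then obtain \<xi> where "x < \<xi>" "\<xi> < t" "f t - f x = (t - x) * f' \<xi>"
      using MVT2[of x t f f'] assms by auto
    then show ?thesis using that[of \<xi>] 1 by (auto simp: mult.commute)
  next
    case 2
    then show ?thesis using that[of x] by simp
  next
    case 3
    then obtain \<xi> where "t < \<xi>" "\<xi> < x" "f x - f t = (x - t) * f' \<xi>"
      using MVT2[of t x f f'] assms by auto
    then show ?thesis using that[of \<xi>] 3 by (auto simp: algebra_simps)
  qed
qed

text \<open>First-order expansion of \<open>exp\<close> of an increment, uniformly in \<open>a\<close>. One lattice step changes \<open>t = \<langle>n\<rangle>\<^sup>2\<close> by at most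
  \<open>3 sqrt t\<close> and by at most a factor of three. The error consists of the square of the increment
  and of the variation of the slope, both \<open>O(t powr (-3/4))\<close>.\<close>

lemma profile_expansion:
  assumes a: "0 \<le> a" and t: "1 \<le> t" and x: "1 \<le> x" "t \<le> 3 * x" and tx: "\<bar>t - x\<bar> \<le> 3 * sqrt t"
  shows "\<bar>exp (profile a t - profile a x) - 1 - profile_slope a t * (t - x)\<bar> \<le> 11 * t powr (-3/4)"
proof -
  have pos: "t / 3 \<le> \<xi>" "0 < \<xi>" if "min x t \<le> \<xi>" for \<xi> using that t x by auto
  have pw: "\<xi> powr (-e) \<le> 3 powr e * t powr (-e)" if "min x t \<le> \<xi>" "0 \<le> e" for \<xi> e
  proof -
    have "\<xi> powr (-e) \<le> (t / 3) powr (-e)"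
      using pos[OF that(1)] that(2) t by (intro powr_mono2') auto
    also have "\<dots> = 3 powr e * t powr (-e)"
      using t by (simp add: powr_divide powr_minus field_simps)
    finally show ?thesis .
  qed
  have sq: "sqrt t = t powr (1/2)" using t by (simp add: powr_half_sqrt)
  obtain \<xi> where xi: "min x t \<le> \<xi>" "\<xi> \<le> max x t" "profile a t - profile a x = profile_slope a \<xi> * (t - x)"
    by (rule mvt_between[of x t "profile a" "profile_slope a"]) (use has_deriv_profile a pos in auto)
  define y where "y = profile a t - profile a x"
  have y: "\<bar>y\<bar> \<le> 9/16 * t powr (-3/8)"
  proof -
    have "profile_slope a \<xi> \<le> 1/16 * (3 powr (7/8) * t powr (-(7/8)))"
      using profile_slope_le[OF a pos(2)[OF xi(1)]] pw[OF xi(1), of "7/8"] by simp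
    also have "\<dots> \<le> 1/16 * (3 * t powr (-(7/8)))"
      using powr_mono[of "7/8" 1 "3::real"] by (intro mult_left_mono mult_right_mono) auto
    finally have "\<bar>y\<bar> \<le> 1/16 * (3 * t powr (-(7/8))) * (3 * t powr (1/2))"
      unfolding y_def xi(3) abs_mult using tx sq profile_slope_nonneg[of a \<xi>]
      by (intro mult_mono) auto
    also have "\<dots> = 9/16 * (t powr (-(7/8)) * t powr (1/2))" by simp
    also have "t powr (-(7/8)) * t powr (1/2) = t powr (-3/8)"
      by (simp flip: powr_add)
    finally show ?thesis .
  qed
  have y1: "\<bar>y\<bar> \<le> 1" using y powr_neg_le_1[OF t, of "-3/8"] by simp
  have "y\<^sup>2 \<le> (9/16 * t powr (-3/8))\<^sup>2"
    using y by (intro power2_le_iff_abs_le[THEN iffD2]) auto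
  also have "\<dots> = 81/256 * t powr (-3/4)"
    by (simp add: power_mult_distrib power2_eq_square flip: powr_add)
  finally have y2: "y\<^sup>2 \<le> 81/256 * t powr (-3/4)" .
  obtain D where D: "\<And>s. 0 < s \<Longrightarrow> (profile_slope a has_real_derivative D s) (at s)"
    "\<And>s. 0 < s \<Longrightarrow> \<bar>D s\<bar> \<le> 1/8 * s powr (-15/8)"
    using has_deriv_slope[OF a] by metis
  obtain \<zeta> where ze: "min \<xi> t \<le> \<zeta>" "\<zeta> \<le> max \<xi> t" "profile_slope a t - profile_slope a \<xi> = D \<zeta> * (t - \<xi>)"
    by (rule mvt_between[of \<xi> t "profile_slope a" D]) (use D(1) pos xi t in auto)
  have zmin: "min x t \<le> \<zeta>" using ze(1) xi(1) by auto
  have "\<bar>y - profile_slope a t * (t - x)\<bar> = \<bar>D \<zeta>\<bar> * \<bar>t - \<xi>\<bar> * \<bar>t - x\<bar>"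
  proof -
    have "y - profile_slope a t * (t - x) = - (profile_slope a t - profile_slope a \<xi>) * (t - x)"
      by (simp add: y_def xi(3) algebra_simps)
    then show ?thesis by (simp only: ze(3) abs_mult abs_minus)
  qed
  also have "\<dots> \<le> (9/8 * t powr (-(15/8))) * \<bar>t - x\<bar> * \<bar>t - x\<bar>"
  proof (intro mult_right_mono mult_mono)
    have "3 powr (15/8) \<le> (9::real)" using powr_mono[of "15/8" 2 "3::real"] by simp
    then have "3 powr (15/8) * t powr (-(15/8)) \<le> 9 * t powr (-(15/8))"
      by (intro mult_right_mono) auto
    then show "\<bar>D \<zeta>\<bar> \<le> 9/8 * t powr (-(15/8))"
      using D(2)[OF pos(2)[OF zmin]] pw[OF zmin, of "15/8"] by simp
    show "\<bar>t - \<xi>\<bar> \<le> \<bar>t - x\<bar>" using xi(1,2) by (auto simp: min_def max_def split: if_splits)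
  qed auto
  also have "\<dots> \<le> (9/8 * t powr (-(15/8))) * (3 * t powr (1/2)) * (3 * t powr (1/2))"
    using tx sq by (intro mult_mono) auto
  also have "\<dots> = 81/8 * (t powr (-(15/8)) * t powr (1/2) * t powr (1/2))" by simp
  also have "t powr (-(15/8)) * t powr (1/2) * t powr (1/2) = t powr (-7/8)"
    by (simp flip: powr_add)
  also have "81/8 * t powr (-7/8) \<le> 81/8 * t powr (-3/4)"
    using t by (intro mult_left_mono powr_mono) auto
  finally have "\<bar>y - profile_slope a t * (t - x)\<bar> \<le> 81/8 * t powr (-3/4)" .
  then have "\<bar>exp y - 1 - profile_slope a t * (t - x)\<bar> \<le> 81/256 * t powr (-3/4) + 81/8 * t powr (-3/4)"
    using abs_exp_minus_1_minus_id[OF y1] y2 by linarith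
  also have "\<dots> \<le> 11 * t powr (-3/4)" by simp
  finally show ?thesis by (simp add: y_def)
qed

section \<open>The weighted estimate for eigenfunctions\<close>

text \<open>The half-integers are those in the definition of \<open>dil1\<close>. This is why the first-order part of the
  conjugated Laplacian is exactly a multiple of the dilation generator.\<close>

lemma jbracket_sq_step:
  "(jbracket (n - unit i))\<^sup>2 = (jbracket n)\<^sup>2 - 2 * (of_int (n $ i) - 1/2)"
  "(jbracket (n + unit i))\<^sup>2 = (jbracket n)\<^sup>2 + 2 * (of_int (n $ i) + 1/2)"
proof -
  have s: "(\<Sum>j\<in>UNIV. (real_of_int (n $ j) + (if j = i then c else 0))\<^sup>2)
      = (\<Sum>j\<in>UNIV. (real_of_int (n $ j))\<^sup>2) + 2 * c * of_int (n $ i) + c\<^sup>2" for c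
  proof -
    have "(\<Sum>j\<in>UNIV. (real_of_int (n $ j) + (if j = i then c else 0))\<^sup>2)
        = (\<Sum>j\<in>UNIV. (real_of_int (n $ j))\<^sup>2 + (if j = i then 2 * c * of_int (n $ i) + c\<^sup>2 else 0))"
      by (intro sum.cong) (auto simp: power2_sum)
    then show ?thesis by (simp add: sum.distrib)
  qed
  have "(real_of_int ((n - unit i) $ j)) = real_of_int (n $ j) + (if j = i then -1 else 0)"
    "(real_of_int ((n + unit i) $ j)) = real_of_int (n $ j) + (if j = i then 1 else 0)" for j
    by (simp_all add: axis_def)
  then show "(jbracket (n - unit i))\<^sup>2 = (jbracket n)\<^sup>2 - 2 * (of_int (n $ i) - 1/2)"
    "(jbracket (n + unit i))\<^sup>2 = (jbracket n)\<^sup>2 + 2 * (of_int (n $ i) + 1/2)"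
    by (simp_all only: jbracket_sq lnorm_sq s) simp_all
qed

definition weight_exp :: "real \<Rightarrow> int ^ 'd \<Rightarrow> real" where
  "weight_exp a n = profile a ((jbracket n)\<^sup>2)"

definition weight_slope :: "real \<Rightarrow> int ^ 'd \<Rightarrow> real" where
  "weight_slope a n = 2 * profile_slope a ((jbracket n)\<^sup>2)"

lemma jbracket_sq_powr: "((jbracket n)\<^sup>2) powr e = jbracket n powr (2 * e)"
  by (simp add: powr_powr[symmetric] less_imp_le)

lemma weight_exp_expansion_aux:
  assumes a: "0 \<le> a" and z: "(jbracket m)\<^sup>2 = (jbracket n)\<^sup>2 - 2 * c" and c: "\<bar>c\<bar> \<le> \<bar>real_of_int (n $ i)\<bar> + 1/2"
    and c': "c \<le> \<bar>real_of_int (n $ i)\<bar> - 1/2"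
  shows "jbracket n * \<bar>exp (weight_exp a n - weight_exp a m) - 1 - weight_slope a n * c\<bar> \<le> 11 * jbracket n powr (-1/2)"
proof -
  let ?t = "(jbracket n)\<^sup>2" and ?x = "(jbracket m)\<^sup>2"
  have j: "1 \<le> jbracket n" "1 \<le> jbracket m" by simp_all
  have t1: "1 \<le> ?t" "1 \<le> ?x" using j by (simp_all only: one_le_power)
  have c1: "2 * \<bar>c\<bar> \<le> 2 * \<bar>real_of_int (n $ i)\<bar> + 1" using c by simp
  have tx: "\<bar>?t - ?x\<bar> \<le> 3 * sqrt ?t"
  proof -
    have "2 * \<bar>c\<bar> \<le> 3 * jbracket n" using c1 coord_le_jbracket[of n i] j by linarith
    then show ?thesis by (simp add: z abs_mult)
  qed
  have "(real_of_int (n $ i))\<^sup>2 \<le> (lnorm n)\<^sup>2"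
    using coord_le_lnorm[of n i] by (simp add: abs_le_square_iff[symmetric])
  then have "1 + \<bar>real_of_int (n $ i)\<bar>\<^sup>2 \<le> ?t" by (simp add: jbracket_sq)
  moreover have "0 \<le> (\<bar>real_of_int (n $ i)\<bar> - 3/2)\<^sup>2" by simp
  ultimately have "?t \<le> 3 * ?x"
    using c' unfolding z by (simp add: power2_eq_square algebra_simps)
  then have "\<bar>exp (profile a ?t - profile a ?x) - 1 - profile_slope a ?t * (?t - ?x)\<bar> \<le> 11 * ?t powr (-3/4)"
    using a t1 tx by (intro profile_expansion) auto
  moreover have "profile_slope a ?t * (?t - ?x) = weight_slope a n * c" by (simp add: z weight_slope_def)
  ultimately have "\<bar>exp (weight_exp a n - weight_exp a m) - 1 - weight_slope a n * c\<bar> \<le> 11 * ?t powr (-3/4)"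
    by (simp only: weight_exp_def)
  then have "jbracket n * \<bar>exp (weight_exp a n - weight_exp a m) - 1 - weight_slope a n * c\<bar> \<le> jbracket n * (11 * ?t powr (-3/4))"
    by (intro mult_left_mono) (auto simp: less_imp_le)
  also have "?t powr (-3/4) = jbracket n powr (-3/2)" by (simp add: jbracket_sq_powr)
  also have "jbracket n * (11 * jbracket n powr (-3/2)) = 11 * (jbracket n powr 1 * jbracket n powr (-3/2))"
    by (simp add: less_imp_le)
  also have "jbracket n powr 1 * jbracket n powr (-3/2) = jbracket n powr (-1/2)"
    by (simp only: powr_add[symmetric]) simp
  finally show ?thesis .
qed

lemma weight_exp_expansion:
  assumes "0 \<le> a"
  shows "jbracket n * \<bar>exp (weight_exp a n - weight_exp a (n - unit i)) - 1 - weight_slope a n * (of_int (n $ i) - 1/2)\<bar>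
          \<le> 11 * jbracket n powr (-1/2)"
    and "jbracket n * \<bar>exp (weight_exp a n - weight_exp a (n + unit i)) - 1 + weight_slope a n * (of_int (n $ i) + 1/2)\<bar>
          \<le> 11 * jbracket n powr (-1/2)"
  using weight_exp_expansion_aux[OF assms, of "n - unit i" n "of_int (n $ i) - 1/2" i]
    weight_exp_expansion_aux[OF assms, of "n + unit i" n "- (of_int (n $ i) + 1/2)" i]
  by (auto simp: jbracket_sq_step algebra_simps)

lemma weight_slope_nonneg: "0 \<le> weight_slope a n"
  by (simp add: weight_slope_def profile_slope_nonneg)

lemma weight_slope_le:
  assumes "0 \<le> a"
  shows "2 * (jbracket n * weight_slope a n) \<le> 11 * jbracket n powr (-1/2)"
proof -
  have "weight_slope a n \<le> 1/8 * jbracket n powr (-7/4)"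
    using profile_slope_le[OF assms, of "(jbracket n)\<^sup>2"] by (simp add: weight_slope_def jbracket_sq_powr zero_less_power)
  then have "2 * (jbracket n * weight_slope a n) \<le> 2 * (jbracket n * (1/8 * jbracket n powr (-7/4)))"
    by (intro mult_left_mono) (auto simp: less_imp_le)
  also have "\<dots> = 1/4 * (jbracket n powr 1 * jbracket n powr (-7/4))"
    by (simp add: less_imp_le)
  also have "jbracket n powr 1 * jbracket n powr (-7/4) = jbracket n powr (-3/4)"
    by (simp only: powr_add[symmetric]) simp
  also have "1/4 * jbracket n powr (-3/4) \<le> 11 * jbracket n powr (-1/2)"
    by (intro mult_mono powr_mono) auto
  finally show ?thesis .
qed

lemma weight_exp_le:
  assumes "0 \<le> a"
  shows "2 * weight_exp a n \<le> jbracket n powr (1/4)"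
proof -
  have "(1 + a * (jbracket n)\<^sup>2) powr (-1/8) \<le> 1"
    using assms by (intro powr_neg_le_1) auto
  then have "2 * weight_exp a n \<le> ((jbracket n)\<^sup>2) powr (1/8)"
    using mult_left_le by (fastforce simp: weight_exp_def profile_def)
  then show ?thesis by (simp add: jbracket_sq_powr)
qed

lemma weight_exp_bounded:
  assumes "0 < a"
  shows "weight_exp a n \<le> a powr (-1/8)"
proof -
  let ?t = "(jbracket n)\<^sup>2"
  have t: "0 < ?t" by (simp add: zero_less_power)
  have "(1 + a * ?t) powr (-1/8) \<le> (a * ?t) powr (-1/8)"
    using assms t by (intro powr_mono2') auto
  also have "\<dots> = a powr (-1/8) * ?t powr (-1/8)"
    by (rule powr_mult)
  finally have "?t powr (1/8) * (1 + a * ?t) powr (-1/8)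
      \<le> ?t powr (1/8) * (a powr (-1/8) * ?t powr (-1/8))"
    by (intro mult_left_mono) auto
  also have "\<dots> = a powr (-1/8) * (?t powr (1/8) * ?t powr (-1/8))" by simp
  also have "?t powr (1/8) * ?t powr (-1/8) = 1"
    using t by (simp only: powr_add[symmetric]) simp
  finally have "weight_exp a n \<le> 1/2 * a powr (-1/8)" by (simp add: weight_exp_def profile_def)
  also have "\<dots> \<le> a powr (-1/8)" by simp
  finally show ?thesis .
qed

lemma weight_exp_limit: "((\<lambda>a. 2 * weight_exp a n) \<longlongrightarrow> jbracket n powr (1/4)) (at_right 0)"
proof -
  have "((\<lambda>a. 2 * weight_exp a n) \<longlongrightarrow> 2 * (1/2 * (((jbracket n)\<^sup>2) powr (1/8) * (1 + 0 * (jbracket n)\<^sup>2) powr (-1/8))))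
    (at_right 0)"
    unfolding weight_exp_def profile_def by (intro tendsto_intros) auto
  then show ?thesis by (simp add: jbracket_sq_powr)
qed

text \<open>For \<open>v = exp f \<eta> u\<close> the eigenvalue equation of \<open>u\<close> removes everything except the commutator of the
  Laplacian with the cutoff \<open>\<eta>\<close>.\<close>

lemma conjugated_equation:
  fixes u :: "int ^ 'd::finite \<Rightarrow> complex" and \<eta> f g V :: "int ^ 'd \<Rightarrow> real"
  assumes eig: "hamiltonian V w k u = cscale (of_real \<nu>) u"
    and v: "\<And>n. val v n = of_real (exp (f n) * \<eta> n) * u n"
  defines "r \<equiv> \<lambda>i n. exp (f n - f (n - unit i)) - 1 - g n * (of_int (n $ i) - 1/2)"
    and "r' \<equiv> \<lambda>i n. exp (f n - f (n + unit i)) - 1 + g n * (of_int (n $ i) + 1/2)"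
  shows "val (lap v - \<nu> *\<^sub>R v + rmul V v + rmul (wigner_von_neumann w k) v - rmul g (dil v)
      - (\<Sum>i\<in>UNIV. rmul (r i) (tr (unit i) v) + rmul (r' i) (tr (- unit i) v))) n
    = of_real (exp (f n)) * (\<Sum>i\<in>UNIV. of_real (\<eta> n - \<eta> (n - unit i)) * u (n - unit i)
        + of_real (\<eta> n - \<eta> (n + unit i)) * u (n + unit i))"
proof -
  let ?W = "wigner_von_neumann w k n"
  define e where "e = complex_of_real (exp (f n))"
  define U where "U = complex_of_real (V n + ?W - \<nu>)"
  have ex: "complex_of_real (exp (f n - f m)) * val v m = e * (of_real (\<eta> m) * u m)" for m
    by (simp add: v e_def exp_diff)
  let ?t = "\<lambda>i. 2 * val v n - val v (n - unit i) - val v (n + unit i)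
      - of_real (g n) * (of_real (of_int (n $ i) - 1/2) * val v (n - unit i)
                        - of_real (of_int (n $ i) + 1/2) * val v (n + unit i))
      - (of_real (r i n) * val v (n - unit i) + of_real (r' i n) * val v (n + unit i))"
  have term1: "?t i
      = e * (of_real (\<eta> n) * (2 * u n - u (n - unit i) - u (n + unit i)))
        + e * (of_real (\<eta> n - \<eta> (n - unit i)) * u (n - unit i)
             + of_real (\<eta> n - \<eta> (n + unit i)) * u (n + unit i))" for i
  proof -
    have "?t i
      = 2 * val v n - of_real (exp (f n - f (n - unit i))) * val v (n - unit i)
        - of_real (exp (f n - f (n + unit i))) * val v (n + unit i)"
      by (simp add: r_def r'_def algebra_simps)
    also have "\<dots> = 2 * (e * (of_real (\<eta> n) * u n)) - e * (of_real (\<eta> (n - unit i)) * u (n - unit i))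
        - e * (of_real (\<eta> (n + unit i)) * u (n + unit i))"
      unfolding ex by (simp add: v e_def mult_ac)
    finally show ?thesis by (simp add: algebra_simps)
  qed
  have eq: "(\<Sum>i\<in>UNIV. 2 * u n - u (n - unit i) - u (n + unit i)) + U * u n = 0"
    using fun_cong[OF eig, of n]
    by (simp add: hamiltonian_def laplacian_def shift_def shift_adj_def mult_op_def cscale_def U_def algebra_simps)
  have "val (lap v - \<nu> *\<^sub>R v + rmul V v + rmul (wigner_von_neumann w k) v - rmul g (dil v)
      - (\<Sum>i\<in>UNIV. rmul (r i) (tr (unit i) v) + rmul (r' i) (tr (- unit i) v))) n
    = (\<Sum>i\<in>UNIV. ?t i) + U * val v n"
    by (simp add: lap_def lap1_def dil_def dil1_def U_def sum_subtractf sum.distrib sum_distrib_left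
        scaleR_conv_of_real algebra_simps)
  also have "\<dots> = e * of_real (\<eta> n) * ((\<Sum>i\<in>UNIV. 2 * u n - u (n - unit i) - u (n + unit i)) + U * u n)
      + e * (\<Sum>i\<in>UNIV. of_real (\<eta> n - \<eta> (n - unit i)) * u (n - unit i)
             + of_real (\<eta> n - \<eta> (n + unit i)) * u (n + unit i))"
    unfolding term1 sum.distrib[of "\<lambda>i. e * _ i"]
    by (simp add: v e_def[symmetric] sum_distrib_left distrib_left mult.assoc)
  also have "\<dots> = e * (\<Sum>i\<in>UNIV. of_real (\<eta> n - \<eta> (n - unit i)) * u (n - unit i)
             + of_real (\<eta> n - \<eta> (n + unit i)) * u (n + unit i))"
    unfolding eq by simp
  finally show ?thesis by (simp only: e_def)
qed

lemma ell2_tail: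
  assumes "u \<in> ell2" "0 < \<epsilon>"
  shows "\<exists>R. \<forall>Y. finite Y \<longrightarrow> (\<forall>n\<in>Y. R \<le> lnorm n) \<longrightarrow> (\<Sum>n\<in>Y. (cmod (u n))\<^sup>2) \<le> \<epsilon>"
proof -
  let ?f = "\<lambda>n. (cmod (u n))\<^sup>2"
  define S where "S = infsum ?f UNIV"
  have summ: "?f summable_on UNIV" using assms(1) by (simp add: ell2_def)
  then have "(?f has_sum S) UNIV" by (simp add: S_def)
  then have "(sum ?f \<longlongrightarrow> S) (finite_subsets_at_top UNIV)" by (simp add: has_sum_def)
  from tendstoD[OF this assms(2)] obtain X where X: "finite X"
    "\<And>Z. finite Z \<Longrightarrow> X \<subseteq> Z \<Longrightarrow> dist (sum ?f Z) S < \<epsilon>"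
    unfolding eventually_finite_subsets_at_top by auto
  define R where "R = Max (insert 0 (lnorm ` X)) + 1"
  have "sum ?f Y \<le> \<epsilon>" if Y: "finite Y" "\<forall>n\<in>Y. R \<le> lnorm n" for Y
  proof -
    have "X \<inter> Y = {}"
    proof (rule equals0I)
      fix n assume n: "n \<in> X \<inter> Y"
      have "lnorm n \<le> Max (insert 0 (lnorm ` X))" using X(1) n by (intro Max_ge) auto
      moreover have "Max (insert 0 (lnorm ` X)) + 1 \<le> lnorm n" using n Y(2) unfolding R_def by blast
      ultimately show False by linarith
    qed
    then have "sum ?f (X \<union> Y) = sum ?f X + sum ?f Y" using X(1) Y(1) by (intro sum.union_disjoint) auto
    moreover have "sum ?f (X \<union> Y) \<le> S"
      unfolding S_def using X(1) Y(1) by (intro finite_sum_le_infsum summ) auto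
    moreover have "S - \<epsilon> < sum ?f X" using X(2)[OF X(1)] by (auto simp: dist_real_def)
    ultimately show ?thesis by linarith
  qed
  then show ?thesis by blast
qed

definition cutoff :: "real \<Rightarrow> int ^ 'd \<Rightarrow> real" where
  "cutoff R n = max 0 (min 1 (2 - lnorm n / R))"

lemma cutoff_bounds [simp]: "0 \<le> cutoff R n" "cutoff R n \<le> 1"
  by (simp_all add: cutoff_def)

lemma cutoff_eq_1: "0 < R \<Longrightarrow> lnorm n \<le> R \<Longrightarrow> cutoff R n = 1"
  by (simp add: cutoff_def min_def max_def divide_le_eq)

lemma cutoff_eq_0: "0 < R \<Longrightarrow> 2 * R \<le> lnorm n \<Longrightarrow> cutoff R n = 0"
  using le_divide_eq[of 2 "lnorm n" R] by (simp add: cutoff_def)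

lemma clamp_lipschitz: "\<bar>max 0 (min 1 x) - max 0 (min 1 y)\<bar> \<le> \<bar>x - y\<bar>" for x y :: real
  by (auto simp: min_def max_def abs_if)

text \<open>The cutoff has slope \<open>1/R\<close> and varies only where \<open>\<langle>n\<rangle>\<close> is comparable to \<open>R\<close>; this compensates the factor
  \<open>\<langle>n\<rangle>\<close> that the commutator estimate loses.\<close>

lemma cutoff_step:
  assumes R: "1 \<le> R" and mn: "\<bar>lnorm m - lnorm n\<bar> \<le> 1"
  shows "jbracket n * \<bar>cutoff R n - cutoff R m\<bar> \<le> (if R - 1 \<le> lnorm m \<and> lnorm m \<le> 2 * R + 1 then 4 else 0)"
proof (cases "R - 1 \<le> lnorm m \<and> lnorm m \<le> 2 * R + 1")
  case True
  show ?thesis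
  proof (cases "lnorm n \<le> 2 * R + 1")
    case n: True
    have "jbracket n \<le> 1 + lnorm n"
      by (rule power2_le_imp_le) (simp_all add: jbracket_sq power2_sum)
    then have j: "jbracket n \<le> 4 * R" using n R by linarith
    have "\<bar>cutoff R n - cutoff R m\<bar> \<le> \<bar>lnorm m / R - lnorm n / R\<bar>"
      unfolding cutoff_def by (rule order_trans[OF clamp_lipschitz]) simp
    also have "\<dots> \<le> 1 / R"
      using mn R by (simp add: diff_divide_distrib[symmetric] divide_right_mono)
    finally have "jbracket n * \<bar>cutoff R n - cutoff R m\<bar> \<le> (4 * R) * (1 / R)"
      using j R by (intro mult_mono) auto
    then show ?thesis using True R by simp
  next
    case False
    then have "2 * R \<le> lnorm n" "2 * R \<le> lnorm m" using mn by linarith+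
    then have "cutoff R n = 0" "cutoff R m = 0" using R by (simp_all add: cutoff_eq_0)
    then show ?thesis by simp
  qed
next
  case False
  then consider "lnorm m < R - 1" | "2 * R + 1 < lnorm m" by linarith
  then have "cutoff R n = cutoff R m"
  proof cases
    case 1
    then have "lnorm n \<le> R" "lnorm m \<le> R" using mn by linarith+
    then have "cutoff R n = 1" "cutoff R m = 1" using R by (simp_all add: cutoff_eq_1)
    then show ?thesis by simp
  next
    case 2
    then have "2 * R \<le> lnorm n" "2 * R \<le> lnorm m" using mn by linarith+
    then have "cutoff R n = 0" "cutoff R m = 0" using R by (simp_all add: cutoff_eq_0)
    then show ?thesis by simp
  qed
  then show ?thesis using False by auto
qed

lemma exists_fsf:
  assumes "finite {n. f n \<noteq> 0}"
  shows "\<exists>v. \<forall>n. val v n = f n"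
  by (rule exI[of _ "Fsf f"]) (use Fsf_inverse[of f] assms in simp)

definition cutoff_flux :: "real \<Rightarrow> (int ^ 'd \<Rightarrow> complex) \<Rightarrow> int ^ 'd \<Rightarrow> real" where
  "cutoff_flux R u n = (\<Sum>i\<in>UNIV. jbracket n * \<bar>cutoff R n - cutoff R (n - unit i)\<bar> * cmod (u (n - unit i))
     + jbracket n * \<bar>cutoff R n - cutoff R (n + unit i)\<bar> * cmod (u (n + unit i)))"

text \<open>By \<open>cutoff_step\<close> the commutator with the cutoff is controlled by the mass of \<open>u\<close> in the shell
  where the cutoff varies, and this is part of the tail of a square-summable function.\<close>

lemma cutoff_commutator_small:
  fixes u :: "int ^ 'd::finite \<Rightarrow> complex"
  assumes u: "u \<in> ell2" and "0 < \<epsilon>"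
  shows "\<exists>R0\<ge>1. \<forall>R\<ge>R0. \<forall>v :: 'd fsf.
    (\<forall>n. cmod (val v n) \<le> cutoff_flux R u n) \<longrightarrow> norm v \<le> \<epsilon>"
proof -
  \<comment> \<open>There are \<open>2 d\<close> neighbours, each with the factor 4 from the cutoff.\<close>
  define \<epsilon>' where "\<epsilon>' = \<epsilon> / (8 * real CARD('d))"
  have e': "0 < \<epsilon>'" using assms(2) by (simp add: \<epsilon>'_def)
  obtain R1 where R1: "\<And>Y. finite Y \<Longrightarrow> (\<forall>n\<in>Y. R1 \<le> lnorm n) \<Longrightarrow> (\<Sum>n\<in>Y. (cmod (u n))\<^sup>2) \<le> \<epsilon>'\<^sup>2"
    using ell2_tail[OF u zero_less_power[OF e', of 2]] by blast
  show ?thesis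
  proof (intro exI[of _ "max 1 (R1 + 1)"] conjI allI impI)
    fix R and v :: "'d fsf"
    assume "max 1 (R1 + 1) \<le> R"
    then have R: "1 \<le> R" "R1 \<le> R - 1" by auto
    assume v: "\<forall>n. cmod (val v n) \<le> cutoff_flux R u n"
    define T where "T = {n :: int ^ 'd. R - 1 \<le> lnorm n \<and> lnorm n \<le> 2 * R + 1}"
    have T: "finite T" unfolding T_def by (rule finite_subset[OF _ finite_lnorm_le[of "2 * R + 1"]]) auto
    have "finite {n. (if n \<in> T then complex_of_real (cmod (u n)) else 0) \<noteq> 0}"
      by (rule finite_subset[OF _ T]) auto
    from exists_fsf[OF this]
    obtain x :: "'d fsf" where x: "\<And>n. val x n = (if n \<in> T then of_real (cmod (u n)) else 0)"
      by blast
    have "(norm x)\<^sup>2 = (\<Sum>n\<in>T. (cmod (val x n))\<^sup>2)"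
      by (rule norm_fsf_superset[OF T]) (auto simp: supp_def x split: if_splits)
    also have "\<dots> = (\<Sum>n\<in>T. (cmod (u n))\<^sup>2)" by (intro sum.cong) (auto simp: x)
    also have "\<dots> \<le> \<epsilon>'\<^sup>2" using T R by (intro R1) (auto simp: T_def)
    finally have nx: "norm x \<le> \<epsilon>'" by (rule power2_le_imp_le) (use e' in simp)
    have step: "jbracket n * \<bar>cutoff R n - cutoff R m\<bar> * cmod (u m) \<le> 4 * Re (val x m)"
      if "\<bar>lnorm m - lnorm n\<bar> \<le> 1" for n m
    proof -
      have "jbracket n * \<bar>cutoff R n - cutoff R m\<bar> * cmod (u m)
          \<le> (if R - 1 \<le> lnorm m \<and> lnorm m \<le> 2 * R + 1 then 4 else 0) * cmod (u m)"
        by (rule mult_right_mono[OF cutoff_step[OF R(1) that]]) simp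
      also have "\<dots> = 4 * Re (val x m)" by (simp add: x T_def)
      finally show ?thesis .
    qed
    define y where "y = 4 *\<^sub>R (\<Sum>i\<in>UNIV. tr (unit i) x + tr (- unit i) x)"
    have "norm v \<le> norm y"
    proof (rule norm_fsf_mono)
      fix n
      have "cmod (val v n) \<le> (\<Sum>i\<in>UNIV. 4 * Re (val x (n - unit i)) + 4 * Re (val x (n + unit i)))"
        by (rule order_trans[OF v[rule_format, unfolded cutoff_flux_def]]) (intro sum_mono add_mono step lnorm_step)
      also have "\<dots> = Re (val y n)" by (simp add: y_def sum_distrib_left)
      also have "\<dots> \<le> cmod (val y n)" by (rule complex_Re_le_cmod)
      finally show "cmod (val v n) \<le> cmod (val y n)" .
    qed
    also have "norm y \<le> 4 * (\<Sum>i\<in>(UNIV::'d set). 2 * \<epsilon>')"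
    proof -
      have "norm (tr (unit i) x + tr (- unit i) x) \<le> 2 * \<epsilon>'" for i
        using norm_triangle_ineq[of "tr (unit i) x" "tr (- unit i) x"] nx by simp
      then have "norm (\<Sum>i\<in>UNIV. tr (unit i) x + tr (- unit i) x) \<le> (\<Sum>i\<in>(UNIV::'d set). 2 * \<epsilon>')"
        by (rule sum_norm_le)
      then show ?thesis by (simp add: y_def mult_ac)
    qed
    also have "\<dots> = \<epsilon>" by (simp add: \<epsilon>'_def)
    finally show "norm v \<le> \<epsilon>" .
  qed simp
qed

lemma small_at_infinity:
  fixes V :: "int ^ 'd::finite \<Rightarrow> real" and w k \<epsilon> :: real
  assumes V: "(V \<longlongrightarrow> 0) at_inf_lattice"
    and dV: "\<And>i. ((\<lambda>n. of_int (n $ i) * (V n - V (n - unit i))) \<longlongrightarrow> 0) at_inf_lattice"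
    and "0 < \<epsilon>"
  obtains B0 C0 where "finite B0" "11 \<le> C0" "small_potentials V w k \<epsilon> C0 B0"
    "\<And>n. n \<notin> B0 \<Longrightarrow> 11 * jbracket n powr (-1/2) \<le> \<epsilon>"
proof -
  have small: "\<forall>\<^sub>F n in at_inf_lattice. \<bar>f n\<bar> \<le> \<epsilon>" if "(f \<longlongrightarrow> 0) at_inf_lattice" for f :: "int ^ 'd \<Rightarrow> real"
    using tendstoD[OF that assms(3)] by (rule eventually_mono) (auto simp: dist_real_def)
  have dV': "((\<lambda>n. (of_int (n $ i) + 1/2) * (V (n + unit i) - V n)) \<longlongrightarrow> 0) at_inf_lattice" for i
  proof -
    have "((\<lambda>n. of_int ((n + unit i) $ i) * (V (n + unit i) - V (n + unit i - unit i))) \<longlongrightarrow> 0) at_inf_lattice"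
      by (rule filterlim_compose[OF dV shift_at_inf_lattice])
    moreover have "((\<lambda>n. V (n + unit i)) \<longlongrightarrow> 0) at_inf_lattice"
      by (rule filterlim_compose[OF V shift_at_inf_lattice])
    ultimately have "((\<lambda>n. of_int ((n + unit i) $ i) * (V (n + unit i) - V (n + unit i - unit i))
        - 1/2 * (V (n + unit i) - V n)) \<longlongrightarrow> 0 - 1/2 * (0 - 0)) at_inf_lattice"
      by (intro tendsto_intros V)
    then show ?thesis by (simp add: axis_nth algebra_simps)
  qed
  have rho: "((\<lambda>n :: int ^ 'd. 11 * jbracket n powr (-1/2)) \<longlongrightarrow> 0) at_inf_lattice"
  proof -
    have "((\<lambda>n :: int ^ 'd. 11 * jbracket n powr (-1/2)) \<longlongrightarrow> 11 * 0) at_inf_lattice"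
      by (intro tendsto_intros tendsto_neg_powr jbracket_at_top) auto
    then show ?thesis by simp
  qed
  have "\<forall>\<^sub>F n in at_inf_lattice. \<bar>V n\<bar> \<le> \<epsilon> \<and> \<bar>wigner_von_neumann w k n\<bar> \<le> \<epsilon>
      \<and> (\<forall>i. \<bar>(of_int (n $ i) + 1/2) * (V (n + unit i) - V n)\<bar> \<le> \<epsilon>)
      \<and> (\<forall>i j. \<bar>omega i n - omega i (n - unit j)\<bar> \<le> \<epsilon> \<and> \<bar>omega i n - omega i (n + unit j)\<bar> \<le> \<epsilon>)
      \<and> \<bar>11 * jbracket n powr (-1/2)\<bar> \<le> \<epsilon>" (is "eventually ?P _")
    by (intro eventually_conj small V wvn_tendsto_0 rho eventually_all_finite dV'
        omega_difference_eventually assms(3))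
  then have fin: "finite {n. \<not> ?P n}" by (rule finite_exceptions)
  obtain c1 where c1: "\<And>n. \<bar>V n\<bar> \<le> c1" using tendsto_0_imp_bounded[OF V] by blast
  obtain c2 where c2: "\<And>n :: int ^ 'd. \<bar>wigner_von_neumann w k n\<bar> \<le> c2"
    using tendsto_0_imp_bounded[OF wvn_tendsto_0] by blast
  have "\<forall>i. \<exists>c. \<forall>n. \<bar>(of_int (n $ i) + 1/2) * (V (n + unit i) - V n)\<bar> \<le> c"
    using tendsto_0_imp_bounded[OF dV'] by blast
  then obtain c3 where c3: "\<And>i n. \<bar>(of_int (n $ i) + 1/2) * (V (n + unit i) - V n)\<bar> \<le> c3 i" by metis
  define C0 where "C0 = Max ({11, c1, c2} \<union> range c3)"
  have C0: "c \<le> C0" if "c \<in> {11, c1, c2} \<union> range c3" for c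
    unfolding C0_def by (rule Max_ge[OF _ that]) simp
  show thesis
  proof (rule that[of "{n. \<not> ?P n}" C0, OF fin])
    show "11 \<le> C0" by (intro C0) simp
    show "small_potentials V w k \<epsilon> C0 {n. \<not> ?P n}"
    proof
      show "\<bar>V n\<bar> \<le> C0" for n by (rule order_trans[OF c1 C0]) simp
      show "\<bar>wigner_von_neumann w k n\<bar> \<le> C0" for n :: "int ^ 'd" by (rule order_trans[OF c2 C0]) simp
      show "\<bar>(of_int (n $ i) + 1/2) * (V (n + unit i) - V n)\<bar> \<le> C0" for n i
        by (rule order_trans[OF c3 C0]) simp
    qed auto
  qed auto
qed

definition concentrated :: "real \<Rightarrow> (int ^ 'd) set \<Rightarrow> (int ^ 'd \<Rightarrow> complex) \<Rightarrow> bool" where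
  "concentrated C B u \<longleftrightarrow> (\<forall>G. finite G \<longrightarrow>
     (\<Sum>n\<in>G. exp (jbracket n powr (1/4)) * (cmod (u n))\<^sup>2) \<le> C * (\<Sum>n\<in>B. (cmod (u n))\<^sup>2))"

text \<open>The constant of the commutator estimate fixes \<open>\<epsilon>\<close>, and \<open>\<epsilon>\<close> fixes the finite set \<open>B\<close>. For a fixed
  regularisation \<open>a > 0\<close> the weight is bounded, so the cutoff error disappears as the cutoff widens;
  the resulting bound does not depend on \<open>a\<close>, and \<open>a\<close> tends to zero at the end.\<close>

lemma low_energy_estimate:
  fixes V :: "int ^ 'd::finite \<Rightarrow> real" and w k E :: real
  assumes V: "(V \<longlongrightarrow> 0) at_inf_lattice"
    and dV: "\<And>i. ((\<lambda>n. of_int (n $ i) * (V n - V (n - unit i))) \<longlongrightarrow> 0) at_inf_lattice"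
    and E: "0 < E" "E < 4" "E < 2 * real CARD('d) * (1 - \<bar>cos (k/2)\<bar>)"
  shows "\<exists>\<delta>>0. \<exists>C B. finite B \<and>
    (\<forall>\<nu> u. \<bar>\<nu> - E\<bar> < \<delta> \<longrightarrow> u \<in> eigenspace (hamiltonian V w k) \<nu> \<longrightarrow> concentrated C B u)"
proof -
  define d where "d = real CARD('d)"
  define \<kappa> where "\<kappa> = 2 * d * (1 - \<bar>cos (k/2)\<bar>) - E"
  \<comment> \<open>Near \<open>E\<close> the gap, the lower bound for \<open>\<nu> (4 - \<nu>)\<close>, and hence the constant \<open>K\<close>, are uniform in \<open>\<nu>\<close>.\<close>
  define \<delta> where "\<delta> = min (E/2) (min ((4 - E) / 2) (\<kappa> / 2))"
  define \<delta>' where "\<delta>' = (E/2) * ((4 - E) / 2)"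
  define K where "K = carleman_const d w \<kappa> \<delta>'"
  have kap: "0 < \<kappa>" using E by (simp add: \<kappa>_def d_def)
  have d: "0 < \<delta>" using E kap by (simp add: \<delta>_def)
  have d': "0 < \<delta>'" using E by (simp add: \<delta>'_def)
  have K: "1 \<le> K" using kap d' by (simp add: K_def carleman_const_def d_def)
  \<comment> \<open>This choice lets the term \<open>K \<epsilon> \<parallel>v\<parallel>\<close> be absorbed by the left-hand side.\<close>
  define \<epsilon> where "\<epsilon> = 1 / (2 * K)"
  have eps: "0 < \<epsilon>" using K by (simp add: \<epsilon>_def)
  obtain B0 C0 where B0: "finite B0" and C0: "11 \<le> C0" and pot: "small_potentials V w k \<epsilon> C0 B0"
    and rho: "\<And>n. n \<notin> B0 \<Longrightarrow> 11 * jbracket n powr (-1/2) \<le> \<epsilon>"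
    by (rule small_at_infinity[OF V dV eps, of w k]) blast
  define B where "B = B0 \<union> (\<Union>i. (\<lambda>n. n - unit i) ` B0) \<union> (\<Union>i. (\<lambda>n. n + unit i) ` B0)"
  have B: "finite B" using B0 by (simp add: B_def)
  have rho_all: "11 * jbracket n powr (-1/2) \<le> C0" for n :: "int ^ 'd"
    using powr_neg_le_1[of "jbracket n" "-1/2"] C0 by simp
  define L where "L = (\<Sum>n\<in>B. exp (jbracket n powr (1/4)))"
  define C where "C = (2 * K * C0)\<^sup>2 * L"
  have main: "concentrated C B u"
    if nu: "\<bar>\<nu> - E\<bar> < \<delta>" and u: "u \<in> eigenspace (hamiltonian V w k) \<nu>" for \<nu> u
    unfolding concentrated_def
  proof (intro allI impI)
    fix G :: "(int ^ 'd) set"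
    assume G: "finite G"
    have u2: "u \<in> ell2" and eig: "hamiltonian V w k u = cscale (of_real \<nu>) u"
      using u by (auto simp: eigenspace_def)
    have nu_close: "\<bar>\<nu> - E\<bar> < E / 2" "\<bar>\<nu> - E\<bar> < (4 - E) / 2" "\<bar>\<nu> - E\<bar> < \<kappa> / 2"
      using nu by (simp_all add: \<delta>_def)
    have nu_range: "E/2 \<le> \<nu>" "(4 - E) / 2 \<le> 4 - \<nu>"
      using nu_close(1,2) unfolding abs_less_iff by (simp_all add: field_simps)
    define S where "S = (\<Sum>n\<in>B. (cmod (u n))\<^sup>2)"
    have S: "0 \<le> S" by (simp add: S_def sum_nonneg)
    have L: "0 \<le> L" by (simp add: L_def sum_nonneg)
    let ?w = "\<lambda>a. \<Sum>n\<in>G. exp (2 * weight_exp a n) * (cmod (u n))\<^sup>2"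
    have fixed_a: "(?w a) \<le> C * S" if a: "0 < a" for a
    proof -
      have a0: "0 \<le> a" using a by simp
      define M where "M = exp (a powr (-1/8))"
      define r where "r = (\<lambda>(i::'d) (n::int ^ 'd). exp (weight_exp a n - weight_exp a (n - unit i)) - 1 - weight_slope a n * (of_int (n $ i) - 1/2))"
      define r' where "r' = (\<lambda>(i::'d) (n::int ^ 'd). exp (weight_exp a n - weight_exp a (n + unit i)) - 1 + weight_slope a n * (of_int (n $ i) + 1/2))"
      interpret small_potentials V w k \<epsilon> C0 B0 by (rule pot)
      interpret weighted_setting V w k \<epsilon> C0 B0 \<nu> \<kappa> \<delta>' d "weight_slope a" r r' B
      proof
        show "d = real CARD('d)" by (rule d_def)
        show "0 \<le> \<nu>" "\<nu> \<le> 4" using nu_range E by auto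
        have "\<delta>' \<le> \<nu> * (4 - \<nu>)"
          unfolding \<delta>'_def using nu_range E by (intro mult_mono) auto
        then show "\<delta>' \<le> 4 * \<nu> - \<nu>\<^sup>2" by (simp add: power2_eq_square algebra_simps)
        have "\<nu> \<le> E + \<kappa> / 2" using nu_close by linarith
        moreover have "4 * d - 4 * d * \<bar>cos (k/2)\<bar> = 2 * \<kappa> + 2 * E"
          by (simp add: \<kappa>_def algebra_simps)
        ultimately show "\<kappa> \<le> 4 * d - 2 * \<nu> - 4 * d * \<bar>cos (k/2)\<bar>" by linarith
        show "2 \<le> C0" using C0 by simp
        show "n \<in> B0 \<Longrightarrow> n \<in> B" "n \<in> B0 \<Longrightarrow> n - unit i \<in> B" "n \<in> B0 \<Longrightarrow> n + unit i \<in> B" for n i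
          by (auto simp: B_def)
        show "n \<notin> B0 \<Longrightarrow> 2 * (jbracket n * weight_slope a n) \<le> \<epsilon>" for n :: "int ^ 'd"
          by (rule order_trans[OF weight_slope_le[OF a0] rho])
        show "2 * (jbracket n * weight_slope a n) \<le> C0" for n :: "int ^ 'd"
          by (rule order_trans[OF weight_slope_le[OF a0] rho_all])
        show "n \<notin> B0 \<Longrightarrow> jbracket n * \<bar>r i n\<bar> \<le> \<epsilon>" "n \<notin> B0 \<Longrightarrow> jbracket n * \<bar>r' i n\<bar> \<le> \<epsilon>" for n i
          unfolding r_def r'_def by (rule order_trans[OF weight_exp_expansion(1)[OF a0] rho] order_trans[OF weight_exp_expansion(2)[OF a0] rho], assumption)+
        show "jbracket n * \<bar>r i n\<bar> \<le> C0" "jbracket n * \<bar>r' i n\<bar> \<le> C0" for n i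
          unfolding r_def r'_def by (rule order_trans[OF weight_exp_expansion(1)[OF a0] rho_all] order_trans[OF weight_exp_expansion(2)[OF a0] rho_all])+
      qed (use kap d' eps weight_slope_nonneg in auto)
      have approx: "sqrt (?w a) \<le> 2 * K * (C0 * sqrt (L * S)) + \<eta>"
        if eta: "0 < \<eta>" for \<eta>
      proof -
        define \<epsilon>2 where "\<epsilon>2 = \<eta> / (2 * K * M)"
        have e2: "0 < \<epsilon>2" using eta K by (simp add: \<epsilon>2_def M_def)
        obtain R0 where R0: "1 \<le> R0" "\<And>N v. R0 \<le> N \<Longrightarrow>
            (\<And>n. cmod (val v n) \<le> cutoff_flux N u n) \<Longrightarrow> norm (v :: 'd fsf) \<le> \<epsilon>2"
          using cutoff_commutator_small[OF u2 e2] by blast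
        \<comment> \<open>The cutoff radius is large enough for the cutoff to be 1 on \<open>G\<close>.\<close>
        define N where "N = Max (insert R0 (lnorm ` G))"
        have N: "R0 \<le> N" "\<And>n. n \<in> G \<Longrightarrow> lnorm n \<le> N"
          unfolding N_def using G by (auto intro!: Max_ge)
        have "finite {n. of_real (exp (weight_exp a n) * cutoff N n) * u n \<noteq> 0}"
        proof (rule finite_subset[OF _ finite_lnorm_le[of "2 * N"]])
          show "{n. of_real (exp (weight_exp a n) * cutoff N n) * u n \<noteq> 0} \<subseteq> {n. lnorm n \<le> 2 * N}"
          proof safe
            fix n assume "of_real (exp (weight_exp a n) * cutoff N n) * u n \<noteq> 0"
            then have "cutoff N n \<noteq> 0" by auto
            moreover have "0 < N" using N(1) R0(1) by linarith
            ultimately have "\<not> 2 * N \<le> lnorm n" using cutoff_eq_0 by blast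
            then show "lnorm n \<le> 2 * N" by simp
          qed
        qed
        from exists_fsf[OF this] obtain v :: "'d fsf"
          where v: "\<And>n. val v n = of_real (exp (weight_exp a n) * cutoff N n) * u n" by blast
        have Pv: "val (P v) n = of_real (exp (weight_exp a n)) * (\<Sum>i\<in>UNIV. of_real (cutoff N n - cutoff N (n - unit i)) * u (n - unit i)
            + of_real (cutoff N n - cutoff N (n + unit i)) * u (n + unit i))" for n
          unfolding P_def R_def unfolding r_def r'_def by (rule conjugated_equation[OF eig v])
        have "norm ((1 / M) *\<^sub>R rmul jbracket (P v)) \<le> \<epsilon>2"
        proof (rule R0(2)[OF N(1)])
          fix n :: "int ^ 'd"
          let ?D = "(\<Sum>i\<in>UNIV. of_real (cutoff N n - cutoff N (n - unit i)) * u (n - unit i)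
            + of_real (cutoff N n - cutoff N (n + unit i)) * u (n + unit i))"
          have M: "exp (weight_exp a n) / M \<le> 1" using weight_exp_bounded[OF a, of n] by (simp add: M_def)
          have "cmod (val ((1 / M) *\<^sub>R rmul jbracket (P v)) n)
              = exp (weight_exp a n) / M * (jbracket n * cmod ?D)"
            by (simp add: Pv norm_mult M_def)
          also have "\<dots> \<le> 1 * (jbracket n * cmod ?D)"
            using M by (intro mult_right_mono) (auto simp: less_imp_le)
          also have "\<dots> \<le> jbracket n * (\<Sum>i\<in>UNIV. \<bar>cutoff N n - cutoff N (n - unit i)\<bar> * cmod (u (n - unit i))
              + \<bar>cutoff N n - cutoff N (n + unit i)\<bar> * cmod (u (n + unit i)))"
            unfolding mult_1
            by (intro mult_left_mono sum_norm_le norm_triangle_le add_mono) (auto simp: norm_mult less_imp_le simp flip: of_real_diff)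
          finally show "cmod (val ((1 / M) *\<^sub>R rmul jbracket (P v)) n) \<le> cutoff_flux N u n"
            by (simp add: cutoff_flux_def sum_distrib_left distrib_left mult.assoc)
        qed
        then have p: "p v \<le> M * \<epsilon>2" by (simp add: M_def field_simps)
        have q: "norm (rmul (indicat_real B) v) \<le> sqrt (L * S)"
        proof (rule real_le_rsqrt)
          have "(norm (rmul (indicat_real B) v))\<^sup>2 = (\<Sum>n\<in>B. (cmod (val (rmul (indicat_real B) v) n))\<^sup>2)"
            by (rule norm_fsf_superset[OF B]) (auto simp: supp_def indicator_def)
          also have "\<dots> \<le> (\<Sum>n\<in>B. L * (cmod (u n))\<^sup>2)"
          proof (rule sum_mono)
            fix n assume n: "n \<in> B"
            have "(cmod (val (rmul (indicat_real B) v) n))\<^sup>2 = (exp (weight_exp a n))\<^sup>2 * (cutoff N n)\<^sup>2 * (cmod (u n))\<^sup>2"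
              using n by (simp add: v norm_mult power_mult_distrib)
            also have "\<dots> \<le> exp (jbracket n powr (1/4)) * 1 * (cmod (u n))\<^sup>2"
              using weight_exp_le[OF a0, of n] by (intro mult_right_mono mult_mono power_le_one) (auto simp flip: exp_double)
            also have "exp (jbracket n powr (1/4)) \<le> L"
              unfolding L_def by (rule member_le_sum[OF n]) (auto simp: B)
            finally show "(cmod (val (rmul (indicat_real B) v) n))\<^sup>2 \<le> L * (cmod (u n))\<^sup>2"
              by (simp add: mult_right_mono)
          qed
          also have "\<dots> = L * S" by (simp add: S_def sum_distrib_left)
          finally show "(norm (rmul (indicat_real B) v))\<^sup>2 \<le> L * S" .
        qed
        have "norm v \<le> K * (p v + Y v)" unfolding K_def by (rule carleman)
        also have "\<dots> = K * p v + 1/2 * norm v + K * C0 * norm (rmul (indicat_real B) v)"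
        proof -
          have "K * \<epsilon> = 1/2" using K by (simp add: \<epsilon>_def)
          then have "K * Y v = 1/2 * norm v + K * C0 * norm (rmul (indicat_real B) v)"
            unfolding Y_def by (simp only: distrib_left mult.assoc[symmetric])
          then show ?thesis by (simp add: distrib_left)
        qed
        finally have "norm v \<le> 2 * K * p v + 2 * K * C0 * norm (rmul (indicat_real B) v)" by simp
        also have "\<dots> \<le> 2 * K * (M * \<epsilon>2) + 2 * K * C0 * sqrt (L * S)"
          using K C0 p q by (intro add_mono mult_left_mono) auto
        also have "2 * K * (M * \<epsilon>2) = \<eta>" using K by (simp add: \<epsilon>2_def M_def)
        finally have nv: "norm v \<le> 2 * K * (C0 * sqrt (L * S)) + \<eta>" by (simp add: mult.assoc)
        have "(?w a) = (\<Sum>n\<in>G. (cmod (val v n))\<^sup>2)"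
          using N R0(1) by (intro sum.cong refl) (simp add: v cutoff_eq_1 norm_mult power_mult_distrib exp_double)
        also have "\<dots> \<le> (\<Sum>n\<in>G \<union> supp v. (cmod (val v n))\<^sup>2)"
          using G by (intro sum_mono2) auto
        also have "\<dots> = (norm v)\<^sup>2" using G by (subst norm_fsf_superset[of "G \<union> supp v"]) auto
        finally have "sqrt (?w a) \<le> norm v"
          by (rule real_le_lsqrt[rotated -1]) (auto intro: sum_nonneg)
        then show ?thesis using nv by linarith
      qed
      then have "sqrt (?w a) \<le> 2 * K * (C0 * sqrt (L * S))"
        by (rule field_le_epsilon)
      then have "(?w a) \<le> (2 * K * (C0 * sqrt (L * S)))\<^sup>2"
        by (rule sqrt_le_D)
      also have "\<dots> = C * S" using L S by (simp add: C_def power_mult_distrib)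
      finally show ?thesis .
    qed
    have "(?w
        \<longlongrightarrow> (\<Sum>n\<in>G. exp (jbracket n powr (1/4)) * (cmod (u n))\<^sup>2)) (at_right 0)"
      by (intro tendsto_intros weight_exp_limit)
    moreover have "\<forall>\<^sub>F a in at_right 0. (?w a) \<le> C * S"
      using fixed_a by (auto simp: eventually_at_right_field intro: exI[of _ 1])
    ultimately show "(\<Sum>n\<in>G. exp (jbracket n powr (1/4)) * (cmod (u n))\<^sup>2) \<le> C * (\<Sum>n\<in>B. (cmod (u n))\<^sup>2)"
      unfolding S_def by (rule tendsto_upperbound) simp
  qed
  show ?thesis using d B main by blast
qed

section \<open>Energies near the top of the spectrum\<close>

definition stagger :: "int ^ 'd \<Rightarrow> complex" where
  "stagger n = (if even (\<Sum>i\<in>UNIV. n $ i) then 1 else - 1)"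

lemma stagger_unit: "stagger (n - unit i) = - stagger n" "stagger (n + unit i) = - stagger n"
proof -
  have "(\<Sum>j\<in>UNIV. (n - unit i) $ j) = (\<Sum>j\<in>UNIV. n $ j) - 1"
    "(\<Sum>j\<in>UNIV. (n + unit i) $ j) = (\<Sum>j\<in>UNIV. n $ j) + 1"
    by (simp_all add: sum_subtractf sum.distrib axis_def)
  then show "stagger (n - unit i) = - stagger n" "stagger (n + unit i) = - stagger n"
    unfolding stagger_def by simp_all
qed

lemma cmod_stagger: "cmod (stagger n * z) = cmod z"
  by (simp add: stagger_def)

lemma stagger_eigenspace:
  fixes u :: "int ^ 'd::finite \<Rightarrow> complex"
  assumes "u \<in> eigenspace (hamiltonian V w k) \<nu>"
  shows "(\<lambda>n. stagger n * u n) \<in> eigenspace (hamiltonian (\<lambda>n. - V n) (- w) k) (4 * real CARD('d) - \<nu>)"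
proof -
  have eig: "hamiltonian V w k u n = of_real \<nu> * u n" for n
    using assms by (simp add: eigenspace_def cscale_def)
  have "hamiltonian (\<lambda>n. - V n) (- w) k (\<lambda>n. stagger n * u n) n
      = of_real (4 * real CARD('d) - \<nu>) * (stagger n * u n)" for n
  proof -
    have "hamiltonian (\<lambda>n. - V n) (- w) k (\<lambda>n. stagger n * u n) n
        = stagger n * (of_real (4 * real CARD('d)) * u n - hamiltonian V w k u n)"
      by (simp add: hamiltonian_def laplacian_def shift_def shift_adj_def mult_op_def wvn_eq
          stagger_unit sum.distrib sum_subtractf sum_distrib_left sum_negf algebra_simps)
    then show ?thesis by (simp add: eig algebra_simps)
  qed
  moreover have "(\<lambda>n. stagger n * u n) \<in> ell2"
    using assms by (simp add: eigenspace_def ell2_def cmod_stagger)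
  ultimately show ?thesis by (simp add: eigenspace_def cscale_def fun_eq_iff)
qed

definition below_resonance :: "nat \<Rightarrow> real \<Rightarrow> real \<Rightarrow> bool" where
  "below_resonance d k E \<longleftrightarrow> 0 < E \<and> E < 4 \<and> E < 2 * real d * (1 - \<bar>cos (k/2)\<bar>)"

lemma eigenfunction_estimate:
  fixes V :: "int ^ 'd::finite \<Rightarrow> real" and w k E :: real
  assumes V: "(V \<longlongrightarrow> 0) at_inf_lattice"
    and dV: "\<And>i. ((\<lambda>n. of_int (n $ i) * (V n - V (n - unit i))) \<longlongrightarrow> 0) at_inf_lattice"
    and E: "below_resonance CARD('d) k E \<or> below_resonance CARD('d) k (4 * real CARD('d) - E)"
  shows "\<exists>\<delta>>0. \<exists>C B. finite B \<and>
    (\<forall>\<nu> u. \<bar>\<nu> - E\<bar> < \<delta> \<longrightarrow> u \<in> eigenspace (hamiltonian V w k) \<nu> \<longrightarrow> concentrated C B u)"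
  using E
proof
  assume "below_resonance CARD('d) k E"
  then show ?thesis
    unfolding below_resonance_def by (intro low_energy_estimate V dV) auto
next
  assume E': "below_resonance CARD('d) k (4 * real CARD('d) - E)"
  have V': "((\<lambda>n. - V n) \<longlongrightarrow> 0) at_inf_lattice"
    using tendsto_minus[OF V] by simp
  have dV': "((\<lambda>n. of_int (n $ i) * (- V n - - V (n - unit i))) \<longlongrightarrow> 0) at_inf_lattice" for i
    using tendsto_minus[OF dV[of i]] by (simp add: algebra_simps)
  obtain \<delta> C B where *: "\<delta> > 0" "finite B"
    "\<And>\<nu> u. \<bar>\<nu> - (4 * real CARD('d) - E)\<bar> < \<delta> \<Longrightarrow>
      u \<in> eigenspace (hamiltonian (\<lambda>n. - V n) (- w) k) \<nu> \<Longrightarrow> concentrated C B u"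
    using low_energy_estimate[OF V' dV', of "4 * real CARD('d) - E" k "- w"] E'
    unfolding below_resonance_def by blast
  have "concentrated C B u" if "\<bar>\<nu> - E\<bar> < \<delta>" "u \<in> eigenspace (hamiltonian V w k) \<nu>" for \<nu> u
    using *(3)[OF _ stagger_eigenspace[OF that(2)]] that(1)
    by (simp add: concentrated_def cmod_stagger abs_minus_commute)
  then show ?thesis using * by blast
qed

section \<open>Orthogonality and counting of eigenfunctions\<close>

lemma ell2_has_sum_inner:
  assumes "u \<in> ell2" "v \<in> ell2"
  obtains s where "((\<lambda>n. u n * cnj (v n)) has_sum s) UNIV"
proof -
  have "(\<lambda>n. (cmod (u n))\<^sup>2 + (cmod (v n))\<^sup>2) summable_on UNIV"
    using assms by (intro summable_on_add) (auto simp: ell2_def)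
  then have "(\<lambda>n. norm (u n * cnj (v n))) summable_on UNIV"
  proof (rule Infinite_Sum.abs_summable_on_comparison_test')
    fix n
    have "0 \<le> (cmod (u n) - cmod (v n))\<^sup>2" "0 \<le> cmod (u n) * cmod (v n)" by simp_all
    then show "norm (u n * cnj (v n)) \<le> (cmod (u n))\<^sup>2 + (cmod (v n))\<^sup>2"
      unfolding norm_mult complex_mod_cnj power2_diff by linarith
  qed
  then have "(\<lambda>n. u n * cnj (v n)) summable_on UNIV" by (rule abs_summable_summable)
  then show thesis using that by (auto simp: summable_on_def)
qed

lemma ell2_shift: "u \<in> ell2 \<Longrightarrow> (\<lambda>n. u (n + s)) \<in> ell2"
  unfolding ell2_def mem_Collect_eq
  by (subst summable_on_reindex_bij_betw[of "\<lambda>n. n + s" UNIV UNIV "\<lambda>n. (cmod (u n))\<^sup>2"])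
     (auto intro!: bij_betwI[of _ _ _ "\<lambda>n. n - s"])

lemma has_sum_shift:
  "((\<lambda>n. f (n + s)) has_sum a) UNIV \<longleftrightarrow> (f has_sum a) UNIV" for s :: "int ^ 'd"
  by (rule has_sum_reindex_bij_betw) (auto intro!: bij_betwI[of _ _ _ "\<lambda>n. n - s"])

lemma has_sum_sum:
  fixes f :: "'i \<Rightarrow> 'a \<Rightarrow> complex"
  assumes "finite I" "\<And>i. i \<in> I \<Longrightarrow> (f i has_sum s i) A"
  shows "((\<lambda>x. \<Sum>i\<in>I. f i x) has_sum (\<Sum>i\<in>I. s i)) A"
  using assms by (induction I rule: finite_induct) (auto intro: has_sum_add)

text \<open>Symmetry of the operator. The potentials are real and cancel pointwise; the hopping terms cancel
  after a translation of the summation variable.\<close>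

lemma eigenfunctions_orthogonal:
  fixes u v :: "int ^ 'd::finite \<Rightarrow> complex"
  assumes u: "u \<in> eigenspace (hamiltonian V w k) \<nu>" and v: "v \<in> eigenspace (hamiltonian V w k) \<nu>'"
    and "\<nu> \<noteq> \<nu>'"
  shows "((\<lambda>n. u n * cnj (v n)) has_sum 0) UNIV"
proof -
  have u2: "u \<in> ell2" and v2: "v \<in> ell2" using u v by (auto simp: eigenspace_def)
  obtain s where s: "((\<lambda>n. u n * cnj (v n)) has_sum s) UNIV" by (rule ell2_has_sum_inner[OF u2 v2])
  define t where "t = (\<lambda>i n. u n * cnj (v (n - unit i)) + u n * cnj (v (n + unit i))
      - u (n - unit i) * cnj (v n) - u (n + unit i) * cnj (v n))"
  have t: "(t i has_sum 0) UNIV" for i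
  proof -
    obtain a where a: "((\<lambda>n. u n * cnj (v (n + - unit i))) has_sum a) UNIV"
      by (rule ell2_has_sum_inner[OF u2 ell2_shift[OF v2]])
    obtain b where b: "((\<lambda>n. u n * cnj (v (n + unit i))) has_sum b) UNIV"
      by (rule ell2_has_sum_inner[OF u2 ell2_shift[OF v2]])
    have a': "((\<lambda>n. - (u (n + unit i) * cnj (v n))) has_sum - a) UNIV"
      using has_sum_shift[of "\<lambda>n. u n * cnj (v (n + - unit i))" "unit i" a] a
      by (intro has_sum_uminusI) simp
    have b': "((\<lambda>n. - (u (n + - unit i) * cnj (v n))) has_sum - b) UNIV"
      using has_sum_shift[of "\<lambda>n. u n * cnj (v (n + unit i))" "- unit i" b] b
      by (intro has_sum_uminusI) simp
    show ?thesis
      using has_sum_add[OF has_sum_add[OF a b] has_sum_add[OF b' a']] by (simp add: t_def algebra_simps)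
  qed
  have "of_real (\<nu> - \<nu>') * (u n * cnj (v n)) = (\<Sum>i\<in>UNIV. t i n)" for n
  proof -
    have hu: "hamiltonian V w k u n = of_real \<nu> * u n" and hv: "hamiltonian V w k v n = of_real \<nu>' * v n"
      using u v by (simp_all add: eigenspace_def cscale_def)
    have "of_real (\<nu> - \<nu>') * (u n * cnj (v n))
        = hamiltonian V w k u n * cnj (v n) - u n * cnj (hamiltonian V w k v n)"
      unfolding hu hv by (simp add: algebra_simps)
    also have "\<dots> = laplacian u n * cnj (v n) - u n * cnj (laplacian v n)"
      by (simp add: hamiltonian_def mult_op_def algebra_simps)
    also have "\<dots> = (\<Sum>i\<in>UNIV. t i n)"
      unfolding laplacian_def cnj_sum sum_distrib_left sum_distrib_right sum_subtractf[symmetric]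
      by (intro sum.cong) (simp_all add: t_def shift_def shift_adj_def algebra_simps)
    finally show ?thesis .
  qed
  moreover have "((\<lambda>n. \<Sum>i\<in>UNIV. t i n) has_sum (\<Sum>i\<in>(UNIV :: 'd set). 0)) UNIV"
    by (rule has_sum_sum) (auto simp: t)
  ultimately have "((\<lambda>n. of_real (\<nu> - \<nu>') * (u n * cnj (v n))) has_sum 0) UNIV" by simp
  moreover have "((\<lambda>n. of_real (\<nu> - \<nu>') * (u n * cnj (v n))) has_sum of_real (\<nu> - \<nu>') * s) UNIV"
    by (rule has_sum_cmult_right[OF s])
  ultimately have "of_real (\<nu> - \<nu>') * s = 0" by (rule has_sum_unique[rotated])
  then have "s = 0" using assms(3) by simp
  then show ?thesis using s by simp
qed

lemma of_real_cmod_square: "(complex_of_real (cmod z))\<^sup>2 = z * cnj z"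
  using complex_norm_square[of z] by simp

text \<open>Let \<open>\<tau>\<close> be the sum in question and \<open>\<phi>\<close> the projection of the point mass at \<open>n0\<close>. Then \<open>\<phi> n0 = \<tau>\<close> and
  \<open>\<parallel>\<phi>\<parallel>\<^sup>2 = \<tau>\<close>, so \<open>\<tau>\<^sup>2 \<le> \<tau>\<close>.\<close>

lemma bessel:
  fixes \<psi> :: "'j \<Rightarrow> int ^ 'd::finite \<Rightarrow> complex"
  assumes J: "finite J"
    and on: "\<And>i j. i \<in> J \<Longrightarrow> j \<in> J \<Longrightarrow> ((\<lambda>n. \<psi> i n * cnj (\<psi> j n)) has_sum (if i = j then 1 else 0)) UNIV"
  shows "(\<Sum>j\<in>J. (cmod (\<psi> j n0))\<^sup>2) \<le> 1"
proof -
  define \<tau> where "\<tau> = (\<Sum>j\<in>J. (cmod (\<psi> j n0))\<^sup>2)"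
  define \<phi> where "\<phi> n = (\<Sum>j\<in>J. cnj (\<psi> j n0) * \<psi> j n)" for n
  have "\<phi> n0 = of_real \<tau>"
    by (simp add: \<phi>_def \<tau>_def of_real_cmod_square mult.commute)
  have "((\<lambda>n. \<Sum>i\<in>J. \<Sum>j\<in>J. (cnj (\<psi> i n0) * \<psi> j n0) * (\<psi> i n * cnj (\<psi> j n))) has_sum
      (\<Sum>i\<in>J. \<Sum>j\<in>J. (cnj (\<psi> i n0) * \<psi> j n0) * (if i = j then 1 else 0))) UNIV"
    by (intro has_sum_sum J has_sum_cmult_right on)
  moreover have "(\<Sum>i\<in>J. \<Sum>j\<in>J. (cnj (\<psi> i n0) * \<psi> j n0) * (if i = j then 1 else 0)) = of_real \<tau>"
  proof -
    have "(\<Sum>j\<in>J. (cnj (\<psi> i n0) * \<psi> j n0) * (if i = j then 1 else 0))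
        = (\<Sum>j\<in>J. if i = j then cnj (\<psi> i n0) * \<psi> j n0 else 0)" for i
      by (intro sum.cong) auto
    then show ?thesis using J by (simp add: \<tau>_def of_real_cmod_square mult.commute)
  qed
  moreover have "(\<Sum>i\<in>J. \<Sum>j\<in>J. (cnj (\<psi> i n0) * \<psi> j n0) * (\<psi> i n * cnj (\<psi> j n))) = of_real ((cmod (\<phi> n))\<^sup>2)" for n
    unfolding of_real_power of_real_cmod_square \<phi>_def cnj_sum sum_product
    by (intro sum.cong) (simp_all add: mult_ac)
  ultimately have "((\<lambda>n. of_real ((cmod (\<phi> n))\<^sup>2)) has_sum complex_of_real \<tau>) UNIV" by simp
  from has_sum_Re[OF this] have "((\<lambda>n. (cmod (\<phi> n))\<^sup>2) has_sum \<tau>) UNIV" by simp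
  then have "(\<Sum>n\<in>{n0}. (cmod (\<phi> n))\<^sup>2) \<le> \<tau>"
    by (rule finite_sum_le_has_sum) auto
  then have "\<tau> * \<tau> \<le> \<tau>" using \<open>\<phi> n0 = of_real \<tau>\<close> by (simp add: power2_eq_square)
  moreover have "0 \<le> \<tau>" by (simp add: \<tau>_def sum_nonneg)
  ultimately show ?thesis unfolding \<tau>_def[symmetric] by (cases "\<tau> = 0") (auto simp: mult_le_cancel_right1)
qed

text \<open>Functions determined by their values on a finite set: removing one point at a time costs at most one
  dimension.\<close>

lemma finite_dimensional_if_determined:
  fixes U :: "('n \<Rightarrow> complex) set"
  assumes "finite B"
    and "\<And>\<psi> \<phi> c. \<psi> \<in> U \<Longrightarrow> \<phi> \<in> U \<Longrightarrow> \<psi> - cscale c \<phi> \<in> U"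
    and "\<And>\<psi>. \<psi> \<in> U \<Longrightarrow> (\<forall>n\<in>B. \<psi> n = 0) \<Longrightarrow> \<psi> = 0"
  shows "finite_dimensional U"
  using assms
proof (induction B arbitrary: U rule: finite_induct)
  case empty
  have "\<psi> = 0" if "\<psi> \<in> U" for \<psi> using empty(2)[OF that] by blast
  then have "U \<subseteq> cfun.span {}" by (auto simp only: cfun.span_empty)
  then show ?case unfolding finite_dimensional_def by blast
next
  case (insert b B)
  define U0 where "U0 = {\<psi> \<in> U. \<psi> b = 0}"
  have "finite_dimensional U0"
  proof (rule insert.IH)
    show "\<psi> - cscale c \<phi> \<in> U0" if "\<psi> \<in> U0" "\<phi> \<in> U0" for \<psi> \<phi> c
    proof -
      have "\<psi> - cscale c \<phi> \<in> U" by (rule insert.prems(1)) (use that in \<open>auto simp: U0_def\<close>)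
      moreover have "(\<psi> - cscale c \<phi>) b = 0" using that by (simp add: U0_def cscale_def)
      ultimately show ?thesis unfolding U0_def by blast
    qed
    show "\<psi> = 0" if "\<psi> \<in> U0" "\<forall>n\<in>B. \<psi> n = 0" for \<psi>
      by (rule insert.prems(2)) (use that in \<open>auto simp: U0_def\<close>)
  qed
  then obtain S where S: "finite S" "U0 \<subseteq> cfun.span S" unfolding finite_dimensional_def by blast
  show ?case
  proof (cases "\<exists>\<phi>\<in>U. \<phi> b \<noteq> 0")
    case True
    then obtain \<phi> where \<phi>: "\<phi> \<in> U" "\<phi> b \<noteq> 0" by blast
    have "\<psi> \<in> cfun.span (insert \<phi> S)" if "\<psi> \<in> U" for \<psi>
    proof -
      have "\<psi> - cscale (\<psi> b / \<phi> b) \<phi> \<in> U" by (rule insert.prems(1)[OF that \<phi>(1)])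
      moreover have "(\<psi> - cscale (\<psi> b / \<phi> b) \<phi>) b = 0" using \<phi>(2) by (simp add: cscale_def)
      ultimately have "\<psi> - cscale (\<psi> b / \<phi> b) \<phi> \<in> U0" unfolding U0_def by blast
      then show ?thesis using S(2) by (auto simp: cfun.span_insert)
    qed
    then show ?thesis unfolding finite_dimensional_def using S(1) by (intro exI[of _ "insert \<phi> S"]) auto
  next
    case False
    then have "U = U0" by (auto simp: U0_def)
    then show ?thesis using \<open>finite_dimensional U0\<close> by simp
  qed
qed

lemma eigenspace_combination:
  assumes "\<psi> \<in> eigenspace (hamiltonian V w k) \<nu>" "\<phi> \<in> eigenspace (hamiltonian V w k) \<nu>"
  shows "\<psi> - cscale c \<phi> \<in> eigenspace (hamiltonian V w k) \<nu>"
proof -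
  have "(\<lambda>n. 2 * (cmod (\<psi> n))\<^sup>2 + 2 * (cmod c)\<^sup>2 * (cmod (\<phi> n))\<^sup>2) summable_on UNIV"
    using assms by (intro summable_on_add summable_on_cmult_right) (auto simp: eigenspace_def ell2_def)
  then have "(\<lambda>n. norm ((cmod ((\<psi> - cscale c \<phi>) n))\<^sup>2)) summable_on UNIV"
  proof (rule Infinite_Sum.abs_summable_on_comparison_test')
    fix n
    have "(cmod (\<psi> n - c * \<phi> n))\<^sup>2 \<le> (cmod (\<psi> n) + cmod (c * \<phi> n))\<^sup>2"
      by (intro power_mono norm_triangle_ineq4) simp
    also have "\<dots> \<le> 2 * (cmod (\<psi> n))\<^sup>2 + 2 * (cmod (c * \<phi> n))\<^sup>2"
      using zero_le_power2[of "cmod (\<psi> n) - cmod (c * \<phi> n)"] by (simp add: power2_diff power2_sum)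
    finally show "norm ((cmod ((\<psi> - cscale c \<phi>) n))\<^sup>2) \<le> 2 * (cmod (\<psi> n))\<^sup>2 + 2 * (cmod c)\<^sup>2 * (cmod (\<phi> n))\<^sup>2"
      by (simp add: cscale_def norm_mult power_mult_distrib)
  qed
  then have "\<psi> - cscale c \<phi> \<in> ell2" by (simp add: ell2_def)
  moreover have "hamiltonian V w k (\<psi> - cscale c \<phi>) = hamiltonian V w k \<psi> - cscale c (hamiltonian V w k \<phi>)"
    by (rule ext) (simp add: hamiltonian_def laplacian_def shift_def shift_adj_def mult_op_def cscale_def
        sum_subtractf sum.distrib sum_distrib_left algebra_simps)
  ultimately show ?thesis
    using assms by (simp add: eigenspace_def cscale_def fun_eq_iff algebra_simps)
qed

lemma concentrated_eigenfunctions: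
  fixes V :: "int ^ 'd::finite \<Rightarrow> real"
  assumes B: "finite B"
    and conc: "\<And>\<nu> u. \<nu> \<in> I \<Longrightarrow> u \<in> eigenspace (hamiltonian V w k) \<nu> \<Longrightarrow> concentrated C B u"
  shows "finitely_many_eigenvalues_in (hamiltonian V w k) I"
    and "\<nu> \<in> I \<Longrightarrow> u \<in> eigenspace (hamiltonian V w k) \<nu> \<Longrightarrow> decays_subexponentially u"
proof -
  let ?H = "hamiltonian V w k"
  have tight: "(\<Sum>n\<in>G. exp (jbracket n powr (1/4)) * (cmod (u n))\<^sup>2) \<le> C * (\<Sum>n\<in>B. (cmod (u n))\<^sup>2)"
    if "\<nu> \<in> I" "u \<in> eigenspace ?H \<nu>" "finite G" for \<nu> u G
    using conc[OF that(1,2)] that(3) by (simp add: concentrated_def)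
  have tight1: "(\<Sum>n\<in>G. (cmod (u n))\<^sup>2) \<le> C * (\<Sum>n\<in>B. (cmod (u n))\<^sup>2)"
    if "\<nu> \<in> I" "u \<in> eigenspace ?H \<nu>" "finite G" for \<nu> u G
  proof -
    have "(\<Sum>n\<in>G. (cmod (u n))\<^sup>2) \<le> (\<Sum>n\<in>G. exp (jbracket n powr (1/4)) * (cmod (u n))\<^sup>2)"
      by (intro sum_mono) (simp add: mult_le_cancel_right1)
    then show ?thesis using tight[OF that] by linarith
  qed
  have determined: "u = 0" if "\<nu> \<in> I" "u \<in> eigenspace ?H \<nu>" "\<forall>n\<in>B. u n = 0" for \<nu> u
  proof
    fix n
    have "(\<Sum>n\<in>{n}. (cmod (u n))\<^sup>2) \<le> 0"
      using tight1[OF that(1,2), of "{n}"] that(3) by simp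
    then show "u n = 0 n" by simp
  qed
  have fd: "finite_dimensional (eigenspace ?H \<nu>)" if "\<nu> \<in> I" for \<nu>
    by (rule finite_dimensional_if_determined[OF B eigenspace_combination determined[OF that]])
  have count: "card J \<le> nat \<lceil>C * card B\<rceil>" if J: "J \<subseteq> point_spectrum ?H \<inter> I" "finite J" for J
  proof -
    have "\<forall>\<nu>\<in>J. \<exists>\<psi>. \<psi> \<in> eigenspace ?H \<nu> \<and> ((\<lambda>n. \<psi> n * cnj (\<psi> n)) has_sum 1) UNIV"
    proof
      fix \<nu> assume "\<nu> \<in> J"
      then obtain u where u: "u \<in> eigenspace ?H \<nu>" "u \<noteq> 0"
        using J(1) by (auto simp: point_spectrum_def)
      have summ: "(\<lambda>n. (cmod (u n))\<^sup>2) summable_on UNIV" using u(1) by (simp add: eigenspace_def ell2_def)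
      define s where "s = infsum (\<lambda>n. (cmod (u n))\<^sup>2) UNIV"
      have s: "((\<lambda>n. (cmod (u n))\<^sup>2) has_sum s) UNIV" using summ by (simp add: s_def)
      obtain n where "u n \<noteq> 0" using u(2) by (auto simp: fun_eq_iff)
      moreover have "(\<Sum>n\<in>{n}. (cmod (u n))\<^sup>2) \<le> s" by (rule finite_sum_le_has_sum[OF s]) auto
      ultimately have s0: "0 < s" by (simp add: less_le_trans[of 0 "(cmod (u n))\<^sup>2"])
      have "0 - cscale (- 1 / sqrt s) u \<in> eigenspace ?H \<nu>"
      proof (rule eigenspace_combination[OF _ u(1)])
        show "0 \<in> eigenspace ?H \<nu>"
          using eigenspace_combination[OF u(1) u(1), of 1] by (simp add: cscale_def fun_diff_def zero_fun_def)
      qed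
      moreover have "((\<lambda>n. (1 / s) * (cmod (u n))\<^sup>2) has_sum (1 / s * s)) UNIV"
        by (rule has_sum_cmult_right[OF s])
      then have "((\<lambda>n. complex_of_real ((1 / s) * (cmod (u n))\<^sup>2)) has_sum of_real (1 / s * s)) UNIV"
        by (rule has_sum_of_real)
      moreover have "complex_of_real ((1 / s) * (cmod (u n))\<^sup>2)
          = (0 - cscale (- 1 / sqrt s) u) n * cnj ((0 - cscale (- 1 / sqrt s) u) n)" for n
      proof -
        have "complex_of_real (sqrt s) * complex_of_real (sqrt s) = of_real s"
          using s0 by (simp flip: of_real_mult)
        then show ?thesis
          unfolding of_real_mult of_real_power of_real_cmod_square by (simp add: cscale_def divide_simps)
      qed
      ultimately show "\<exists>\<psi>. \<psi> \<in> eigenspace ?H \<nu> \<and> ((\<lambda>n. \<psi> n * cnj (\<psi> n)) has_sum 1) UNIV"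
        using s0 by (intro exI[of _ "0 - cscale (- 1 / sqrt s) u"]) simp
    qed
    then obtain \<psi> where \<psi>: "\<And>\<nu>. \<nu> \<in> J \<Longrightarrow> \<psi> \<nu> \<in> eigenspace ?H \<nu>"
      "\<And>\<nu>. \<nu> \<in> J \<Longrightarrow> ((\<lambda>n. \<psi> \<nu> n * cnj (\<psi> \<nu> n)) has_sum 1) UNIV" by metis
    have bes: "(\<Sum>\<nu>\<in>J. (cmod (\<psi> \<nu> n))\<^sup>2) \<le> 1" for n
    proof (rule bessel[OF J(2)])
      show "((\<lambda>n. \<psi> i n * cnj (\<psi> j n)) has_sum (if i = j then 1 else 0)) UNIV" if "i \<in> J" "j \<in> J" for i j
        using \<psi>(2)[OF that(1)] eigenfunctions_orthogonal[OF \<psi>(1)[OF that(1)] \<psi>(1)[OF that(2)]]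
        by (cases "i = j") simp_all
    qed
    have low: "1 \<le> C * (\<Sum>n\<in>B. (cmod (\<psi> \<nu> n))\<^sup>2)" if "\<nu> \<in> J" for \<nu>
    proof -
      have "((\<lambda>n. (cmod (\<psi> \<nu> n))\<^sup>2) has_sum 1) UNIV"
        using has_sum_Re[OF \<psi>(2)[OF that]] by (simp add: complex_mult_cnj cmod_power2)
      then show ?thesis
        by (rule has_sum_le_finite_sums) (use that J(1) \<psi>(1) in \<open>auto intro!: tight1\<close>)
    qed
    show ?thesis
    proof (cases "J = {}")
      case False
      then obtain \<nu> where "\<nu> \<in> J" by blast
      have "0 < C"
      proof (rule ccontr)
        assume "\<not> 0 < C"
        then have "C * (\<Sum>n\<in>B. (cmod (\<psi> \<nu> n))\<^sup>2) \<le> 0" by (intro mult_nonpos_nonneg sum_nonneg) auto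
        then show False using low[OF \<open>\<nu> \<in> J\<close>] by linarith
      qed
      have "real (card J) = (\<Sum>\<nu>\<in>J. 1)" by simp
      also have "\<dots> \<le> (\<Sum>\<nu>\<in>J. C * (\<Sum>n\<in>B. (cmod (\<psi> \<nu> n))\<^sup>2))" by (intro sum_mono low)
      also have "\<dots> = C * (\<Sum>n\<in>B. \<Sum>\<nu>\<in>J. (cmod (\<psi> \<nu> n))\<^sup>2)"
        by (subst sum.swap) (simp add: sum_distrib_left)
      also have "\<dots> \<le> C * (\<Sum>n\<in>B. 1)" using \<open>0 < C\<close> by (intro mult_left_mono sum_mono bes) auto
      finally have "real (card J) \<le> C * card B" by simp
      then show ?thesis by linarith
    qed simp
  qed
  have "finite (point_spectrum ?H \<inter> I)"
    using finite_if_finite_subsets_card_bdd[OF count] by blast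
  then show "finitely_many_eigenvalues_in ?H I"
    unfolding finitely_many_eigenvalues_in_def using fd by blast
  show "decays_subexponentially u" if "\<nu> \<in> I" "u \<in> eigenspace ?H \<nu>"
  proof -
    have "(\<lambda>n. exp (2 * (1/2) * jbracket n powr (1/4)) * (cmod (u n))\<^sup>2) summable_on UNIV"
    proof (rule nonneg_bounded_partial_sums_imp_summable_on)
      show "\<forall>\<^sub>F G in finite_subsets_at_top UNIV.
          (\<Sum>n\<in>G. exp (2 * (1/2) * jbracket n powr (1/4)) * (cmod (u n))\<^sup>2) \<le> C * (\<Sum>n\<in>B. (cmod (u n))\<^sup>2)"
        using tight[OF that] by (intro eventually_finite_subsets_at_top_weakI) simp
    qed simp
    then show ?thesis
      unfolding decays_subexponentially_def by (intro exI[of _ "1/2"] conjI bexI[of _ "1/4"]) auto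
  qed
qed

section \<open>Recurrences on the half-line\<close>

text \<open>One step of summation by parts. If \<open>z\<close> rotates by \<open>2 \<theta>\<close> and the phase by \<open>\<kappa>\<close>, the product rotates by
  \<open>2 \<theta> + \<kappa>\<close>; dividing by \<open>1 - exp (- i (2 \<theta> + \<kappa>))\<close> writes it as a difference of consecutive terms.\<close>

lemma oscillation_corrector:
  fixes z z' err :: complex and \<phi> \<alpha> \<alpha>' :: real
  assumes "z' = cis (2 * \<theta>) * z + err" and "\<alpha>' = \<alpha> + \<kappa>" and "cis (2 * \<theta> + \<kappa>) \<noteq> 1"
  defines "\<Phi> \<equiv> 1 - cis (- (2 * \<theta> + \<kappa>))"
  shows "\<bar>Re (cis \<alpha>' * z') - (Re (cis \<alpha>' * z' / \<Phi>) - Re (cis \<alpha> * z / \<Phi>))\<bar> \<le> cmod err / cmod \<Phi>"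
proof -
  have \<Phi>: "\<Phi> \<noteq> 0"
  proof
    assume "\<Phi> = 0"
    then have "cis (2 * \<theta> + \<kappa>) * cis (- (2 * \<theta> + \<kappa>)) = cis (2 * \<theta> + \<kappa>)" by (simp add: \<Phi>_def)
    then show False using assms(3) by (simp add: cis_mult)
  qed
  have "cis \<alpha>' * z' = cis (2 * \<theta> + \<kappa>) * (cis \<alpha> * z) + cis \<alpha>' * err"
    unfolding assms(1,2) by (simp add: algebra_simps cis_mult flip: mult.assoc)
  then have "cis (- (2 * \<theta> + \<kappa>)) * (cis \<alpha>' * z') = cis \<alpha> * z + cis (- (2 * \<theta> + \<kappa>)) * (cis \<alpha>' * err)"
    by (simp add: distrib_left cis_mult flip: mult.assoc)
  then have "\<Phi> * (cis \<alpha>' * z') = cis \<alpha>' * z' - cis \<alpha> * z - cis (- (2 * \<theta> + \<kappa>)) * (cis \<alpha>' * err)"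
    by (simp add: \<Phi>_def left_diff_distrib)
  then have "cis \<alpha>' * z' = (cis \<alpha>' * z' - cis \<alpha> * z - cis (- (2 * \<theta> + \<kappa>)) * (cis \<alpha>' * err)) / \<Phi>"
    using \<Phi> by (metis nonzero_mult_div_cancel_left)
  then have "cis \<alpha>' * z' = cis \<alpha>' * z' / \<Phi> - cis \<alpha> * z / \<Phi> - cis (- (2 * \<theta> + \<kappa>)) * (cis \<alpha>' * err) / \<Phi>"
    by (simp only: diff_divide_distrib)
  from arg_cong[OF this, of Re]
  have "Re (cis \<alpha>' * z') - (Re (cis \<alpha>' * z' / \<Phi>) - Re (cis \<alpha> * z / \<Phi>))
      = - Re (cis (- (2 * \<theta> + \<kappa>)) * (cis \<alpha>' * err) / \<Phi>)"
    by (simp only: minus_complex.sel)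
  also have "\<bar>\<dots>\<bar> \<le> cmod (cis (- (2 * \<theta> + \<kappa>)) * (cis \<alpha>' * err) / \<Phi>)"
    using abs_Re_le_cmod by (simp only: abs_minus_cancel)
  also have "\<dots> = cmod err / cmod \<Phi>" by (simp add: norm_mult norm_divide)
  finally show ?thesis .
qed

text \<open>
  Solutions of the eigenvalue equation on the half-line at energy \<open>2 - 2 cos \<theta>\<close>. The form \<open>G\<close> contains
  \<open>V n\<close>, so that \<open>V\<close> enters its increments only through differences. The complex quantity \<open>\<zeta>\<close> is
  multiplied by \<open>exp (i \<theta>)\<close> in each step of the free equation; \<open>c / n\<close> is the correction that removes the
  oscillating part of the increments of \<open>G\<close>, and \<open>s\<close> collects all quantities that tend to zero.
\<close>

locale halfline =
  fixes u V :: "nat \<Rightarrow> real" and w k \<theta> :: real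
  assumes sin_pos: "0 < sin \<theta>"
    and nonres: "cis (2 * \<theta> + k) \<noteq> 1" "cis (2 * \<theta> - k) \<noteq> 1"
    and rec: "\<And>n. u (n + 2) = (2 * cos \<theta> + (V (n + 1) + w * sin (k * real (n + 1)) / real (n + 1))) * u (n + 1) - u n"
    and V: "V \<longlonglongrightarrow> 0" and dV: "(\<lambda>n. real (n + 1) * (V (n + 1) - V n)) \<longlonglongrightarrow> 0"
begin

definition W where "W n = w * sin (k * real n) / real n"
definition q where "q n = V n + W n"
definition s where "s n = \<bar>q (n + 1)\<bar> + \<bar>real (n + 1) * (V (n + 1) - V n)\<bar> + 1 / real (n + 1)"
definition A where "A n = (u n)\<^sup>2 + (u (n + 1))\<^sup>2"
definition \<zeta> where "\<zeta> n = complex_of_real (u (n + 1)) - cis (- \<theta>) * of_real (u n)"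
definition \<Phi> where "\<Phi> \<kappa> = 1 - cis (- (2 * \<theta> + \<kappa>))"
definition X where "X \<kappa> n = Re (cis (\<kappa> * real n) * (\<zeta> n)\<^sup>2 / \<Phi> \<kappa>)"
definition c where "c n = w / (2 * sin \<theta>) * (X (- k) n - X k n)"
definition G where "G n = (u (n + 1))\<^sup>2 + (u n)\<^sup>2 - (2 * cos \<theta> + V n) * u n * u (n + 1)"
definition T where "T n = G n - c n / real n"
definition C1 where "C1 = \<bar>w\<bar> / (2 * sin \<theta>) * (2 / cmod (\<Phi> (- k)) + 2 / cmod (\<Phi> k))"

lemma s_tendsto_0: "s \<longlonglongrightarrow> 0"
proof -
  have W: "W \<longlonglongrightarrow> 0"
  proof (rule Lim_null_comparison)
    show "(\<lambda>n. \<bar>w\<bar> / real n) \<longlonglongrightarrow> 0" by (rule lim_const_over_n)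
    show "\<forall>\<^sub>F n in sequentially. norm (W n) \<le> \<bar>w\<bar> / real n"
      by (intro always_eventually allI) (auto simp: W_def abs_mult intro!: divide_right_mono mult_left_le)
  qed
  have "q \<longlonglongrightarrow> 0 + 0" unfolding q_def by (intro tendsto_add V W)
  then have "(\<lambda>n. q (n + 1)) \<longlonglongrightarrow> 0" using LIMSEQ_ignore_initial_segment[of q 0 1] by simp
  moreover have "(\<lambda>n. 1 / real (n + 1)) \<longlonglongrightarrow> 0"
    using LIMSEQ_ignore_initial_segment[OF lim_const_over_n[of 1], of 1] by simp
  ultimately have "(\<lambda>n. \<bar>q (n + 1)\<bar> + \<bar>real (n + 1) * (V (n + 1) - V n)\<bar> + 1 / real (n + 1)) \<longlonglongrightarrow> \<bar>0\<bar> + \<bar>0\<bar> + 0"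
    by (intro tendsto_add tendsto_rabs dV)
  then show ?thesis by (simp add: s_def[abs_def])
qed

lemma s_bounds: "\<bar>q (n + 1)\<bar> \<le> s n" "\<bar>V (n + 1) - V n\<bar> \<le> s n / real (n + 1)" "1 / real (n + 1) \<le> s n" "0 \<le> s n"
proof -
  show "\<bar>q (n + 1)\<bar> \<le> s n" "1 / real (n + 1) \<le> s n" "0 \<le> s n"
    by (simp_all add: s_def)
  have "real (n + 1) * \<bar>V (n + 1) - V n\<bar> \<le> s n" by (simp add: s_def abs_mult)
  then show "\<bar>V (n + 1) - V n\<bar> \<le> s n / real (n + 1)" by (simp add: field_simps)
qed

lemma A_nonneg: "0 \<le> A n" by (simp add: A_def)

lemma abs_mult_le_A:
  "(u n)\<^sup>2 \<le> A n" "(u (n + 1))\<^sup>2 \<le> A n" "\<bar>u n * u (n + 1)\<bar> \<le> A n / 2"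
proof -
  have "0 \<le> (\<bar>u n\<bar> - \<bar>u (n + 1)\<bar>)\<^sup>2" by simp
  then show "\<bar>u n * u (n + 1)\<bar> \<le> A n / 2"
    by (simp add: A_def power2_diff abs_mult)
qed (simp_all add: A_def)

lemma rec': "u n = (2 * cos \<theta> + q (n + 1)) * u (n + 1) - u (n + 2)"
  using rec[of n] by (simp add: q_def W_def)

text \<open>One step back in the recurrence: the coefficient \<open>2 cos \<theta> + q\<close> is at most 3 in absolute value, and \<open>19 = 2 * 3\<^sup>2 + 1\<close>.\<close>

lemma A_back: "s n \<le> 1 \<Longrightarrow> A n \<le> 19 * A (n + 1)"
proof -
  assume "s n \<le> 1"
  then have "\<bar>2 * cos \<theta> + q (n + 1)\<bar> \<le> 3"
    using s_bounds(1)[of n] abs_cos_le_one[of \<theta>] by linarith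
  then have "\<bar>u n\<bar> \<le> 3 * \<bar>u (n + 1)\<bar> + \<bar>u (n + 2)\<bar>"
    unfolding rec'[of n] by (intro order_trans[OF abs_triangle_ineq4] add_mono) (auto simp: abs_mult mult_right_mono)
  then have "(u n)\<^sup>2 \<le> (3 * \<bar>u (n + 1)\<bar> + \<bar>u (n + 2)\<bar>)\<^sup>2"
    by (metis abs_le_square_iff abs_of_nonneg abs_ge_zero add_nonneg_nonneg mult_nonneg_nonneg zero_le_numeral)
  also have "\<dots> \<le> 18 * (u (n + 1))\<^sup>2 + 18 * (u (n + 2))\<^sup>2"
  proof -
    have "(3 * \<bar>x\<bar> + \<bar>y\<bar>)\<^sup>2 = 2 * (9 * x\<^sup>2 + y\<^sup>2) - (3 * \<bar>x\<bar> - \<bar>y\<bar>)\<^sup>2" for x y :: real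
      by (simp add: power2_sum power2_diff power_mult_distrib)
    then have "(3 * \<bar>x\<bar> + \<bar>y\<bar>)\<^sup>2 \<le> 2 * (9 * x\<^sup>2 + y\<^sup>2)" for x y :: real by simp
    then show ?thesis
      using zero_le_power2[of "u (n + 2)"] by (smt (verit, best))
  qed
  finally have "(u n)\<^sup>2 + (u (n + 1))\<^sup>2 \<le> 19 * ((u (n + 1))\<^sup>2 + (u (n + 2))\<^sup>2)"
    using zero_le_power2[of "u (n + 2)"] unfolding distrib_left by linarith
  then show ?thesis by (simp add: A_def)
qed

lemma cmod_zeta_le: "cmod (\<zeta> n) \<le> \<bar>u n\<bar> + \<bar>u (n + 1)\<bar>"
  unfolding \<zeta>_def by (rule order_trans[OF norm_triangle_ineq4]) (simp add: norm_mult)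

lemma cmod_zeta_sq_le: "(cmod (\<zeta> n))\<^sup>2 \<le> 2 * A n"
proof -
  have "(cmod (\<zeta> n))\<^sup>2 \<le> (\<bar>u n\<bar> + \<bar>u (n + 1)\<bar>)\<^sup>2"
    by (intro power_mono cmod_zeta_le) simp
  also have "\<dots> \<le> 2 * A n"
    using abs_mult_le_A(3)[of n] by (simp add: power2_sum A_def abs_mult)
  finally show ?thesis .
qed

lemma zeta_step: "\<zeta> (n + 1) = cis \<theta> * \<zeta> n + of_real (q (n + 1) * u (n + 1))"
proof -
  have trig: "cos \<theta> * (cos \<theta> * x) + sin \<theta> * (sin \<theta> * x) = x" for x
    using sin_cos_squared_add3[of \<theta>] by (simp only: mult.assoc[symmetric] distrib_right[symmetric] mult_1)
  show ?thesis
    using rec'[of n] by (simp add: \<zeta>_def complex_eq_iff algebra_simps trig numeral_2_eq_2[symmetric])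
qed

lemma zeta_sq_step:
  assumes "s n \<le> 1"
  shows "\<exists>err. (\<zeta> (n + 1))\<^sup>2 = cis (2 * \<theta>) * (\<zeta> n)\<^sup>2 + err \<and> cmod err \<le> 31 * (s n * A (n + 1))"
proof -
  define err where "err = of_real (q (n + 1) * u (n + 1)) * (\<zeta> (n + 1) + cis \<theta> * \<zeta> n)"
  have "cis (2 * \<theta>) * (\<zeta> n)\<^sup>2 = (cis \<theta> * \<zeta> n)\<^sup>2"
    by (simp add: power_mult_distrib power2_eq_square cis_mult)
  moreover have "of_real (q (n + 1) * u (n + 1)) = \<zeta> (n + 1) - cis \<theta> * \<zeta> n"
    using zeta_step[of n] by simp
  ultimately have "(\<zeta> (n + 1))\<^sup>2 = cis (2 * \<theta>) * (\<zeta> n)\<^sup>2 + err"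
    by (simp only: err_def) (simp add: power2_eq_square algebra_simps)
  moreover have "cmod err \<le> 31 * (s n * A (n + 1))"
  proof -
    have "cmod err \<le> \<bar>q (n + 1)\<bar> * (\<bar>u (n + 1)\<bar> * (cmod (\<zeta> (n + 1)) + cmod (\<zeta> n)))"
      unfolding err_def norm_mult norm_of_real abs_mult mult.assoc
      by (intro mult_left_mono order_trans[OF norm_triangle_ineq]) (simp_all add: norm_mult)
    then have e: "cmod err \<le> \<bar>q (n + 1)\<bar> * (\<bar>u (n + 1)\<bar> * (cmod (\<zeta> (n + 1)) + cmod (\<zeta> n)))" .
    have "\<bar>u (n + 1)\<bar> * (cmod (\<zeta> (n + 1)) + cmod (\<zeta> n)) \<le> 31 * A (n + 1)"
    proof -
      have "\<bar>u (n + 1)\<bar> * (cmod (\<zeta> (n + 1)) + cmod (\<zeta> n))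
          \<le> \<bar>u (n + 1)\<bar> * ((\<bar>u (n + 1)\<bar> + \<bar>u (n + 1 + 1)\<bar>) + (\<bar>u n\<bar> + \<bar>u (n + 1)\<bar>))"
        by (intro mult_left_mono add_mono cmod_zeta_le) simp
      also have "\<dots> = 2 * (u (n + 1))\<^sup>2 + \<bar>u (n + 1) * u (n + 1 + 1)\<bar> + \<bar>u n * u (n + 1)\<bar>"
        by (simp add: abs_mult algebra_simps power2_eq_square)
      also have "\<dots> \<le> 2 * A (n + 1) + A (n + 1) / 2 + A n / 2"
        by (intro add_mono mult_left_mono abs_mult_le_A) simp
      also have "\<dots> \<le> 31 * A (n + 1)" using A_back[OF assms] A_nonneg[of "n + 1"] by linarith
      finally show ?thesis .
    qed
    then have "\<bar>q (n + 1)\<bar> * (\<bar>u (n + 1)\<bar> * (cmod (\<zeta> (n + 1)) + cmod (\<zeta> n))) \<le> s n * (31 * A (n + 1))"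
      by (rule mult_mono[OF s_bounds(1)]) (auto simp: s_bounds(4))
    from order_trans[OF e this] show ?thesis by (simp only: mult_ac)
  qed
  ultimately show ?thesis by blast
qed

lemma X_step:
  assumes "s n \<le> 1" "cis (2 * \<theta> + \<kappa>) \<noteq> 1"
  shows "\<bar>Re (cis (\<kappa> * real (n + 1)) * (\<zeta> (n + 1))\<^sup>2) - (X \<kappa> (n + 1) - X \<kappa> n)\<bar>
    \<le> 31 * (s n * A (n + 1)) / cmod (\<Phi> \<kappa>)"
proof -
  obtain err where err: "(\<zeta> (n + 1))\<^sup>2 = cis (2 * \<theta>) * (\<zeta> n)\<^sup>2 + err" "cmod err \<le> 31 * (s n * A (n + 1))"
    using zeta_sq_step[OF assms(1)] by blast
  have "\<kappa> * real (n + 1) = \<kappa> * real n + \<kappa>" by (simp add: algebra_simps)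
  from oscillation_corrector[OF err(1) this assms(2)]
  show ?thesis unfolding X_def \<Phi>_def
    by (rule order_trans) (intro divide_right_mono err(2) norm_ge_zero)
qed

lemma abs_X_le: "\<bar>X \<kappa> n\<bar> \<le> 2 / cmod (\<Phi> \<kappa>) * A n"
proof -
  have "\<bar>X \<kappa> n\<bar> \<le> (cmod (\<zeta> n))\<^sup>2 / cmod (\<Phi> \<kappa>)"
    unfolding X_def by (rule order_trans[OF abs_Re_le_cmod]) (simp add: norm_divide norm_mult norm_power)
  also have "\<dots> \<le> 2 * A n / cmod (\<Phi> \<kappa>)" by (intro divide_right_mono cmod_zeta_sq_le norm_ge_zero)
  finally show ?thesis by simp
qed

lemma abs_c_le: "\<bar>c n\<bar> \<le> C1 * A n"
proof -
  have "\<bar>X (- k) n - X k n\<bar> \<le> 2 / cmod (\<Phi> (- k)) * A n + 2 / cmod (\<Phi> k) * A n"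
    using abs_X_le[of "- k" n] abs_X_le[of k n] by linarith
  then have "\<bar>w\<bar> / (2 * sin \<theta>) * \<bar>X (- k) n - X k n\<bar>
      \<le> \<bar>w\<bar> / (2 * sin \<theta>) * (2 / cmod (\<Phi> (- k)) * A n + 2 / cmod (\<Phi> k) * A n)"
    using sin_pos by (intro mult_left_mono) auto
  moreover have "\<bar>c n\<bar> = \<bar>w\<bar> / (2 * sin \<theta>) * \<bar>X (- k) n - X k n\<bar>"
    using sin_pos by (simp add: c_def abs_mult)
  ultimately show ?thesis by (simp only: C1_def distrib_right mult.assoc)
qed

text \<open>Multiply the recurrence by \<open>u (n + 2) - u n\<close>.\<close>

lemma G_step: "G (n + 1) - G n = W (n + 1) * u (n + 1) * (u (n + 2) - u n) + (V n - V (n + 1)) * u n * u (n + 1)"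
proof -
  have "u (n + 2) + u n = (2 * cos \<theta> + V (n + 1) + W (n + 1)) * u (n + 1)"
    using rec'[of n] by (simp add: q_def)
  then have "(u (n + 2) - u n) * (u (n + 2) + u n) = (u (n + 2) - u n) * ((2 * cos \<theta> + V (n + 1) + W (n + 1)) * u (n + 1))"
    by simp
  then show ?thesis
    by (simp add: G_def power2_eq_square algebra_simps numeral_2_eq_2[symmetric])
qed

text \<open>As \<open>sin \<theta> * u n\<close> is the imaginary part of \<open>\<zeta> n\<close>, the product with its real part is \<open>Im (\<zeta>\<^sup>2) / 2\<close>; the product formula
  for sines then separates the two phases.\<close>

lemma W_term:
  "W n * u n * (2 * Re (\<zeta> n)) = w / (2 * sin \<theta>) * (Re (cis (- k * real n) * (\<zeta> n)\<^sup>2) - Re (cis (k * real n) * (\<zeta> n)\<^sup>2)) / real n"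
proof -
  have "u n = Im (\<zeta> n) / sin \<theta>" using sin_pos by (simp add: \<zeta>_def)
  then show ?thesis using sin_pos by (cases "n = 0") (simp_all add: W_def power2_eq_square field_simps)
qed

text \<open>The errors come from the correction in both phases, from the product of \<open>W\<close> with the whole potential, from
  the difference of \<open>V\<close>, and from \<open>c n (1/n - 1/(n + 1))\<close>. Each is \<open>o(1/n)\<close> times the size of the solution.\<close>

lemma T_step:
  assumes "s n \<le> 1" "1 \<le> n"
  shows "\<bar>T (n + 1) - T n\<bar> \<le> (19 + \<bar>w\<bar> + 31 * C1 + 38 * C1) * (s n * A (n + 1)) / real (n + 1)"
proof -
  let ?m = "real (n + 1)" and ?sA = "s n * A (n + 1)"
  let ?Re = "\<lambda>\<kappa>. Re (cis (\<kappa> * real (n + 1)) * (\<zeta> (n + 1))\<^sup>2)"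
  let ?e = "w / (2 * sin \<theta>) * ((?Re (- k) - (X (- k) (n + 1) - X (- k) n)) - (?Re k - (X k (n + 1) - X k n)))"
  have e: "\<bar>?e\<bar> \<le> 31 * C1 * ?sA"
  proof -
    have "\<bar>(?Re (- k) - (X (- k) (n + 1) - X (- k) n)) - (?Re k - (X k (n + 1) - X k n))\<bar>
        \<le> 31 * ?sA / cmod (\<Phi> (- k)) + 31 * ?sA / cmod (\<Phi> k)"
      using X_step[OF assms(1), of "- k"] X_step[OF assms(1), of k] nonres by simp
    also have "\<dots> \<le> (2 / cmod (\<Phi> (- k)) + 2 / cmod (\<Phi> k)) * (31 * ?sA)"
      using s_bounds(4)[of n] A_nonneg[of "n + 1"] by (simp add: field_simps add_mono divide_right_mono)
    finally have "\<bar>?e\<bar> \<le> \<bar>w\<bar> / (2 * sin \<theta>) * ((2 / cmod (\<Phi> (- k)) + 2 / cmod (\<Phi> k)) * (31 * ?sA))"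
      unfolding abs_mult[of "w / _"] using sin_pos by (intro mult_mono) simp_all
    then show ?thesis by (simp add: C1_def mult_ac)
  qed
  have "W (n + 1) * u (n + 1) * (u (n + 2) - u n)
      = W (n + 1) * u (n + 1) * (2 * Re (\<zeta> (n + 1))) - W (n + 1) * q (n + 1) * (u (n + 1))\<^sup>2"
  proof -
    have "u (n + 2) - u n = 2 * Re (\<zeta> (n + 1)) - q (n + 1) * u (n + 1)"
      using rec'[of n] by (simp add: \<zeta>_def algebra_simps)
    then show ?thesis by (simp only:) (simp add: power2_eq_square algebra_simps)
  qed
  also have "W (n + 1) * u (n + 1) * (2 * Re (\<zeta> (n + 1))) = (c (n + 1) - c n + ?e) / ?m"
    unfolding W_term c_def by (simp add: algebra_simps)
  finally have W: "W (n + 1) * u (n + 1) * (u (n + 2) - u n)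
      = (c (n + 1) - c n + ?e) / ?m - W (n + 1) * q (n + 1) * (u (n + 1))\<^sup>2" .
  have "c n / real n - c n / ?m = c n / (real n * ?m)"
    using assms(2) by (simp add: field_simps)
  then have split: "T (n + 1) - T n = ?e / ?m - W (n + 1) * q (n + 1) * (u (n + 1))\<^sup>2
      + (V n - V (n + 1)) * u n * u (n + 1) + c n / (real n * ?m)"
    using G_step[of n] unfolding W T_def by (simp add: add_divide_distrib diff_divide_distrib)
  have e1: "\<bar>?e / ?m\<bar> \<le> 31 * C1 * ?sA / ?m"
    unfolding abs_divide[of _ ?m] abs_of_nat by (rule divide_right_mono[OF e]) simp
  have e2: "\<bar>W (n + 1) * q (n + 1) * (u (n + 1))\<^sup>2\<bar> \<le> \<bar>w\<bar> * ?sA / ?m"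
  proof -
    have "\<bar>W (n + 1)\<bar> \<le> \<bar>w\<bar> / ?m"
      by (auto simp: W_def abs_mult intro!: divide_right_mono mult_left_le)
    then have "\<bar>W (n + 1)\<bar> * (\<bar>q (n + 1)\<bar> * (u (n + 1))\<^sup>2) \<le> \<bar>w\<bar> / ?m * (s n * A (n + 1))"
      by (intro mult_mono s_bounds abs_mult_le_A) (auto simp: s_bounds(4))
    then show ?thesis by (simp add: abs_mult)
  qed
  have e3: "\<bar>(V n - V (n + 1)) * u n * u (n + 1)\<bar> \<le> 19 * ?sA / ?m"
  proof -
    have "\<bar>u n * u (n + 1)\<bar> \<le> 19 * A (n + 1)"
      using abs_mult_le_A(3)[of n] A_back[OF assms(1)] A_nonneg[of "n + 1"] by linarith
    then have "\<bar>V (n + 1) - V n\<bar> * \<bar>u n * u (n + 1)\<bar> \<le> s n / ?m * (19 * A (n + 1))"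
      by (intro mult_mono s_bounds) (auto simp: s_bounds(4))
    then show ?thesis by (simp add: abs_mult abs_minus_commute mult_ac)
  qed
  have e4: "\<bar>c n / (real n * ?m)\<bar> \<le> 38 * C1 * ?sA / ?m"
  proof -
    have C1: "0 \<le> C1" using sin_pos by (simp add: C1_def)
    have "\<bar>c n\<bar> \<le> C1 * (19 * A (n + 1))"
      by (rule order_trans[OF abs_c_le mult_left_mono[OF A_back[OF assms(1)] C1]])
    moreover have "1 / real n \<le> 2 * s n"
    proof -
      have "1 / real n \<le> 2 * (1 / ?m)" using assms(2) by (simp add: field_simps)
      then show ?thesis using s_bounds(3)[of n] by linarith
    qed
    ultimately have "\<bar>c n\<bar> * (1 / real n) \<le> C1 * (19 * A (n + 1)) * (2 * s n)"
      by (intro mult_mono) (auto simp: C1 A_nonneg)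
    then have "\<bar>c n\<bar> * (1 / real n) / ?m \<le> 38 * C1 * ?sA / ?m"
      by (intro divide_right_mono) (auto simp: mult_ac)
    then show ?thesis by (simp add: abs_divide abs_mult)
  qed
  have "\<bar>T (n + 1) - T n\<bar> \<le> 31 * C1 * ?sA / ?m + \<bar>w\<bar> * ?sA / ?m + 19 * ?sA / ?m + 38 * C1 * ?sA / ?m"
  proof -
    have "\<bar>x1 - x2 + x3 + x4\<bar> \<le> y1 + y2 + y3 + y4"
      if "\<bar>x1\<bar> \<le> y1" "\<bar>x2\<bar> \<le> y2" "\<bar>x3\<bar> \<le> y3" "\<bar>x4\<bar> \<le> y4" for x1 x2 x3 x4 y1 y2 y3 y4 :: real
      using that by linarith
    from this[OF e1 e2 e3 e4] show ?thesis unfolding split .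
  qed
  also have "\<dots> = (19 + \<bar>w\<bar> + 31 * C1 + 38 * C1) * ?sA / ?m"
    unfolding add_divide_distrib[symmetric] by (simp add: algebra_simps)
  finally show ?thesis .
qed

lemma G_bounds:
  assumes "\<bar>V n\<bar> \<le> 1 - \<bar>cos \<theta>\<bar>"
  shows "(1 - \<bar>cos \<theta>\<bar>) / 2 * A n \<le> G n" "G n \<le> 2 * A n"
proof -
  have "\<bar>2 * cos \<theta> + V n\<bar> \<le> 1 + \<bar>cos \<theta>\<bar>" using assms by linarith
  then have "\<bar>2 * cos \<theta> + V n\<bar> * \<bar>u n * u (n + 1)\<bar> \<le> (1 + \<bar>cos \<theta>\<bar>) * (A n / 2)"
    by (intro mult_mono abs_mult_le_A) auto
  then have *: "\<bar>(2 * cos \<theta> + V n) * u n * u (n + 1)\<bar> \<le> (1 + \<bar>cos \<theta>\<bar>) * (A n / 2)"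
    by (simp add: abs_mult mult.assoc)
  have G: "G n = A n - (2 * cos \<theta> + V n) * u n * u (n + 1)" by (simp add: G_def A_def)
  have "(1 - \<bar>cos \<theta>\<bar>) / 2 * A n = A n - (1 + \<bar>cos \<theta>\<bar>) * (A n / 2)" by (simp add: field_simps)
  then show "(1 - \<bar>cos \<theta>\<bar>) / 2 * A n \<le> G n" using * unfolding G by linarith
  have "(1 + \<bar>cos \<theta>\<bar>) * (A n / 2) \<le> 2 * (A n / 2)"
    using abs_cos_le_one[of \<theta>] A_nonneg[of n] by (intro mult_right_mono) auto
  then show "G n \<le> 2 * A n" using * unfolding G by linarith
qed

text \<open>For large \<open>n\<close> the corrected form \<open>T\<close> is comparable to \<open>A\<close> and changes by a factor of at most \<open>1 + 1/(2 n + 2)\<close>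
  when going back one step, so \<open>n T n\<close> increases. If the solution did not vanish, \<open>T\<close> would dominate a
  multiple of the harmonic series.\<close>

lemma square_summable_vanishes:
  assumes summ: "summable (\<lambda>n. (u n)\<^sup>2)"
  shows "\<exists>N. u N = 0 \<and> u (N + 1) = 0"
proof (rule ccontr)
  assume neg: "\<not> ?thesis"
  define \<delta> where "\<delta> = (1 - \<bar>cos \<theta>\<bar>) / 4"
  have "(cos \<theta>)\<^sup>2 < 1" using sin_cos_squared_add[of \<theta>] sin_pos zero_less_power[of "sin \<theta>" 2] by linarith
  then have \<delta>: "0 < \<delta>" by (simp add: \<delta>_def abs_square_less_1)
  define K where "K = 19 + \<bar>w\<bar> + 31 * C1 + 38 * C1"
  have C1: "0 \<le> C1" using sin_pos by (simp add: C1_def)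
  have K: "0 < K" using C1 by (simp add: K_def)
  have "\<forall>\<^sub>F n in sequentially. \<bar>V n\<bar> < 4 * \<delta>"
    using tendstoD[OF V, of "4 * \<delta>"] \<delta> by (simp add: dist_real_def)
  moreover have "\<forall>\<^sub>F n in sequentially. s n < min 1 (\<delta> / (2 * K))"
    using order_tendstoD(2)[OF s_tendsto_0, of "min 1 (\<delta> / (2 * K))"] \<delta> K by simp
  moreover have "\<forall>\<^sub>F n in sequentially. C1 / real n < \<delta>"
    using order_tendstoD(2)[OF lim_const_over_n \<delta>] .
  moreover have "\<forall>\<^sub>F n in sequentially. 1 \<le> n" by (rule eventually_ge_at_top)
  ultimately have "\<forall>\<^sub>F n in sequentially. \<bar>V n\<bar> < 4 * \<delta> \<and> s n < min 1 (\<delta> / (2 * K)) \<and> C1 / real n < \<delta> \<and> 1 \<le> n"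
    by eventually_elim blast
  then obtain N where N: "\<And>n. N \<le> n \<Longrightarrow> \<bar>V n\<bar> < 4 * \<delta>" "\<And>n. N \<le> n \<Longrightarrow> s n < 1"
    "\<And>n. N \<le> n \<Longrightarrow> s n < \<delta> / (2 * K)" "\<And>n. N \<le> n \<Longrightarrow> C1 / real n < \<delta>" "\<And>n. N \<le> n \<Longrightarrow> 1 \<le> n"
    unfolding eventually_sequentially by auto
  have c: "\<bar>c n / real n\<bar> \<le> \<delta> * A n" if "N \<le> n" for n
  proof -
    have "\<bar>c n / real n\<bar> \<le> C1 * A n / real n" using abs_c_le[of n] by (simp add: divide_right_mono)
    also have "\<dots> = C1 / real n * A n" by simp
    also have "\<dots> \<le> \<delta> * A n" using N(4)[OF that] A_nonneg by (intro mult_right_mono) auto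
    finally show ?thesis .
  qed
  have low: "\<delta> * A n \<le> T n" and up: "T n \<le> (2 + \<delta>) * A n" if "N \<le> n" for n
  proof -
    have "\<bar>V n\<bar> \<le> 1 - \<bar>cos \<theta>\<bar>" using N(1)[OF that] by (simp add: \<delta>_def)
    note G = G_bounds[OF this]
    have "(1 - \<bar>cos \<theta>\<bar>) / 2 * A n = 2 * (\<delta> * A n)" by (simp add: \<delta>_def)
    then show "\<delta> * A n \<le> T n" "T n \<le> (2 + \<delta>) * A n"
      using G c[OF that] A_nonneg[of n] mult_nonneg_nonneg[of \<delta> "A n"] \<delta>
      unfolding T_def abs_le_iff distrib_right by linarith+
  qed
  have mono: "real n * T n \<le> real (n + 1) * T (n + 1)" if n: "N \<le> n" for n
  proof -
    have T1: "\<delta> * A (n + 1) \<le> T (n + 1)" using low[of "n + 1"] n by simp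
    have "0 \<le> \<delta> * A (n + 1)" using \<delta> A_nonneg by simp
    then have T0: "0 \<le> T (n + 1)" using T1 by linarith
    have "\<bar>T (n + 1) - T n\<bar> \<le> K * (s n * A (n + 1)) / real (n + 1)"
      using T_step[of n] N(2,5)[OF n] by (simp add: K_def)
    also have "\<dots> \<le> (1/2) * T (n + 1) / real (n + 1)"
    proof (intro divide_right_mono)
      have "K * s n \<le> \<delta> / 2" using N(3)[OF n] K by (simp add: field_simps)
      then have "K * s n * A (n + 1) \<le> \<delta> / 2 * A (n + 1)" by (intro mult_right_mono A_nonneg)
      then show "K * (s n * A (n + 1)) \<le> (1/2) * T (n + 1)" using T1 by (simp add: mult.assoc)
    qed simp
    finally have "T n \<le> T (n + 1) + (1/2) * T (n + 1) / real (n + 1)" by linarith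
    then have "real n * T n \<le> real n * (T (n + 1) + (1/2) * T (n + 1) / real (n + 1))"
      by (intro mult_left_mono) auto
    also have "\<dots> = real n * T (n + 1) + (real n / real (n + 1)) * ((1/2) * T (n + 1))"
      by (simp add: distrib_left)
    also have "\<dots> \<le> real n * T (n + 1) + 1 * ((1/2) * T (n + 1))"
      using T0 by (intro add_left_mono mult_right_mono) auto
    also have "\<dots> \<le> real (n + 1) * T (n + 1)" using T0 by (simp add: distrib_right)
    finally show ?thesis .
  qed
  define g where "g = real N * T N"
  have "0 < A N"
  proof -
    have "u N \<noteq> 0 \<or> u (N + 1) \<noteq> 0" using neg by blast
    then show ?thesis unfolding A_def by (auto simp: add_pos_nonneg add_nonneg_pos)
  qed
  then have "0 < \<delta> * A N" using \<delta> by simp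
  then have g: "0 < g" using low[of N] N(5)[of N] by (simp add: g_def)
  have grow: "g \<le> real n * T n" if "N \<le> n" for n
    using that
  proof (induction n rule: dec_induct)
    case (step n)
    then show ?case using mono[of n] by simp
  qed (simp add: g_def)
  have "summable (\<lambda>n. (2 + \<delta>) * A n)"
    unfolding A_def using summ summable_ignore_initial_segment[OF summ, of 1]
    by (intro summable_mult summable_add) auto
  then have "summable (\<lambda>n. g * inverse (real n))"
  proof (rule summable_comparison_test[rotated], intro exI allI impI)
    fix n assume n: "N \<le> n"
    then have "0 < real n" using N(5)[of n] by simp
    then have "g * inverse (real n) \<le> T n" using grow[OF n] by (simp add: field_simps)
    then show "norm (g * inverse (real n)) \<le> (2 + \<delta>) * A n" using up[OF n] g by simp
  qed
  then have "summable (\<lambda>n. inverse g * (g * inverse (real n)))" by (rule summable_mult)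
  then have "summable (\<lambda>n. inverse (real n))" using g by (simp add: mult.assoc[symmetric])
  then show False using not_summable_harmonic[where 'a = real] by simp
qed

end

section \<open>The logarithmic rate\<close>

lemma iter_ln_at_top: "filterlim (iter_ln (Suc j)) at_top at_top"
proof (induction j)
  case 0
  have "filterlim (\<lambda>x::real. ln (1 + x)) at_top at_top"
    by (intro filterlim_compose[OF ln_at_top] filterlim_tendsto_add_at_top[OF tendsto_const] filterlim_ident)
  then show ?case by simp
next
  case (Suc j)
  have "filterlim (\<lambda>x. ln (1 + iter_ln (Suc j) x)) at_top at_top"
    by (intro filterlim_compose[OF ln_at_top] filterlim_tendsto_add_at_top[OF tendsto_const] Suc)
  then show ?case by simp
qed

text \<open>All iterated logarithms up to level \<open>m\<close> eventually exceed 1, so the product is at most 1, while the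
  remaining factor has the negative exponent \<open>- q\<close>.\<close>

lemma log_rate_tendsto_0:
  assumes "0 \<le> r" "r < q"
  shows "(log_rate m q r \<longlongrightarrow> 0) at_top"
proof (rule Lim_null_comparison)
  show "((\<lambda>x. iter_ln (m + 1) x powr (- q)) \<longlongrightarrow> 0) at_top"
    using assms iter_ln_at_top[of m] by (intro tendsto_neg_powr) auto
  have "\<forall>\<^sub>F x in at_top. 1 \<le> iter_ln j x" for j
    using iter_ln_at_top by (cases j) (auto simp: filterlim_at_top)
  then have "\<forall>\<^sub>F x in at_top. \<forall>j\<in>{0..m}. 1 \<le> iter_ln j x"
    by (intro eventually_ball_finite) auto
  then show "\<forall>\<^sub>F x in at_top. norm (log_rate m q r x) \<le> iter_ln (m + 1) x powr (- q)"
  proof (rule eventually_mono)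
    fix x assume x: "\<forall>j\<in>{0..m}. 1 \<le> iter_ln j x"
    have "(\<Prod>j=0..m. iter_ln j x powr (- r)) \<le> 1"
      using x assms by (intro prod_le_1 conjI powr_neg_le_1) auto
    moreover have "0 \<le> (\<Prod>j=0..m. iter_ln j x powr (- r))" by (intro prod_nonneg) auto
    ultimately show "norm (log_rate m q r x) \<le> iter_ln (m + 1) x powr (- q)"
      unfolding log_rate_def real_norm_def abs_mult by (simp add: mult_left_le)
  qed
qed

lemma bigo_log_rate_tendsto_0:
  assumes "f \<in> O[at_inf_lattice](\<lambda>n. log_rate m q r (lnorm n))" "0 \<le> r" "r < q"
  shows "(f \<longlongrightarrow> (0::real)) at_inf_lattice"
proof -
  obtain C where C: "\<forall>\<^sub>F n in at_inf_lattice. norm (f n) \<le> C * norm (log_rate m q r (lnorm n))"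
    using assms(1) by (auto elim: landau_o.bigE)
  have "((\<lambda>n. C * norm (log_rate m q r (lnorm n))) \<longlongrightarrow> C * norm (0::real)) at_inf_lattice"
    by (intro tendsto_intros filterlim_compose[OF log_rate_tendsto_0[OF assms(2,3)] lnorm_at_top])
  then show ?thesis by (intro Lim_null_comparison[OF C]) simp
qed

section \<open>Dimension one\<close>

lemma two_term_recurrence_zero:
  fixes U :: "int \<Rightarrow> real"
  assumes rec: "\<And>n. U (n + 1) + U (n - 1) = p n * U n" and "U N = 0" "U (N + 1) = 0"
  shows "U n = 0"
proof -
  have "U n = 0 \<and> U (n + 1) = 0"
  proof (induction n rule: int_induct[where k = N])
    case (step1 n)
    then show ?case using rec[of "n + 1"] by simp
  next
    case (step2 n)
    then show ?case using rec[of n] by simp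
  qed (use assms in auto)
  then show ?thesis by simp
qed

text \<open>A resonance \<open>2 \<theta> = - \<kappa>\<close> modulo \<open>2 \<pi>\<close> forces \<open>cos (2 \<theta>) = cos k\<close>; the two square roots correspond to \<open>E_minus k\<close>
  and \<open>E_plus k\<close>.\<close>

lemma nonresonant_angle:
  assumes "cis (2 * \<theta> + \<kappa>) = 1" "\<bar>\<kappa>\<bar> = \<bar>k\<bar>"
  shows "cos \<theta> = cos (k/2) \<or> cos \<theta> = - cos (k/2)"
proof -
  have "cis (2 * \<theta>) = cis (2 * \<theta> + \<kappa>) * cis (- \<kappa>)" by (simp add: cis_mult)
  then have "cis (2 * \<theta>) = cis (- \<kappa>)" using assms(1) by simp
  then have "cos (2 * \<theta>) = cos \<kappa>" by (simp add: complex_eq_iff)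
  also have "cos \<kappa> = cos (2 * (k/2))" using assms(2) cos_abs_real[of \<kappa>] cos_abs_real[of k] by simp
  finally have "(cos \<theta>)\<^sup>2 = (cos (k/2))\<^sup>2" unfolding cos_double_cos by simp
  then show ?thesis by (simp add: power2_eq_iff)
qed

text \<open>The half-line result applies to the real and to the imaginary part of an eigenfunction. Two
  consecutive zeros then propagate to the whole line through the recurrence.\<close>

lemma no_eigenfunctions_dim_1:
  fixes V :: "int ^ 'd::finite \<Rightarrow> real"
  assumes card: "CARD('d) = 1"
    and V: "(V \<longlongrightarrow> 0) at_inf_lattice"
    and dV: "\<And>i. ((\<lambda>n. of_int (n $ i) * (V n - V (n - unit i))) \<longlongrightarrow> 0) at_inf_lattice"
    and nu: "0 < \<nu>" "\<nu> < 4" "\<nu> \<noteq> E_minus k" "\<nu> \<noteq> E_plus k"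
    and psi: "\<psi> \<in> eigenspace (hamiltonian V w k) \<nu>"
  shows "\<psi> = 0"
proof -
  obtain i where i: "(UNIV :: 'd set) = {i}" using card by (rule card_1_singletonE)
  have all_i: "j = i" for j :: 'd using i by blast
  define emb :: "int \<Rightarrow> int ^ 'd" where "emb n = (\<chi> j. n)" for n
  have emb_i: "emb n $ i = n" for n by (simp add: emb_def)
  have emb: "n = emb (n $ i)" for n :: "int ^ 'd"
  proof -
    have "n $ j = n $ i" for j using all_i[of j] by simp
    then show ?thesis by (simp add: emb_def vec_eq_iff)
  qed
  have emb_unit: "emb n - unit i = emb (n - 1)" "emb n + unit i = emb (n + 1)" for n
  proof -
    have "unit i $ j = (1 :: int)" for j using all_i[of j] by (simp add: axis_nth)
    then show "emb n - unit i = emb (n - 1)" "emb n + unit i = emb (n + 1)"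
      by (simp_all add: emb_def vec_eq_iff)
  qed
  have lnorm_emb: "lnorm (emb n) = \<bar>real_of_int n\<bar>" for n
    by (simp add: lnorm_def i emb_i)
  have emb_lim: "filterlim (\<lambda>n. emb (int n)) at_inf_lattice sequentially"
    unfolding at_inf_lattice_def filterlim_filtercomap_iff o_def
    by (simp add: lnorm_emb filterlim_real_sequentially)
  define Vn where "Vn n = V (emb (int n))" for n
  have Vn: "Vn \<longlonglongrightarrow> 0"
    unfolding Vn_def by (rule filterlim_compose[OF V emb_lim])
  have "(\<lambda>n. of_int (emb (int n) $ i) * (V (emb (int n)) - V (emb (int n) - unit i))) \<longlonglongrightarrow> 0"
    by (rule filterlim_compose[OF dV emb_lim])
  from LIMSEQ_ignore_initial_segment[OF this, of 1]
  have dVn: "(\<lambda>n. real (n + 1) * (Vn (n + 1) - Vn n)) \<longlonglongrightarrow> 0"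
    by (simp add: emb_unit emb_i Vn_def)
  define \<theta> where "\<theta> = arccos ((2 - \<nu>) / 2)"
  have cos_th: "2 * cos \<theta> = 2 - \<nu>" and sin_th: "0 < sin \<theta>"
  proof -
    have b: "-1 < (2 - \<nu>) / 2" "(2 - \<nu>) / 2 < 1" using nu by (auto simp: field_simps)
    then show "2 * cos \<theta> = 2 - \<nu>" by (simp add: \<theta>_def)
    show "0 < sin \<theta>" unfolding \<theta>_def using arccos_lt_bounded[OF b] by (intro sin_gt_zero) auto
  qed
  have nonres: "cis (2 * \<theta> + \<kappa>) \<noteq> 1" if "\<bar>\<kappa>\<bar> = \<bar>k\<bar>" for \<kappa>
    using nonresonant_angle[OF _ that, of \<theta>] cos_th nu(3,4) by (auto simp: E_minus_def E_plus_def)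
  have eig: "hamiltonian V w k \<psi> n = of_real \<nu> * \<psi> n" for n
    using psi by (simp add: eigenspace_def cscale_def)
  define p where "p n = 2 - \<nu> + (V (emb n) + wigner_von_neumann w k (emb n))" for n
  have eq: "\<psi> (emb (n + 1)) + \<psi> (emb (n - 1)) = of_real (p n) * \<psi> (emb n)" for n
    using eig[of "emb n"]
    by (simp add: hamiltonian_def laplacian_def shift_def shift_adj_def mult_op_def i emb_unit p_def algebra_simps)
  have Wn: "wigner_von_neumann w k (emb (int n)) = w * sin (k * real n) / real n" for n
    by (simp add: wvn_eq lnorm_emb phase_def i emb_i)
  have summ: "(\<lambda>n. (cmod (\<psi> (emb (int n))))\<^sup>2) summable_on UNIV"
  proof -
    have "inj (\<lambda>n. emb (int n))" by (rule injI) (metis emb_i of_nat_eq_iff)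
    moreover have "(\<lambda>n. (cmod (\<psi> n))\<^sup>2) summable_on range (\<lambda>n. emb (int n))"
      by (rule summable_on_subset_banach[of _ UNIV]) (use psi in \<open>auto simp: eigenspace_def ell2_def\<close>)
    ultimately show ?thesis by (simp add: summable_on_reindex o_def)
  qed
  have vanish: "g (\<psi> (emb n)) = 0"
    if g: "\<And>z z'. g (z + z') = g z + g z'" "\<And>a z. g (of_real a * z) = a * g z" "\<And>z. \<bar>g z\<bar> \<le> cmod z"
    for g :: "complex \<Rightarrow> real" and n
  proof -
    have recurrence: "g (\<psi> (emb (n + 1))) + g (\<psi> (emb (n - 1))) = p n * g (\<psi> (emb n))" for n
      using arg_cong[OF eq[of n], of g] by (simp only: g)
    define u where "u n = g (\<psi> (emb (int n)))" for n
    interpret halfline u Vn w k \<theta>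
    proof
      show "cis (2 * \<theta> + k) \<noteq> 1" "cis (2 * \<theta> - k) \<noteq> 1"
        using nonres[of k] nonres[of "- k"] by simp_all
      show "u (n + 2) = (2 * cos \<theta> + (Vn (n + 1) + w * sin (k * real (n + 1)) / real (n + 1))) * u (n + 1) - u n" for n
        using recurrence[of "int (n + 1)"] unfolding p_def Wn cos_th by (simp add: u_def Vn_def algebra_simps)
    qed (use sin_th Vn dVn in auto)
    have "summable (\<lambda>n. (cmod (\<psi> (emb (int n))))\<^sup>2)"
      using summ by (simp add: summable_on_UNIV_nonneg_real_iff)
    then have "summable (\<lambda>n. (u n)\<^sup>2)"
    proof (rule summable_comparison_test[rotated], intro exI allI impI)
      show "norm ((u n)\<^sup>2) \<le> (cmod (\<psi> (emb (int n))))\<^sup>2" for n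
        using power_mono[OF g(3)[of "\<psi> (emb (int n))"] abs_ge_zero, of 2] by (simp add: u_def)
    qed
    from square_summable_vanishes[OF this] obtain N where "u N = 0" "u (N + 1) = 0" by blast
    then show "g (\<psi> (emb n)) = 0"
      using two_term_recurrence_zero[of "\<lambda>n. g (\<psi> (emb n))" p "int N" n, OF recurrence]
      by (simp add: u_def add.commute)
  qed
  show ?thesis
  proof
    fix n
    have "Re (\<psi> (emb (n $ i))) = 0" "Im (\<psi> (emb (n $ i))) = 0"
      by (rule vanish; simp add: abs_Re_le_cmod abs_Im_le_cmod)+
    then show "\<psi> n = 0 n" using emb[of n] by (simp add: complex_eq_iff)
  qed
qed

section \<open>Eigenvalues in the set of admissible energies\<close>

lemma E_edge_eq:
  assumes "0 < k" "k < 2 * pi"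
  shows "E_edge k = 4 * (1 - \<bar>cos (k/2)\<bar>)"
proof (cases "k < pi")
  case True
  then have "0 \<le> cos (k/2)" using assms by (intro cos_ge_zero) auto
  then show ?thesis using True by (simp add: E_edge_def E_minus_def)
next
  case False
  then have "0 \<le> cos (pi - k/2)" using assms by (intro cos_ge_zero) auto
  then have "cos (k/2) \<le> 0" by simp
  then show ?thesis using False by (simp add: E_edge_def E_plus_def)
qed

lemma cos_half_nonzero:
  assumes "0 < k" "k < 2 * pi" "k \<noteq> pi"
  shows "cos (k/2) \<noteq> 0"
proof
  assume "cos (k/2) = 0"
  then have "cos (k/2) = cos (pi/2)" by (simp only: cos_pi_half)
  from cos_inj_pi[OF _ _ _ _ this] have "k/2 = pi/2" using assms(1,2) by simp
  then show False using assms(3) by simp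
qed

text \<open>In terms of \<open>|cos (k/2)|\<close> the edge is \<open>4 (1 - |cos (k/2)|)\<close>. For \<open>d \<ge> 2\<close> this is at most \<open>2 d (1 - |cos (k/2)|)\<close>,
  the threshold of the nonresonance estimate, and it is below 4 because \<open>k \<noteq> \<pi>\<close>.\<close>

lemma mu_H_below_resonance:
  assumes "0 < k" "k < 2 * pi" "k \<noteq> pi" "d \<noteq> 1" "0 < d" "E \<in> mu_H d k"
  shows "below_resonance d k E \<or> below_resonance d k (4 * real d - E)"
proof -
  have "below_resonance d k E" if "0 < E" "E < E_edge k" for E
  proof -
    have c: "0 < \<bar>cos (k/2)\<bar>" "\<bar>cos (k/2)\<bar> \<le> 1" using cos_half_nonzero[OF assms(1-3)] by auto
    have "2 \<le> real d" using assms(4,5) by linarith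
    then have "4 * (1 - \<bar>cos (k/2)\<bar>) \<le> 2 * real d * (1 - \<bar>cos (k/2)\<bar>)" using c by (intro mult_right_mono) auto
    moreover have "E < 4 * (1 - \<bar>cos (k/2)\<bar>)" using that(2) E_edge_eq[OF assms(1,2)] by simp
    moreover have "4 * (1 - \<bar>cos (k/2)\<bar>) < 4" using c by simp
    ultimately show ?thesis using that(1) unfolding below_resonance_def
      by (intro conjI) (auto intro: less_le_trans less_trans)
  qed
  note below = this
  have "0 < E \<and> E < E_edge k \<or> 4 * real d - E_edge k < E \<and> E < 4 * real d"
    using assms(4,6) by (simp add: mu_H_def)
  then show ?thesis
  proof
    assume "0 < E \<and> E < E_edge k"
    then show ?thesis using below by blast
  next
    assume "4 * real d - E_edge k < E \<and> E < 4 * real d"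
    then have "0 < 4 * real d - E" "4 * real d - E < E_edge k" by linarith+
    then show ?thesis using below by blast
  qed
qed

theorem proposition1p1:
  fixes V :: "int ^ 'd \<Rightarrow> real" and w k q r E :: real and m :: nat
  assumes "0 < k" "k < 2 * pi" "k \<noteq> pi"
    and "bounded (range V)"
    and "0 \<le> r" "r < q"
    and "V \<in> O[at_inf_lattice](\<lambda>n. log_rate m q r (lnorm n))"
    and "\<And>i. (\<lambda>n. real_of_int (n $ i) * (V n - shift i V n))
               \<in> O[at_inf_lattice](\<lambda>n. log_rate m q r (lnorm n))"
    and "E \<in> mu_H CARD('d) k"
  shows "(\<exists>I. open I \<and> is_interval I \<and> E \<in> I
            \<and> finitely_many_eigenvalues_in (hamiltonian V w k) I
            \<and> (\<forall>\<nu>\<in>I. \<forall>\<psi>\<in>eigenspace (hamiltonian V w k) \<nu>. decays_subexponentially \<psi>))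
       \<and> (CARD('d) = 1 \<longrightarrow>
            (\<forall>I. open I \<and> is_interval I \<and> E \<in> I \<and> I \<subseteq> {E_minus k<..<E_plus k}
               \<longrightarrow> point_spectrum (hamiltonian V w k) \<inter> I = {}))"
proof -
  let ?H = "hamiltonian V w k"
  have V: "(V \<longlongrightarrow> 0) at_inf_lattice"
    by (rule bigo_log_rate_tendsto_0[OF assms(7,5,6)])
  have dV: "((\<lambda>n. of_int (n $ i) * (V n - V (n - unit i))) \<longlongrightarrow> 0) at_inf_lattice" for i
    using bigo_log_rate_tendsto_0[OF assms(8,5,6)] by (simp add: shift_def)
  show ?thesis
  proof (cases "CARD('d) = 1")
    case True
    have none: "\<psi> = 0" if "\<nu> \<in> {0<..<4} - {E_minus k, E_plus k}" "\<psi> \<in> eigenspace ?H \<nu>" for \<nu> \<psi>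
      using no_eigenfunctions_dim_1[OF True V dV _ _ _ _ that(2)] that(1) by auto
    have no_spectrum: "point_spectrum ?H \<inter> I = {}" if "I \<subseteq> {0<..<4} - {E_minus k, E_plus k}" for I
      using that none unfolding point_spectrum_def by blast
    have "open ({0<..<4} - {E_minus k, E_plus k})" by (intro open_Diff) auto
    moreover have "E \<in> {0<..<4} - {E_minus k, E_plus k}" using assms(9) True by (simp add: mu_H_def)
    ultimately obtain \<delta> where d: "0 < \<delta>" "ball E \<delta> \<subseteq> {0<..<4} - {E_minus k, E_plus k}"
      by (rule openE)
    have dec: "decays_subexponentially (0 :: int ^ 'd \<Rightarrow> complex)"
      unfolding decays_subexponentially_def by (intro exI[of _ 1] conjI bexI[of _ "1/2"]) auto
    have fin: "finitely_many_eigenvalues_in ?H (ball E \<delta>)"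
      unfolding finitely_many_eigenvalues_in_def no_spectrum[OF d(2)] by simp
    have decay: "\<forall>\<nu>\<in>ball E \<delta>. \<forall>\<psi>\<in>eigenspace ?H \<nu>. decays_subexponentially \<psi>"
    proof (intro ballI)
      fix \<nu> \<psi> assume "\<nu> \<in> ball E \<delta>" "\<psi> \<in> eigenspace ?H \<nu>"
      then have "\<psi> = 0" by (intro none[OF subsetD[OF d(2)]])
      then show "decays_subexponentially \<psi>" using dec by (simp only:)
    qed
    have empty: "point_spectrum ?H \<inter> I = {}" if "I \<subseteq> {E_minus k<..<E_plus k}" for I
    proof (rule no_spectrum)
      have "{E_minus k<..<E_plus k} \<subseteq> {0<..<4} - {E_minus k, E_plus k}"
      proof -
        have "0 \<le> E_minus k" "E_plus k \<le> 4" using cos_le_one[of "k/2"] by (simp_all add: E_minus_def E_plus_def)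
        then show ?thesis by auto
      qed
      then show "I \<subseteq> {0<..<4} - {E_minus k, E_plus k}" using that by blast
    qed
    have "open (ball E \<delta>)" "is_interval (ball E \<delta>)" "E \<in> ball E \<delta>"
      using d(1) by (simp_all add: is_interval_ball_real)
    with fin decay empty show ?thesis by (intro conjI exI[of _ "ball E \<delta>"] impI allI) blast+
  next
    case False
    have "below_resonance CARD('d) k E \<or> below_resonance CARD('d) k (4 * real CARD('d) - E)"
      by (rule mu_H_below_resonance[OF assms(1-3) False _ assms(9)]) simp
    from eigenfunction_estimate[OF V dV this, of w]
    obtain \<delta> C B where "0 < \<delta>" "finite B" and
      est: "\<And>\<nu> u. \<bar>\<nu> - E\<bar> < \<delta> \<Longrightarrow> u \<in> eigenspace ?H \<nu> \<Longrightarrow> concentrated C B u"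
      by blast
    have conc: "concentrated C B u" if "\<nu> \<in> ball E \<delta>" "u \<in> eigenspace ?H \<nu>" for \<nu> u
      using est[OF _ that(2)] that(1) by (simp add: dist_real_def abs_minus_commute)
    have "open (ball E \<delta>) \<and> is_interval (ball E \<delta>) \<and> E \<in> ball E \<delta>
        \<and> finitely_many_eigenvalues_in ?H (ball E \<delta>)
        \<and> (\<forall>\<nu>\<in>ball E \<delta>. \<forall>\<psi>\<in>eigenspace ?H \<nu>. decays_subexponentially \<psi>)"
    proof (intro conjI ballI)
      show "is_interval (ball E \<delta>)" by (rule is_interval_ball_real)
      show "E \<in> ball E \<delta>" using \<open>0 < \<delta>\<close> by simp
      show "finitely_many_eigenvalues_in ?H (ball E \<delta>)" 
        using \<open>finite B\<close> conc by (rule concentrated_eigenfunctions(1))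
      show "decays_subexponentially \<psi>" if "\<nu> \<in> ball E \<delta>" "\<psi> \<in> eigenspace ?H \<nu>" for \<nu> \<psi>
        using \<open>finite B\<close> conc that by (rule concentrated_eigenfunctions(2))
    qed simp
    then show ?thesis using False by blast
  qed
qed

end
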